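(* Let $n,N\in\mathbb{N}$, fix $p_j\in[1,2]$ for $j=1,\dots,N$, and let $a\in L^\infty S^m_\rho(n,N)$ with $0\le\rho\le1$ and $m<(\rho-1)\sum_{j=1}^N\frac{n}{p_j}$. Then there is a constant $C$, depending only on $n$, the $p_j$, $m$, $\rho$ and finitely many of the constants $C_\alpha$ of the symbol class, such that for all Schwartz functions $u_1,\dots,u_N$ \[ |T_a(u_1,\dots,u_N)(x)|\le C\prod_{j=1}^N M_{p_j}(u_j)(x)\quad\text{for all }x\in\mathbb{R}^n. \] Consequently, for $p_j<q_j\le\infty$ and $r>0$ with $\frac1r=\sum_{j=1}^N\frac1{q_j}$, $T_a$ is bounded from $L^{q_1}_{w_1}\times\dots\times L^{q_N}_{w_N}$ to $L^r_\mu$ whenever, for each $j$, $w_j\in A_{q_j/p_j}$ if $q_j<\infty$ and $w_j\equiv1$ if $q_j=\infty$, and $\mu=\prod_{j=1}^N w_j^{r/q_j}$.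
   Context: For $\Xi=(\xi_1,\dots,\xi_N)\in\mathbb{R}^{nN}$, $\langle\Xi\rangle=(1+|\Xi|^2)^{1/2}$. A symbol $a:\mathbb{R}^n\times\mathbb{R}^{nN}\to\mathbb{C}$ belongs to $L^\infty S^m_\rho(n,N)$ if for every multi-index $\alpha\in\mathbb{Z}_+^{nN}$ there is $C_\alpha$ with $\operatorname{ess\,sup}_x|\partial_\Xi^\alpha a(x,\Xi)|\le C_\alpha\langle\Xi\rangle^{m-\rho|\alpha|}$. For Schwartz functions $u_j$, $T_a(u_1,\dots,u_N)(x)=\int_{\mathbb{R}^{nN}}a(x,\Xi)\prod_{j=1}^N\widehat{u}_j(\xi_j)e^{ix\cdot\xi_j}\,d\Xi$, with $\widehat u(\xi)=\int u(y)e^{-i\xi\cdot y}dy$. $M_p(u)(x)=\sup_{B\ni x}\big(|B|^{-1}\int_B|u|^p\big)^{1/p}$ (supremum over balls). For a weight $w\ge0$, $L^p_w$ is the closure of the Schwartz class in the norm $(\int|u|^pw\,dx)^{1/p}$. $A_s$ ($1<s<\infty$) is the Muckenhoupt class: $\sup_B \big(|B|^{-1}\int_B w\big)\big(|B|^{-1}\int_B w^{-1/(s-1)}\big)^{s-1}<\infty$. Boundedness means a bound on Schwartz inputs, yielding a unique bounded extension.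
   Formalization: The pointwise inequality is proved for almost every x (for each choice of Schwartz functions) rather than all x, since the symbol class controls a only up to null sets in x and the bound can fail on a null set; r is taken to be a finite positive real. *)

theory Defs
  imports "HOL-Analysis.Analysis"
begin

text \<open>Iterated partial derivatives: derivative along the directions in a list
  (innermost derivative = last list element).  Multi-index derivatives
  correspond to lists of basis vectors; the order |alpha| is the length.\<close>
fun Dlist :: "'a::euclidean_space list \<Rightarrow> ('a \<Rightarrow> complex) \<Rightarrow> 'a \<Rightarrow> complex" where
  "Dlist [] f = f"
| "Dlist (v # vs) f = (\<lambda>y. frechet_derivative (Dlist vs f) (at y) v)"

definition smooth_fun :: "('a::euclidean_space \<Rightarrow> complex) \<Rightarrow> bool" where
  "smooth_fun f \<longleftrightarrow> (\<forall>vs. set vs \<subseteq> Basis \<longrightarrow> (\<forall>y. Dlist vs f differentiable (at y)))"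

definition jbr :: "'a::real_normed_vector \<Rightarrow> real" where
  "jbr X = sqrt (1 + (norm X)\<^sup>2)"

definition schwartz :: "('a::euclidean_space \<Rightarrow> complex) \<Rightarrow> bool" where
  "schwartz u \<longleftrightarrow> smooth_fun u \<and>
     (\<forall>vs (k::nat). set vs \<subseteq> Basis \<longrightarrow> (\<exists>C. \<forall>x. (1 + norm x) ^ k * norm (Dlist vs u x) \<le> C))"

definition fourier :: "('a::euclidean_space \<Rightarrow> complex) \<Rightarrow> 'a \<Rightarrow> complex" where
  "fourier u \<xi> = (\<integral>y. u y * cis (- (\<xi> \<bullet> y)) \<partial>lborel)"

definition symbol_class :: "real \<Rightarrow> real \<Rightarrow> (real^'n \<Rightarrow> (real^'n)^'N \<Rightarrow> complex) \<Rightarrow> bool" where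
  "symbol_class m \<rho> a \<longleftrightarrow>
     (\<lambda>z. a (fst z) (snd z)) \<in> borel_measurable lebesgue \<and>
     (AE x in lebesgue. smooth_fun (a x)) \<and>
     (\<forall>vs. set vs \<subseteq> Basis \<longrightarrow>
        (\<exists>C. AE x in lebesgue. \<forall>\<Xi>. norm (Dlist vs (a x) \<Xi>) \<le> C * jbr \<Xi> powr (m - \<rho> * real (length vs))))"

definition T_op :: "(real^'n \<Rightarrow> (real^'n)^'N \<Rightarrow> complex) \<Rightarrow> ('N::finite \<Rightarrow> real^'n \<Rightarrow> complex)
     \<Rightarrow> real^'n \<Rightarrow> complex" where
  "T_op a u x = (\<integral>\<Xi>. a x \<Xi> * (\<Prod>j\<in>UNIV. fourier (u j) (\<Xi> $ j) * cis (x \<bullet> (\<Xi> $ j))) \<partial>lborel)"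

definition enn_powr :: "ennreal \<Rightarrow> real \<Rightarrow> ennreal" where
  "enn_powr X e = (if X = \<infinity> then \<infinity> else ennreal (enn2real X powr e))"

definition maxfun :: "real \<Rightarrow> ('a::euclidean_space \<Rightarrow> complex) \<Rightarrow> 'a \<Rightarrow> ennreal" where
  "maxfun p u x = (SUP B \<in> {ball c r | c r. 0 < r \<and> x \<in> ball c r}.
      enn_powr ((\<integral>\<^sup>+ y \<in> B. ennreal (norm (u y) powr p) \<partial>lebesgue) / emeasure lebesgue B) (1 / p))"

definition muckenhoupt :: "real \<Rightarrow> ('a::euclidean_space \<Rightarrow> real) \<Rightarrow> bool" where
  "muckenhoupt s w \<longleftrightarrow> 1 < s \<and> (\<forall>x. 0 \<le> w x) \<and> w \<in> borel_measurable lebesgue \<and>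
     (SUP B \<in> {ball c r | c r. 0 < r}.
        ((\<integral>\<^sup>+ y \<in> B. ennreal (w y) \<partial>lebesgue) / emeasure lebesgue B) *
        enn_powr ((\<integral>\<^sup>+ y \<in> B. (if w y = 0 then \<infinity> else ennreal (w y powr (- 1 / (s - 1)))) \<partial>lebesgue)
                   / emeasure lebesgue B) (s - 1)) < \<infinity>"

definition wnorm :: "ennreal \<Rightarrow> ('a::euclidean_space \<Rightarrow> real) \<Rightarrow> ('a \<Rightarrow> complex) \<Rightarrow> ennreal" where
  "wnorm q w u = (if q = \<infinity> then Inf {C. AE x in lebesgue. ennreal (norm (u x)) \<le> C}
     else enn_powr (\<integral>\<^sup>+ x. ennreal (norm (u x) powr enn2real q * w x) \<partial>lebesgue) (1 / enn2real q))"

end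

theory Submission
  imports Defs "HOL-Probability.Probability"
begin

text \<open>
  Fix \<open>x\<close> and translate it to the origin. With \<open>q = 1 + |\<Xi>|^2\<close>, the Erlang densities \<open>q^(k+1) t^k exp(-q t) / k!\<close>
  integrate to 1 over \<open>t > 0\<close>. They decompose the symbol into pieces living at frequency \<open>R = t^(-1/2)\<close>, in place of a
  Littlewood-Paley decomposition. Integrating by parts with the operators \<open>1 - h \<partial>\<^sub>e\<close>, where \<open>h = R^\<rho>\<close>, moves the weight
  \<open>\<Prod>\<^sub>i (1 - i h y\<^sub>i)^(-n-1)\<close> onto each \<open>u\<^sub>j\<close>. After that the piece is bounded in absolute value by \<open>R^m\<close> times a Gaussian, so
  the estimate is a product of estimates in one variable \<open>\<xi>\<^sub>j\<close>. Splitting the weighted \<open>u\<^sub>j\<close> at a height, with a Bessel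
  inequality for the small part and the trivial bound for the large part, one gets \<open>R^((1-\<rho>)n/p\<^sub>j) M\<^bsub>p\<^sub>j\<^esub>(u\<^sub>j)(x)\<close> without
  the Hausdorff-Young inequality. The condition on \<open>m\<close> makes the integral over \<open>t\<close> converge.

  The weighted bounds follow by Hoelder's inequality from Muckenhoupt's theorem, which is proved with Lerner's pointwise estimate
  \<open>(M f)^(s-1) \<le> A M\<^sub>w((M\<^sub>\<sigma>(f/\<sigma>))^(s-1)/w)\<close>; here \<open>w\<close> and \<open>\<sigma>\<close> are doubling, hence the maximal operators on the
  right are bounded by the Vitali covering lemma.
\<close>

subsection \<open>Gaussian weights\<close>

text \<open>The whole estimate rests on factorisation over j. A Gaussian on the product space is the
  product of Gaussians in the \<xi>_j. The weight is a product of linear factors for two reasons: 1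
  - i h y_e is the Fourier multiplier of the first-order operator 1 - h \<partial>_e, so only
  derivatives of the symbol have to be controlled; and the product over all coordinates splits over
  j, so each u_j gets its own weight. At frequency R a derivative of the symbol gains R^(-\<rho>),
  hence h = R^\<rho> is the largest scale at which h \<partial>_e is harmless; it localises u_j to
  distance R^(-\<rho>) from x. The exponent n + 1 is the least integer that beats the volume growth
  of balls. The Erlang index k is a free parameter: below frequency R the derivatives produce
  negative powers of t q, and a large k lets q^(k+1) t^k absorb them. In place of inversion or
  Plancherel, the identity that moves the transform from one integrable factor to the other is used
  throughout.\<close>

definition gauss :: "real \<Rightarrow> 'a::euclidean_space \<Rightarrow> real" where
  "gauss R \<xi> = exp (- (norm \<xi>)\<^sup>2 / (2 * R\<^sup>2))"

lemma gauss_nonneg [simp]: "0 \<le> gauss R \<xi>"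
  by (simp add: gauss_def)

lemma gauss_measurable [measurable]: "gauss R \<in> borel_measurable borel"
  unfolding gauss_def by measurable

lemma gauss_prod: "gauss R \<xi> = (\<Prod>b\<in>Basis. exp (- (\<xi> \<bullet> b)\<^sup>2 / (2 * R\<^sup>2)))"
proof -
  have "(norm \<xi>)\<^sup>2 = (\<Sum>b\<in>Basis. (\<xi> \<bullet> b)\<^sup>2)"
    by (subst power2_norm_eq_inner, subst euclidean_inner) (simp add: power2_eq_square)
  then show ?thesis
    by (simp add: gauss_def exp_sum[symmetric] sum_negf sum_divide_distrib)
qed

lemma integrable_lborel_prod:
  fixes f :: "'a::euclidean_space \<Rightarrow> real \<Rightarrow> complex"
  assumes "\<And>b. b \<in> Basis \<Longrightarrow> integrable lborel (f b)"
  shows "integrable lborel (\<lambda>x. \<Prod>b\<in>Basis. f b (x \<bullet> b))"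
    and "(\<integral>x. (\<Prod>b\<in>Basis. f b (x \<bullet> b)) \<partial>lborel) = (\<Prod>b\<in>Basis. \<integral>x. f b x \<partial>lborel)"
proof -
  interpret product_sigma_finite "\<lambda>_::'a. lborel :: real measure" ..
  have m[measurable]: "\<And>b. b \<in> Basis \<Longrightarrow> f b \<in> borel_measurable borel"
    using borel_measurable_integrable[OF assms] by simp
  have eq: "(\<Prod>b\<in>Basis. f b ((\<Sum>c\<in>Basis. x c *\<^sub>R c) \<bullet> b)) = (\<Prod>b\<in>Basis. f b (x b))" for x :: "'a \<Rightarrow> real"
    by (intro prod.cong) auto
  show "integrable lborel (\<lambda>x. \<Prod>b\<in>Basis. f b (x \<bullet> b))"
    by (subst lborel_eq, subst integrable_distr_eq) (auto simp: eq intro!: product_integrable_prod assms)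
  show "(\<integral>x. (\<Prod>b\<in>Basis. f b (x \<bullet> b)) \<partial>lborel) = (\<Prod>b\<in>Basis. \<integral>x. f b x \<partial>lborel)"
    by (subst lborel_eq, subst integral_distr) (auto simp: eq intro!: product_integral_prod assms)
qed

text \<open>This is the characteristic function of the standard normal distribution at -t R,
  rescaled by s -> R s.\<close>

lemma gauss_1d:
  assumes R: "0 < R"
  shows "integrable lborel (\<lambda>s. complex_of_real (exp (- s\<^sup>2 / (2 * R\<^sup>2))) * cis (- (s * t)))"
    and "(\<integral>s. complex_of_real (exp (- s\<^sup>2 / (2 * R\<^sup>2))) * cis (- (s * t)) \<partial>lborel)
       = complex_of_real (sqrt (2 * pi) * R * exp (- (R * t)\<^sup>2 / 2))"
proof -
  define f where "f = (\<lambda>s. complex_of_real (exp (- s\<^sup>2 / (2 * R\<^sup>2))) * cis (- (s * t)))"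
  have "complex_of_real (exp (- ((-t*R)^2) / 2)) = char std_normal_distribution (-t*R)"
    by (simp add: char_std_normal_distribution)
  also have "\<dots> = (\<integral>s. std_normal_density s *\<^sub>R iexp (-t*R * s) \<partial>lborel)"
    unfolding char_def by (subst integral_density) auto
  also have "\<dots> = (\<integral>s. (1 / sqrt (2 * pi)) *\<^sub>R f (R * s) \<partial>lborel)"
    using R by (intro Bochner_Integration.integral_cong)
      (auto simp: f_def normal_density_def cis_conv_exp scaleR_conv_of_real power_mult_distrib mult_ac)
  finally have "(\<integral>s. f (R * s) \<partial>lborel) = complex_of_real (sqrt (2*pi) * exp (- ((R*t)^2) / 2))"
    by (simp add: field_simps scaleR_conv_of_real mult_ac) 
  with lborel_integral_real_affine[of R f 0] R
  show "integral\<^sup>L lborel f = complex_of_real (sqrt (2 * pi) * R * exp (- (R * t)\<^sup>2 / 2))"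
    by (simp add: scaleR_conv_of_real mult_ac)
  have "integrable lborel std_normal_density" by simp
  then have "integrable lborel (\<lambda>s. sqrt (2*pi) * std_normal_density (0 + (1/R) * s))"
    using R by (intro integrable_mult_right lborel_integrable_real_affine) auto
  then have "integrable lborel (\<lambda>s. exp (- s\<^sup>2 / (2 * R\<^sup>2)))"
    by (simp add: normal_density_def power_divide mult.commute)
  then show "integrable lborel f"
    by (rule Bochner_Integration.integrable_bound) (auto simp: f_def norm_mult cis_conv_exp)
qed

lemma gauss_fourier:
  fixes t :: "'a::euclidean_space"
  assumes R: "0 < R"
  shows "integrable lborel (\<lambda>\<xi>. complex_of_real (gauss R \<xi>) * cis (- (\<xi> \<bullet> t)))"
    and "(\<integral>\<xi>. complex_of_real (gauss R \<xi>) * cis (- (\<xi> \<bullet> t)) \<partial>lborel)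
       = complex_of_real ((sqrt (2 * pi) * R) ^ DIM('a) * gauss (1 / R) t)"
proof -
  have cis_sum: "cis (- (\<xi> \<bullet> t)) = (\<Prod>b\<in>Basis. cis (- ((\<xi> \<bullet> b) * (t \<bullet> b))))" for \<xi> :: 'a
    by (subst euclidean_inner) (simp add: cis_conv_exp exp_sum[symmetric] sum_negf sum_distrib_left)
  have eq: "complex_of_real (gauss R \<xi>) * cis (- (\<xi> \<bullet> t)) =
    (\<Prod>b\<in>Basis. complex_of_real (exp (- (\<xi> \<bullet> b)\<^sup>2 / (2 * R\<^sup>2))) * cis (- ((\<xi> \<bullet> b) * (t \<bullet> b))))" for \<xi>
    unfolding gauss_prod cis_sum prod.distrib by simp
  show "integrable lborel (\<lambda>\<xi>. complex_of_real (gauss R \<xi>) * cis (- (\<xi> \<bullet> t)))"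
    unfolding eq by (rule integrable_lborel_prod(1)) (rule gauss_1d(1)[OF R])
  show "(\<integral>\<xi>. complex_of_real (gauss R \<xi>) * cis (- (\<xi> \<bullet> t)) \<partial>lborel)
       = complex_of_real ((sqrt (2 * pi) * R) ^ DIM('a) * gauss (1 / R) t)"
  proof -
    have "(\<integral>\<xi>. complex_of_real (gauss R \<xi>) * cis (- (\<xi> \<bullet> t)) \<partial>lborel)
      = (\<Prod>b\<in>Basis. complex_of_real (sqrt (2 * pi) * R * exp (- (R * (t \<bullet> b))\<^sup>2 / 2)))"
      unfolding eq by (subst integrable_lborel_prod(2)[OF gauss_1d(1)[OF R]]) (simp only: gauss_1d(2)[OF R])
    also have "\<dots> = complex_of_real (\<Prod>b\<in>Basis. (sqrt (2 * pi) * R) * exp (- (R * (t \<bullet> b))\<^sup>2 / 2))"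
      by (simp only: of_real_prod)
    also have "\<dots> = complex_of_real ((sqrt (2 * pi) * R) ^ DIM('a) * gauss (1 / R) t)"
      unfolding prod.distrib gauss_prod using R by (simp add: power_mult_distrib power_divide mult.commute)
    finally show ?thesis .
  qed
qed

lemma gauss_integrable:
  assumes R: "0 < R"
  shows "integrable lborel (gauss R :: 'a::euclidean_space \<Rightarrow> real)"
    and "(\<integral>\<xi>. gauss R (\<xi>::'a) \<partial>lborel) = (sqrt (2 * pi) * R) ^ DIM('a)"
proof -
  from gauss_fourier[OF R, of "0::'a"]
  have 1: "integrable lborel (\<lambda>\<xi>::'a. complex_of_real (gauss R \<xi>))"
    and 2: "(\<integral>\<xi>. complex_of_real (gauss R (\<xi>::'a)) \<partial>lborel) = complex_of_real ((sqrt (2 * pi) * R) ^ DIM('a))"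
    by (simp_all add: gauss_def)
  show "integrable lborel (gauss R :: 'a \<Rightarrow> real)" using 1 by (simp only: complex_of_real_integrable_eq)
  show "(\<integral>\<xi>. gauss R (\<xi>::'a) \<partial>lborel) = (sqrt (2 * pi) * R) ^ DIM('a)"
    using 2 by (simp only: integral_complex_of_real of_real_eq_iff)
qed

lemma nn_integral_gauss:
  assumes R: "0 < R"
  shows "(\<integral>\<^sup>+\<xi>. ennreal (gauss R (\<xi>::'a::euclidean_space)) \<partial>lborel) = ennreal ((sqrt (2 * pi) * R) ^ DIM('a))"
  using gauss_integrable[OF R, where 'a='a] by (simp add: nn_integral_eq_integral)

section \<open>Lebesgue measure and product integrals on \<open>'a ^ 'N\<close>\<close>

lemma Basis_vec_prod:
  fixes g :: "'a::euclidean_space ^ 'N \<Rightarrow> 'c::comm_monoid_mult"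
  shows "(\<Prod>b\<in>Basis. g b) = (\<Prod>i\<in>UNIV. \<Prod>u\<in>Basis. g (axis i u))"
proof -
  have B: "(Basis :: ('a^'N) set) = (\<lambda>(i,u). axis i u) ` (UNIV \<times> Basis)"
    by (auto simp: Basis_vec_def)
  have "inj_on (\<lambda>(i,u). axis i u :: 'a^'N) (UNIV \<times> Basis)"
    by (auto simp: inj_on_def axis_eq_axis)
  then show ?thesis
    unfolding B by (subst prod.reindex) (auto simp: prod.cartesian_product intro!: prod.cong)
qed

lemma vec_lambda_borel:
  "(\<lambda>f. \<chi> i. f i) \<in> measurable (\<Pi>\<^sub>M i\<in>UNIV. lborel) (borel :: ('a::euclidean_space^'N) measure)"
proof (rule borel_measurable_euclidean_space[THEN iffD2], intro ballI)
  fix b :: "'a^'N" assume "b \<in> Basis"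
  then obtain i u where b: "b = axis i u" by (auto simp: Basis_vec_def)
  show "(\<lambda>f. (\<chi> i. f i) \<bullet> b) \<in> borel_measurable (\<Pi>\<^sub>M i\<in>UNIV. lborel)"
    unfolding b inner_axis by simp
qed

text \<open>Lebesgue measure is determined by its values on boxes. A box in \<open>'a ^ 'N\<close>
  is a product of boxes in the components, and the product over \<open>Basis\<close> of its side
  lengths regroups accordingly.\<close>

lemma lborel_vec:
  "(lborel :: ('a::euclidean_space ^ 'N) measure)
    = distr (\<Pi>\<^sub>M i\<in>UNIV. lborel) borel (\<lambda>f. \<chi> i. f i)" (is "_ = distr ?P _ _")
proof (rule lborel_eqI)
  interpret product_sigma_finite "\<lambda>_::'N. lborel :: 'a measure" ..
  fix l u :: "'a^'N" assume lu: "\<And>b. b \<in> Basis \<Longrightarrow> l \<bullet> b \<le> u \<bullet> b"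
  have *: "(\<lambda>f. \<chi> i. f i) -` box l u \<inter> space ?P = (\<Pi>\<^sub>E i\<in>UNIV. box (l $ i) (u $ i))"
    by (auto simp: box_def space_PiM Basis_vec_def inner_axis)
  have lu': "l $ i \<bullet> b \<le> u $ i \<bullet> b" if "b \<in> Basis" for i b
    using lu[of "axis i b"] that by (auto simp: inner_axis Basis_vec_def)
  show "emeasure (distr ?P borel (\<lambda>f. \<chi> i. f i)) (box l u) = (\<Prod>b\<in>Basis. (u - l) \<bullet> b)"
    by (subst emeasure_distr[OF vec_lambda_borel])
      (auto simp: * emeasure_PiM lu' Basis_vec_prod inner_axis prod_ennreal inner_diff_left prod_nonneg)
qed simp

lemma vec_nth_borel [measurable]: "(\<lambda>x. x $ i) \<in> borel_measurable (borel :: ('a::euclidean_space^'N) measure)"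
  by (intro borel_measurable_continuous_onI continuous_intros)

lemma nn_integral_vec_prod:
  fixes f :: "'N::finite \<Rightarrow> 'a::euclidean_space \<Rightarrow> ennreal"
  assumes [measurable]: "\<And>i. f i \<in> borel_measurable borel"
  shows "(\<integral>\<^sup>+x. (\<Prod>i\<in>UNIV. f i (x $ i)) \<partial>lborel) = (\<Prod>i\<in>UNIV. \<integral>\<^sup>+x. f i x \<partial>lborel)"
proof -
  interpret product_sigma_finite "\<lambda>_::'N. lborel :: 'a measure" ..
  show ?thesis
    by (subst lborel_vec, subst nn_integral_distr[OF vec_lambda_borel])
      (auto intro!: product_nn_integral_prod)
qed

lemma integral_vec_prod:
  fixes f :: "'N::finite \<Rightarrow> 'a::euclidean_space \<Rightarrow> complex"
  assumes "\<And>i. integrable lborel (f i)"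
  shows "integrable lborel (\<lambda>x. \<Prod>i\<in>UNIV. f i (x $ i))"
    and "(\<integral>x. (\<Prod>i\<in>UNIV. f i (x $ i)) \<partial>lborel) = (\<Prod>i\<in>UNIV. \<integral>x. f i x \<partial>lborel)"
proof -
  interpret product_sigma_finite "\<lambda>_::'N. lborel :: 'a measure" ..
  have m[measurable]: "\<And>i. f i \<in> borel_measurable borel"
    using borel_measurable_integrable[OF assms] by simp
  show "integrable lborel (\<lambda>x. \<Prod>i\<in>UNIV. f i (x $ i))"
    by (subst lborel_vec, subst integrable_distr_eq[OF vec_lambda_borel])
      (auto intro!: product_integrable_prod assms)
  show "(\<integral>x. (\<Prod>i\<in>UNIV. f i (x $ i)) \<partial>lborel) = (\<Prod>i\<in>UNIV. \<integral>x. f i x \<partial>lborel)"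
    by (subst lborel_vec, subst integral_distr[OF vec_lambda_borel])
      (auto intro!: product_integral_prod assms)
qed

subsection \<open>Fourier integrals against a Gaussian weight\<close>

text \<open>A function that is not integrable has Bochner integral 0, so the bound covers that case
  too. Later estimates can therefore pass to nonnegative integrals at once.\<close>

lemma norm_integral_le_nn:
  fixes f :: "_ \<Rightarrow> 'b::{banach, second_countable_topology}"
  shows "ennreal (norm (integral\<^sup>L M f)) \<le> (\<integral>\<^sup>+x. ennreal (norm (f x)) \<partial>M)"
  by (cases "integrable M f") (auto simp: integral_norm_bound_ennreal not_integrable_integral_eq)

lemma fourier_measurable [measurable]:
  fixes g :: "'a::euclidean_space \<Rightarrow> complex"
  assumes [measurable]: "g \<in> borel_measurable borel"
  shows "fourier g \<in> borel_measurable borel"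
  unfolding fourier_def cis_conv_exp by measurable

lemma norm_fourier_le:
  fixes g :: "'a::euclidean_space \<Rightarrow> complex"
  assumes "integrable lborel g"
  shows "norm (fourier g \<xi>) \<le> (\<integral>y. norm (g y) \<partial>lborel)"
  unfolding fourier_def
  by (rule order.trans[OF integral_norm_bound]) (simp add: norm_mult)

lemma integrable_mult_cis:
  fixes g :: "'a::euclidean_space \<Rightarrow> complex"
  assumes "integrable lborel g" and [measurable]: "h \<in> borel_measurable borel"
  shows "integrable lborel (\<lambda>y. g y * cis (h y))"
proof -
  have [measurable]: "g \<in> borel_measurable borel" using borel_measurable_integrable[OF assms(1)] by simp
  show ?thesis
    by (rule Bochner_Integration.integrable_bound[OF assms(1)]) (auto simp: norm_mult cis_conv_exp)
qed

lemma fourier_add: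
  fixes f g :: "'a::euclidean_space \<Rightarrow> complex"
  assumes "integrable lborel f" "integrable lborel g"
  shows "fourier (\<lambda>y. f y + g y) \<xi> = fourier f \<xi> + fourier g \<xi>"
  unfolding fourier_def distrib_right
  by (intro Bochner_Integration.integral_add integrable_mult_cis assms) auto

text \<open>The multiplication formula, by Fubini for the absolutely integrable f(\<xi>) g(y). The
  Bessel inequality and the transfer of the weight to the u_j are both two applications of
  it.\<close>

lemma fourier_exchange:
  fixes f g :: "'a::euclidean_space \<Rightarrow> complex"
  assumes f: "integrable lborel f" and g: "integrable lborel g"
  shows "(\<integral>\<xi>. f \<xi> * fourier g \<xi> \<partial>lborel) = (\<integral>y. fourier f y * g y \<partial>lborel)"
proof -
  have [measurable]: "f \<in> borel_measurable borel" "g \<in> borel_measurable borel"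
    using borel_measurable_integrable[OF f] borel_measurable_integrable[OF g] by simp_all
  have int: "integrable (lborel \<Otimes>\<^sub>M lborel) (\<lambda>(\<xi>, y). f \<xi> * (g y * cis (- (\<xi> \<bullet> y))))"
  proof (rule Bochner_Integration.integrable_bound)
    show "integrable (lborel \<Otimes>\<^sub>M lborel) (\<lambda>(\<xi>, y). f \<xi> * g y)"
      using f g by (intro lborel_pair.integrable_product_swap lborel_pair.Fubini_integrable)
        (auto simp: norm_mult)
  qed (auto simp: norm_mult cis_conv_exp split_beta)
  have "(\<integral>\<xi>. f \<xi> * fourier g \<xi> \<partial>lborel) = (\<integral>\<xi>. (\<integral>y. f \<xi> * (g y * cis (- (\<xi> \<bullet> y))) \<partial>lborel) \<partial>lborel)"
    unfolding fourier_def by simp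
  also have "\<dots> = (\<integral>y. (\<integral>\<xi>. f \<xi> * (g y * cis (- (\<xi> \<bullet> y))) \<partial>lborel) \<partial>lborel)"
    using lborel_pair.Fubini_integral[OF int] by simp
  also have "\<dots> = (\<integral>y. (\<integral>\<xi>. (f \<xi> * cis (- (y \<bullet> \<xi>))) * g y \<partial>lborel) \<partial>lborel)"
    by (simp add: inner_commute mult_ac)
  also have "\<dots> = (\<integral>y. fourier f y * g y \<partial>lborel)"
    unfolding fourier_def by simp
  finally show ?thesis .
qed

lemma integrable_gauss_mult:
  fixes F :: "'a::euclidean_space \<Rightarrow> complex"
  assumes R: "0 < R" and [measurable]: "F \<in> borel_measurable borel" and F: "\<And>x. norm (F x) \<le> B"
  shows "integrable lborel (\<lambda>\<xi>. complex_of_real (gauss R \<xi>) * F \<xi>)"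
proof (rule Bochner_Integration.integrable_bound)
  show "integrable lborel (\<lambda>\<xi>::'a. B * gauss R \<xi>)"
    by (intro integrable_mult_right gauss_integrable R)
  show "AE x in lborel. norm (complex_of_real (gauss R x) * F x) \<le> norm (B * gauss R x)"
    using F order.trans[OF norm_ge_zero F] 
    by (auto simp: norm_mult abs_mult mult.commute[of B] intro!: mult_left_mono)
qed measurable

lemma nn_integral_lborel_translate:
  fixes c :: "'a::euclidean_space"
  assumes [measurable]: "f \<in> borel_measurable borel"
  shows "(\<integral>\<^sup>+x. f (c + x) \<partial>lborel) = (\<integral>\<^sup>+x. f x \<partial>lborel)"
  by (subst (2) lborel_distr_plus[of c, symmetric]) (simp add: nn_integral_distr)

text \<open>The Gaussian makes all integrals converge absolutely, and the exchange formula turns the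
  left side into a quadratic form in g. Its kernel P, the transform of the Gaussian, is positive and
  even and has mass (2 pi)^n for every R, so Schur's test gives a constant independent of R. As g is
  only integrable, the right side may be infinite.\<close>

lemma bessel_gauss:
  fixes g :: "'a::euclidean_space \<Rightarrow> complex"
  assumes R: "0 < R" and g: "integrable lborel g"
  shows "(\<integral>\<^sup>+\<xi>. ennreal (gauss R \<xi> * (norm (fourier g \<xi>))\<^sup>2) \<partial>lborel)
    \<le> ennreal ((2 * pi) ^ DIM('a)) * (\<integral>\<^sup>+y. ennreal ((norm (g y))\<^sup>2) \<partial>lborel)"
proof -
  have [measurable]: "g \<in> borel_measurable borel" using borel_measurable_integrable[OF g] by simp
  define F where "F = fourier g"
  have [measurable]: "(\<lambda>\<xi>. cnj (F \<xi>)) \<in> borel_measurable borel"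
    unfolding F_def
    by (intro measurable_compose[OF fourier_measurable borel_measurable_continuous_onI] continuous_intros) simp
  define P where "P = (\<lambda>t::'a. (sqrt (2 * pi) * R) ^ DIM('a) * gauss (1 / R) t)"
  have [measurable]: "F \<in> borel_measurable borel" "P \<in> borel_measurable borel"
    unfolding F_def P_def by measurable
  have Pnn: "0 \<le> P t" for t using R by (simp add: P_def)
  have Peven: "P (y - z) = P (z - y)" for y z by (simp add: P_def gauss_def norm_minus_commute)
  have FB: "norm (F \<xi>) \<le> (\<integral>y. norm (g y) \<partial>lborel)" for \<xi> unfolding F_def by (rule norm_fourier_le[OF g])
  have i1: "integrable lborel (\<lambda>\<xi>. complex_of_real (gauss R \<xi>) * cnj (F \<xi>))"
    by (rule integrable_gauss_mult[OF R, where B="\<integral>y. norm (g y) \<partial>lborel"]) (auto simp: FB)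
  have i2: "integrable lborel (\<lambda>\<xi>. complex_of_real (gauss R \<xi>) * cis (\<xi> \<bullet> y))" for y :: 'a
    by (rule integrable_gauss_mult[OF R, where B=1]) (auto simp: cis_conv_exp)
  have ker: "fourier (\<lambda>\<xi>. complex_of_real (gauss R \<xi>) * cis (\<xi> \<bullet> y)) z = complex_of_real (P (z - y))" for y z :: 'a
  proof -
    have "fourier (\<lambda>\<xi>. complex_of_real (gauss R \<xi>) * cis (\<xi> \<bullet> y)) z
      = (\<integral>\<xi>. complex_of_real (gauss R \<xi>) * cis (- (\<xi> \<bullet> (z - y))) \<partial>lborel)"
      unfolding fourier_def
      by (intro Bochner_Integration.integral_cong) (auto simp: cis_mult inner_diff inner_commute algebra_simps)
    then show ?thesis using gauss_fourier(2)[OF R, of "z - y"] by (simp add: P_def)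
  qed
  have inner: "fourier (\<lambda>\<xi>. complex_of_real (gauss R \<xi>) * cnj (F \<xi>)) y
      = cnj (\<integral>z. complex_of_real (P (z - y)) * g z \<partial>lborel)" for y
  proof -
    have "fourier (\<lambda>\<xi>. complex_of_real (gauss R \<xi>) * cnj (F \<xi>)) y
      = cnj (\<integral>\<xi>. (complex_of_real (gauss R \<xi>) * cis (\<xi> \<bullet> y)) * F \<xi> \<partial>lborel)"
      unfolding fourier_def
      by (subst Bochner_Integration.integral_cnj[symmetric], intro Bochner_Integration.integral_cong)
        (auto simp: cis_cnj inner_commute)
    also have "(\<integral>\<xi>. (complex_of_real (gauss R \<xi>) * cis (\<xi> \<bullet> y)) * F \<xi> \<partial>lborel)
      = (\<integral>z. complex_of_real (P (z - y)) * g z \<partial>lborel)"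
      unfolding F_def fourier_exchange[OF i2 g] ker ..
    finally show ?thesis .
  qed
  have "(\<integral>\<^sup>+\<xi>. ennreal (gauss R \<xi> * (norm (F \<xi>))\<^sup>2) \<partial>lborel)
     = ennreal (\<integral>\<xi>. gauss R \<xi> * (norm (F \<xi>))\<^sup>2 \<partial>lborel)"
  proof (rule nn_integral_eq_integral)
    have "integrable lborel (\<lambda>\<xi>. complex_of_real (gauss R \<xi>) * (complex_of_real ((norm (F \<xi>))\<^sup>2)))"
      by (rule integrable_gauss_mult[OF R, where B="(\<integral>y. norm (g y) \<partial>lborel)\<^sup>2"])
        (auto simp: FB norm_power intro!: power_mono)
    then show "integrable lborel (\<lambda>\<xi>. gauss R \<xi> * (norm (F \<xi>))\<^sup>2)"
      by (simp only: of_real_mult[symmetric] complex_of_real_integrable_eq)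
  qed simp
  also have "(\<integral>\<xi>. gauss R \<xi> * (norm (F \<xi>))\<^sup>2 \<partial>lborel) = norm (\<integral>\<xi>. gauss R \<xi> * (norm (F \<xi>))\<^sup>2 \<partial>lborel)"
    by (simp add: integral_nonneg_AE)
  also have "\<dots> = norm (\<integral>\<xi>. complex_of_real (gauss R \<xi> * (norm (F \<xi>))\<^sup>2) \<partial>lborel)"
    by (simp only: integral_complex_of_real norm_of_real real_norm_def)
  also have "(\<integral>\<xi>. complex_of_real (gauss R \<xi> * (norm (F \<xi>))\<^sup>2) \<partial>lborel)
      = (\<integral>\<xi>. (complex_of_real (gauss R \<xi>) * cnj (F \<xi>)) * fourier g \<xi> \<partial>lborel)"
    by (intro Bochner_Integration.integral_cong)
      (auto simp: F_def[symmetric] complex_norm_square mult_ac simp del: of_real_power)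
  also have "\<dots> = (\<integral>y. cnj (\<integral>z. complex_of_real (P (z - y)) * g z \<partial>lborel) * g y \<partial>lborel)"
    unfolding fourier_exchange[OF i1 g] inner ..
  also have "ennreal (norm \<dots>) \<le> (\<integral>\<^sup>+y. ennreal (norm (cnj (\<integral>z. complex_of_real (P (z - y)) * g z \<partial>lborel) * g y)) \<partial>lborel)"
    by (rule norm_integral_le_nn) 
  also have "\<dots> \<le> (\<integral>\<^sup>+y. (\<integral>\<^sup>+z. ennreal (P (z - y) * (norm (g z))\<^sup>2 / 2 + P (z - y) * (norm (g y))\<^sup>2 / 2) \<partial>lborel) \<partial>lborel)"
  proof (rule nn_integral_mono)
    fix y
    have "ennreal (norm (cnj (\<integral>z. complex_of_real (P (z - y)) * g z \<partial>lborel) * g y))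
      = ennreal (norm (\<integral>z. complex_of_real (P (z - y)) * g z \<partial>lborel)) * ennreal (norm (g y))"
      by (simp add: norm_mult ennreal_mult)
    also have "\<dots> \<le> (\<integral>\<^sup>+z. ennreal (norm (complex_of_real (P (z - y)) * g z)) \<partial>lborel) * ennreal (norm (g y))"
      by (intro mult_right_mono norm_integral_le_nn) simp
    also have "\<dots> = (\<integral>\<^sup>+z. ennreal (P (z - y) * (norm (g z) * norm (g y))) \<partial>lborel)"
      by (subst nn_integral_multc[symmetric]) (auto simp: norm_mult Pnn ennreal_mult'[symmetric] ennreal_mult''[symmetric] mult.assoc)
    \<comment> \<open>Schur's test: the product of the two values of g is replaced by half the sum
      of their squares, so that each term contains only one of them.\<close>
    also have "\<dots> \<le> (\<integral>\<^sup>+z. ennreal (P (z - y) * (norm (g z))\<^sup>2 / 2 + P (z - y) * (norm (g y))\<^sup>2 / 2) \<partial>lborel)"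
    proof (intro nn_integral_mono ennreal_leI)
      fix z
      have "norm (g z) * norm (g y) \<le> (norm (g z))\<^sup>2 / 2 + (norm (g y))\<^sup>2 / 2"
        using sum_squares_bound[of "norm (g z)" "norm (g y)"] by simp
      from mult_left_mono[OF this Pnn[of "z - y"]]
      show "P (z - y) * (norm (g z) * norm (g y)) \<le> P (z - y) * (norm (g z))\<^sup>2 / 2 + P (z - y) * (norm (g y))\<^sup>2 / 2"
        by (simp add: distrib_left)
    qed
    finally show "ennreal (norm (cnj (\<integral>z. complex_of_real (P (z - y)) * g z \<partial>lborel) * g y)) \<le> \<dots>" .
  qed
  also have "\<dots> = (\<integral>\<^sup>+y. (\<integral>\<^sup>+z. ennreal (P (z - y) * (norm (g z))\<^sup>2 / 2) \<partial>lborel) \<partial>lborel)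
       + (\<integral>\<^sup>+y. (\<integral>\<^sup>+z. ennreal (P (z - y) * (norm (g y))\<^sup>2 / 2) \<partial>lborel) \<partial>lborel)"
    by (simp add: ennreal_plus Pnn nn_integral_add)
  also have "(\<integral>\<^sup>+y. (\<integral>\<^sup>+z. ennreal (P (z - y) * (norm (g z))\<^sup>2 / 2) \<partial>lborel) \<partial>lborel)
       = (\<integral>\<^sup>+z. (\<integral>\<^sup>+y. ennreal (P (z - y) * (norm (g z))\<^sup>2 / 2) \<partial>lborel) \<partial>lborel)"
    by (rule lborel_pair.Fubini') simp
  \<comment> \<open>Only the names of the variables are exchanged here; P being even, the two halves
    of the sum are now the same integral.\<close>
  also have "\<dots> = (\<integral>\<^sup>+y. (\<integral>\<^sup>+z. ennreal (P (z - y) * (norm (g y))\<^sup>2 / 2) \<partial>lborel) \<partial>lborel)"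
    by (intro nn_integral_cong) (subst Peven, rule refl)
  also have "(\<integral>\<^sup>+y. (\<integral>\<^sup>+z. ennreal (P (z - y) * (norm (g y))\<^sup>2 / 2) \<partial>lborel) \<partial>lborel)
     = (\<integral>\<^sup>+y. ennreal ((2 * pi) ^ DIM('a) / 2) * ennreal ((norm (g y))\<^sup>2) \<partial>lborel)"
  proof (rule nn_integral_cong)
    fix y :: 'a
    have "(\<integral>\<^sup>+z. ennreal (P (z - y) * (norm (g y))\<^sup>2 / 2) \<partial>lborel)
      = (\<integral>\<^sup>+z. ennreal (P (-y + z)) \<partial>lborel) * ennreal ((norm (g y))\<^sup>2 / 2)"
      by (subst nn_integral_multc[symmetric]) (auto simp: Pnn ennreal_mult'[symmetric])
    also have "(\<integral>\<^sup>+z. ennreal (P (-y + z)) \<partial>lborel) = (\<integral>\<^sup>+z. ennreal (P z) \<partial>lborel)"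
      by (rule nn_integral_lborel_translate) simp
    also have "\<dots> = ennreal ((sqrt (2 * pi) * R) ^ DIM('a)) * (\<integral>\<^sup>+z. ennreal (gauss (1 / R) (z::'a)) \<partial>lborel)"
      unfolding P_def using R by (subst nn_integral_cmult[symmetric]) (auto simp: ennreal_mult')
    \<comment> \<open>R cancels: the prefactor of P has R^n and the dual Gaussian has width 1 /
      R.\<close>
    also have "\<dots> = ennreal ((2 * pi) ^ DIM('a))"
    proof -
      have "(sqrt (2 * pi) * R) ^ DIM('a) * (sqrt (2 * pi) * (1 / R)) ^ DIM('a) = (2 * pi) ^ DIM('a)"
        using R by (subst power_mult_distrib[symmetric]) simp
      moreover have "ennreal ((sqrt (2 * pi) * R) ^ DIM('a)) * ennreal ((sqrt (2 * pi) * (1 / R)) ^ DIM('a))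
          = ennreal ((sqrt (2 * pi) * R) ^ DIM('a) * (sqrt (2 * pi) * (1 / R)) ^ DIM('a))"
        using R by (intro ennreal_mult'[symmetric]) simp
      moreover have "(\<integral>\<^sup>+z. ennreal (gauss (1 / R) (z::'a)) \<partial>lborel) = ennreal ((sqrt (2 * pi) * (1 / R)) ^ DIM('a))"
        using R by (intro nn_integral_gauss) simp
      ultimately show ?thesis by (simp only:)
    qed
    finally show "(\<integral>\<^sup>+z. ennreal (P (z - y) * (norm (g y))\<^sup>2 / 2) \<partial>lborel)
      = ennreal ((2 * pi) ^ DIM('a) / 2) * ennreal ((norm (g y))\<^sup>2)"
      by (simp add: ennreal_mult'[symmetric])
  qed
  also have "\<dots> + \<dots> = (\<integral>\<^sup>+y. ennreal ((2 * pi) ^ DIM('a)) * ennreal ((norm (g y))\<^sup>2) \<partial>lborel)"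
  proof -
    have "ennreal (K / 2) * X + ennreal (K / 2) * X = ennreal K * X" if "0 \<le> K" for K X
      using that by (subst distrib_right[symmetric], subst ennreal_plus[symmetric]) auto
    from this[of "(2 * pi) ^ DIM('a)"] show ?thesis by (subst nn_integral_add[symmetric]) auto
  qed
  also have "\<dots> = ennreal ((2 * pi) ^ DIM('a)) * (\<integral>\<^sup>+y. ennreal ((norm (g y))\<^sup>2) \<partial>lborel)"
    by (rule nn_integral_cmult) simp
  finally show ?thesis unfolding F_def .
qed

text \<open>Hausdorff-Young followed by Hoelder would give the same quantity R^(n/p) I^(1/p). Here g
  is cut at a height l: where |g| \<le> l, the bound p \<le> 2 gives |g|^2 \<le> l^(2-p) |g|^p and
  the Bessel inequality applies; where |g| > l, the bound 1 \<le> p gives |g| \<le> l^(1-p) |g|^p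
  and the transform is bounded trivially.\<close>

lemma gauss_fourier_L1:
  fixes g :: "'a::euclidean_space \<Rightarrow> complex"
  assumes R: "0 < R" and g: "integrable lborel g" and p: "1 \<le> p" "p \<le> 2"
    and I: "0 < I" "(\<integral>\<^sup>+y. ennreal (norm (g y) powr p) \<partial>lborel) \<le> ennreal I"
  shows "(\<integral>\<^sup>+\<xi>. ennreal (gauss R \<xi> * norm (fourier g \<xi>)) \<partial>lborel)
    \<le> ennreal (2 * (2 * pi) ^ DIM('a) * (R ^ DIM('a) * I) powr (1 / p))"
proof -
  have [measurable]: "g \<in> borel_measurable borel" using borel_measurable_integrable[OF g] by simp
  \<comment> \<open>The height at which the two parts balance: l^p = R^n I, that is R^n l^(1-p) I =
    l.\<close>
  define l where "l = (R ^ DIM('a) * I) powr (1 / p)"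
  define K where "K = (2 * pi) ^ DIM('a)"
  define S where "S = (sqrt (2 * pi)) ^ DIM('a)"
  have l: "0 < l" using R I by (simp add: l_def)
  have lp: "l powr p = R ^ DIM('a) * I" using R I p by (simp add: l_def powr_powr)
  have sqrt_le: "sqrt (2 * pi) \<le> 2 * pi"
    using pi_gt3 by (intro real_le_lsqrt) (auto simp: power2_eq_square intro: mult_mono)
  have K: "0 < K" "0 < S" "S \<le> K"
    unfolding K_def S_def using power_mono[OF sqrt_le, of "DIM('a)"] by auto
  \<comment> \<open>Instead of Cauchy-Schwarz against the Gaussian, z \<le> c/2 + z^2/(2c) is used
    pointwise. With c = l / R^n both terms integrate to multiples of l.\<close>
  define c where "c = l / R ^ DIM('a)"
  have c: "0 < c" using l R by (simp add: c_def)
  define g1 where "g1 = (\<lambda>y. if norm (g y) \<le> l then g y else 0)"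
  define g2 where "g2 = (\<lambda>y. if norm (g y) \<le> l then 0 else g y)"
  have [measurable]: "g1 \<in> borel_measurable borel" "g2 \<in> borel_measurable borel"
    unfolding g1_def g2_def by measurable
  have i1: "integrable lborel g1" "integrable lborel g2"
    by (rule Bochner_Integration.integrable_bound[OF g]; auto simp: g1_def g2_def)+
  have split: "fourier g \<xi> = fourier g1 \<xi> + fourier g2 \<xi>" for \<xi>
  proof -
    have "g = (\<lambda>y. g1 y + g2 y)" by (auto simp: g1_def g2_def)
    then show ?thesis using fourier_add[OF i1, of \<xi>] by simp
  qed
  have L2: "(\<integral>\<^sup>+y. ennreal ((norm (g1 y))\<^sup>2) \<partial>lborel) \<le> ennreal (l powr (2 - p)) * ennreal I"
  proof -
    have "(\<integral>\<^sup>+y. ennreal ((norm (g1 y))\<^sup>2) \<partial>lborel) \<le> (\<integral>\<^sup>+y. ennreal (l powr (2 - p)) * ennreal (norm (g y) powr p) \<partial>lborel)"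
    proof (rule nn_integral_mono)
      fix y
      show "ennreal ((norm (g1 y))\<^sup>2) \<le> ennreal (l powr (2 - p)) * ennreal (norm (g y) powr p)"
      proof (cases "norm (g y) \<le> l \<and> g y \<noteq> 0")
        case True
        then have "(norm (g1 y))\<^sup>2 = norm (g y) powr (2 - p) * norm (g y) powr p"
          by (simp add: g1_def powr_add[symmetric] powr_numeral)
        also have "\<dots> \<le> l powr (2 - p) * norm (g y) powr p"
          using True p by (intro mult_right_mono powr_mono2) auto
        finally show ?thesis by (simp add: ennreal_mult'[symmetric] ennreal_leI)
      qed (auto simp: g1_def)
    qed
    also have "\<dots> = ennreal (l powr (2 - p)) * (\<integral>\<^sup>+y. ennreal (norm (g y) powr p) \<partial>lborel)"
      by (rule nn_integral_cmult) simp
    finally show ?thesis using I(2) by (meson mult_left_mono order_trans zero_le)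
  qed
  have L1: "norm (fourier g2 \<xi>) \<le> l powr (1 - p) * I" for \<xi>
  proof -
    have "ennreal (norm (fourier g2 \<xi>)) \<le> (\<integral>\<^sup>+y. ennreal (norm (g2 y * cis (- (\<xi> \<bullet> y)))) \<partial>lborel)"
      unfolding fourier_def by (rule norm_integral_le_nn)
    also have "\<dots> \<le> (\<integral>\<^sup>+y. ennreal (l powr (1 - p)) * ennreal (norm (g y) powr p) \<partial>lborel)"
    proof (rule nn_integral_mono)
      fix y
      show "ennreal (norm (g2 y * cis (- (\<xi> \<bullet> y)))) \<le> ennreal (l powr (1 - p)) * ennreal (norm (g y) powr p)"
      proof (cases "norm (g y) \<le> l")
        case False
        then have nz: "0 < norm (g y)" using l by linarith
        have "norm (g2 y * cis (- (\<xi> \<bullet> y))) = norm (g y) powr (1 - p) * norm (g y) powr p"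
          using False nz by (simp add: g2_def norm_mult powr_add[symmetric])
        also have "\<dots> \<le> l powr (1 - p) * norm (g y) powr p"
          using False p l by (intro mult_right_mono powr_mono2') auto
        finally show ?thesis by (simp add: ennreal_mult'[symmetric] ennreal_leI)
      qed (auto simp: g2_def)
    qed
    also have "\<dots> = ennreal (l powr (1 - p)) * (\<integral>\<^sup>+y. ennreal (norm (g y) powr p) \<partial>lborel)"
      by (rule nn_integral_cmult) simp
    also have "\<dots> \<le> ennreal (l powr (1 - p)) * ennreal I"
      by (rule mult_left_mono[OF I(2)]) simp
    finally show ?thesis using I by (simp add: ennreal_mult'[symmetric])
  qed
  have L1': "R ^ DIM('a) * (l powr (1 - p) * I) = l"
  proof -
    have "R ^ DIM('a) * (l powr (1 - p) * I) = l powr (1 - p) * l powr p" by (simp add: lp mult_ac)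
    then show ?thesis using l by (simp add: powr_add[symmetric])
  qed
  have L2': "l powr (2 - p) * I / c = l"
  proof -
    have "l powr (2 - p) * I * R ^ DIM('a) = l powr (2 - p) * l powr p" by (simp add: lp mult_ac)
    also have "\<dots> = l * l" using l by (simp add: powr_add[symmetric] powr_numeral power2_eq_square)
    finally show ?thesis using l R by (simp add: c_def field_simps)
  qed
  have "(\<integral>\<^sup>+\<xi>. ennreal (gauss R \<xi> * norm (fourier g \<xi>)) \<partial>lborel) \<le>
    (\<integral>\<^sup>+\<xi>. ennreal (c / 2 + l powr (1 - p) * I) * ennreal (gauss R \<xi>) +
       ennreal (1 / (2 * c)) * ennreal (gauss R \<xi> * (norm (fourier g1 \<xi>))\<^sup>2) \<partial>lborel)"
  proof (rule nn_integral_mono)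
    fix \<xi>
    have "2 * (norm (fourier g1 \<xi>) * c) \<le> (norm (fourier g1 \<xi>))\<^sup>2 + c\<^sup>2"
      using sum_squares_bound[of "norm (fourier g1 \<xi>)" c] by (simp add: mult_ac)
    then have "norm (fourier g1 \<xi>) \<le> c / 2 + (norm (fourier g1 \<xi>))\<^sup>2 / (2 * c)"
      using c by (simp add: field_simps power2_eq_square)
    then have "norm (fourier g \<xi>) \<le> (c / 2 + l powr (1 - p) * I) + (norm (fourier g1 \<xi>))\<^sup>2 / (2 * c)"
      unfolding split using L1[of \<xi>] norm_triangle_ineq[of "fourier g1 \<xi>" "fourier g2 \<xi>"] by linarith
    from mult_left_mono[OF this gauss_nonneg[of R \<xi>]]
    have "gauss R \<xi> * norm (fourier g \<xi>) \<le> (c / 2 + l powr (1 - p) * I) * gauss R \<xi>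
      + 1 / (2 * c) * (gauss R \<xi> * (norm (fourier g1 \<xi>))\<^sup>2)"
      by (simp add: distrib_left mult_ac)
    moreover have "0 \<le> c / 2 + l powr (1 - p) * I" "0 \<le> 1 / (2 * c)" using c I by auto
    ultimately show "ennreal (gauss R \<xi> * norm (fourier g \<xi>)) \<le> ennreal (c / 2 + l powr (1 - p) * I) * ennreal (gauss R \<xi>) +
       ennreal (1 / (2 * c)) * ennreal (gauss R \<xi> * (norm (fourier g1 \<xi>))\<^sup>2)"
      by (simp add: ennreal_mult'[symmetric] ennreal_plus[symmetric] ennreal_leI del: ennreal_plus)
  qed
  also have "\<dots> = ennreal (c / 2 + l powr (1 - p) * I) * (\<integral>\<^sup>+\<xi>. ennreal (gauss R (\<xi>::'a)) \<partial>lborel)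
     + ennreal (1 / (2 * c)) * (\<integral>\<^sup>+\<xi>. ennreal (gauss R \<xi> * (norm (fourier g1 \<xi>))\<^sup>2) \<partial>lborel)"
    by (subst nn_integral_add) (auto simp: nn_integral_cmult)
  also have "\<dots> \<le> ennreal (c / 2 + l powr (1 - p) * I) * ennreal (S * R ^ DIM('a))
     + ennreal (1 / (2 * c)) * (ennreal K * (ennreal (l powr (2 - p)) * ennreal I))"
    using bessel_gauss[OF R i1(1)] L2
    by (intro add_mono mult_left_mono order.trans[OF bessel_gauss[OF R i1(1)]])
      (auto simp: nn_integral_gauss[OF R] K_def S_def power_mult_distrib intro!: mult_left_mono)
  also have "\<dots> = ennreal ((c / 2 + l powr (1 - p) * I) * (S * R ^ DIM('a)) + 1 / (2 * c) * (K * (l powr (2 - p) * I)))"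
    using c I K R by (simp add: ennreal_mult'[symmetric] ennreal_plus[symmetric] del: ennreal_plus)
  also have "\<dots> \<le> ennreal (2 * K * l)"
  proof (rule ennreal_leI)
    have cR: "c * R ^ DIM('a) = l" using R by (simp add: c_def)
    have "(c / 2 + l powr (1 - p) * I) * (S * R ^ DIM('a)) + 1 / (2 * c) * (K * (l powr (2 - p) * I))
      = S / 2 * (c * R ^ DIM('a)) + S * (R ^ DIM('a) * (l powr (1 - p) * I)) + K / 2 * (l powr (2 - p) * I / c)"
      using c by (simp add: field_simps)
    also have "\<dots> = (3 / 2 * S + K / 2) * l" unfolding cR L1' L2' by (simp add: algebra_simps)
    also have "\<dots> \<le> 2 * K * l" using K l by (intro mult_right_mono) auto
    finally show "(c / 2 + l powr (1 - p) * I) * (S * R ^ DIM('a)) + 1 / (2 * c) * (K * (l powr (2 - p) * I)) \<le> 2 * K * l" .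
  qed
  finally show ?thesis unfolding K_def l_def .
qed

subsection \<open>Decaying weights and the maximal function\<close>

lemma ball_integral_le_maxfun:
  fixes u :: "'a::euclidean_space \<Rightarrow> complex"
  assumes [measurable]: "u \<in> borel_measurable borel" and p: "0 < p" and A: "0 \<le> A"
    and M: "maxfun p u x \<le> ennreal A" and r: "0 < r"
  shows "(\<integral>\<^sup>+ y. ennreal (norm (u y) powr p) * indicator (ball x r) y \<partial>lborel)
    \<le> ennreal (A powr p * (unit_ball_vol (DIM('a)) * r ^ DIM('a)))"
proof -
  let ?B = "ball x r"
  define I where "I = (\<integral>\<^sup>+ y. ennreal (norm (u y) powr p) * indicator ?B y \<partial>lborel)"
  define v where "v = unit_ball_vol (DIM('a)) * r ^ DIM('a)"
  have v: "0 < v" using r by (simp add: v_def)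
  have vol: "emeasure lebesgue ?B = ennreal v" using r by (simp add: emeasure_ball v_def)
  have leb: "(\<integral>\<^sup>+ y \<in> ?B. ennreal (norm (u y) powr p) \<partial>lebesgue) = I"
    unfolding I_def by (rule nn_integral_completion) 
  have mem: "?B \<in> {ball c r | c r. 0 < r \<and> x \<in> ball c r}" using r by (auto intro!: exI[of _ x] exI[of _ r])
  have "enn_powr ((\<integral>\<^sup>+ y \<in> ?B. ennreal (norm (u y) powr p) \<partial>lebesgue) / emeasure lebesgue ?B) (1 / p) \<le> maxfun p u x"
    unfolding maxfun_def by (rule SUP_upper[OF mem])
  also note M
  finally have le: "enn_powr (I / ennreal v) (1 / p) \<le> ennreal A" unfolding leb vol .
  then have fin: "I / ennreal v \<noteq> \<infinity>" by (auto simp: enn_powr_def top_unique)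
  then have "I \<noteq> \<infinity>" using v by (auto simp: ennreal_top_divide)
  then obtain i where i: "0 \<le> i" "I = ennreal i" by (cases I) auto
  have q: "I / ennreal v = ennreal (i / v)" using i v by (simp add: divide_ennreal)
  have "(i / v) powr (1 / p) \<le> A" using le A i v unfolding q by (simp add: enn_powr_def)
  then have "((i / v) powr (1 / p)) powr p \<le> A powr p" using p by (intro powr_mono2) auto
  then have "i / v \<le> A powr p" using p i v by (simp add: powr_powr)
  then have "i \<le> A powr p * v" using v by (simp add: field_simps)
  then show ?thesis unfolding I_def[symmetric] i v_def by (rule ennreal_leI)
qed

text \<open>Dyadic decomposition: where h |y - x| is about 2^k, the weight is about 2^(-k(n+1)),
  while the ball of radius 2^k / h has volume about 2^(kn) / h^n. The exponent n + 1 leaves the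
  summable factor 2^(-k).\<close>

lemma weighted_integral_le_maxfun:
  fixes u :: "'a::euclidean_space \<Rightarrow> complex"
  assumes [measurable]: "u \<in> borel_measurable borel" and p: "0 < p" and A: "0 \<le> A"
    and M: "maxfun p u x \<le> ennreal A" and h: "0 < h"
  shows "(\<integral>\<^sup>+ y. ennreal (norm (u y) powr p * (1 + h\<^sup>2 * (norm (y - x))\<^sup>2) powr (- (real DIM('a) + 1) / 2)) \<partial>lborel)
    \<le> ennreal (2 ^ (DIM('a) + 2) * unit_ball_vol (DIM('a)) * A powr p / h ^ DIM('a))"
proof -
  let ?n = "DIM('a)"
  define f where "f = (\<lambda>y. ennreal (norm (u y) powr p))"
  have [measurable]: "f \<in> borel_measurable borel" unfolding f_def by measurable
  \<comment> \<open>For k > 0 only h |y - x| \<ge> 2^(k-1) is known, not 2^k; the numerator 2^(n+1)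
    pays for this shift.\<close>
  define c :: "nat \<Rightarrow> real" where "c = (\<lambda>k. 2 ^ (?n + 1) / (2 ^ k) ^ (?n + 1))"
  have c: "0 \<le> c k" for k by (simp add: c_def)
  have pt: "ennreal (norm (u y) powr p * (1 + h\<^sup>2 * (norm (y - x))\<^sup>2) powr (- (real ?n + 1) / 2))
    \<le> (\<Sum>k. ennreal (c k) * (f y * indicator (ball x (2 ^ k / h)) y))" for y
  proof -
    define r where "r = h * norm (y - x)"
    have r: "0 \<le> r" using h by (simp add: r_def)
    define k where "k = (LEAST k. r < 2 ^ k)"
    have ex: "\<exists>k. r < 2 ^ k" using real_arch_pow[of 2 r] by simp
    have k: "r < 2 ^ k" unfolding k_def by (rule LeastI_ex[OF ex])
    have W: "(1 + r\<^sup>2) powr (- (real ?n + 1) / 2) \<le> c k"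
    proof (cases k)
      case 0
      have "(1 + r\<^sup>2) powr (- (real ?n + 1) / 2) \<le> (1 + r\<^sup>2) powr 0" by (rule powr_mono) auto
      also have "\<dots> \<le> 1" by simp
      also have "1 \<le> (2::real) ^ (?n + 1)" by (rule one_le_power) simp
      finally show ?thesis by (simp add: c_def 0)
    next
      case (Suc j)
      then have "\<not> r < 2 ^ j" using not_less_Least[of j "\<lambda>k. r < 2 ^ k"] by (simp add: k_def)
      then have j: "2 ^ j \<le> r" by simp
      have "(2 ^ j)\<^sup>2 \<le> 1 + r\<^sup>2" using power_mono[OF j, of 2] by simp
      then have "(1 + r\<^sup>2) powr (- (real ?n + 1) / 2) \<le> ((2 ^ j)\<^sup>2) powr (- (real ?n + 1) / 2)"
        by (intro powr_mono2') auto
      also have "\<dots> = ((2 ^ j) powr 2) powr (- (real ?n + 1) / 2)"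
        by (simp add: powr_numeral)
      also have "\<dots> = (2 ^ j) powr (- real (?n + 1))"
        unfolding powr_powr by (rule arg_cong) simp
      also have "\<dots> = 1 / (2 ^ j) ^ (?n + 1)"
        by (subst powr_minus_divide, subst powr_realpow) auto
      also have "\<dots> = c k" unfolding Suc c_def by (simp add: power_mult_distrib)
      finally show ?thesis .
    qed
    have "y \<in> ball x (2 ^ k / h)" using k h by (simp add: r_def dist_norm norm_minus_commute field_simps)
    then have "ennreal (norm (u y) powr p * (1 + r\<^sup>2) powr (- (real ?n + 1) / 2)) \<le>
      ennreal (c k) * (f y * indicator (ball x (2 ^ k / h)) y)"
      using mult_right_mono[OF W, of "norm (u y) powr p"]
      by (auto simp: f_def ennreal_mult'[symmetric] c mult.commute intro!: ennreal_leI)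
    also have "\<dots> \<le> (\<Sum>k. ennreal (c k) * (f y * indicator (ball x (2 ^ k / h)) y))"
      using sum_le_suminf[OF summableI, of "{k}" "\<lambda>k. ennreal (c k) * (f y * indicator (ball x (2 ^ k / h)) y)"] by simp
    finally show ?thesis by (simp add: r_def power_mult_distrib)
  qed
  have "(\<integral>\<^sup>+ y. ennreal (norm (u y) powr p * (1 + h\<^sup>2 * (norm (y - x))\<^sup>2) powr (- (real ?n + 1) / 2)) \<partial>lborel)
    \<le> (\<integral>\<^sup>+ y. (\<Sum>k. ennreal (c k) * (f y * indicator (ball x (2 ^ k / h)) y)) \<partial>lborel)"
    by (intro nn_integral_mono pt)
  also have "\<dots> = (\<Sum>k. ennreal (c k) * (\<integral>\<^sup>+ y. f y * indicator (ball x (2 ^ k / h)) y \<partial>lborel))"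
  proof -
    have [measurable]: "(\<lambda>y. f y * indicator (ball x r) y) \<in> borel_measurable borel" for r
      by (intro borel_measurable_times_ennreal borel_measurable_indicator) auto
    show ?thesis by (subst nn_integral_suminf) (auto simp: nn_integral_cmult)
  qed
  also have "\<dots> \<le> (\<Sum>k. ennreal (2 ^ (?n + 1) * unit_ball_vol ?n * A powr p / h ^ ?n) * ennreal ((1 / 2) ^ k))"
  proof (intro suminf_le summableI)
    fix k
    have "ennreal (c k) * (\<integral>\<^sup>+ y. f y * indicator (ball x (2 ^ k / h)) y \<partial>lborel) \<le>
      ennreal (c k) * ennreal (A powr p * (unit_ball_vol ?n * (2 ^ k / h) ^ ?n))"
      unfolding f_def by (intro mult_left_mono ball_integral_le_maxfun[OF _ p A M]) (use h in auto)
    also have "\<dots> = ennreal ((2 ^ (?n + 1) * unit_ball_vol ?n * A powr p / h ^ ?n) * (1 / 2) ^ k)"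
      unfolding c_def by (subst ennreal_mult'[symmetric]) (auto simp: power_divide field_simps)
    finally show "ennreal (c k) * (\<integral>\<^sup>+ y. f y * indicator (ball x (2 ^ k / h)) y \<partial>lborel) \<le>
      ennreal (2 ^ (?n + 1) * unit_ball_vol ?n * A powr p / h ^ ?n) * ennreal ((1 / 2) ^ k)"
      by (subst ennreal_mult''[symmetric]) auto
  qed
  also have "\<dots> = ennreal (2 ^ (?n + 1) * unit_ball_vol ?n * A powr p / h ^ ?n) * (\<Sum>k. ennreal ((1 / 2) ^ k))"
    by simp
  also have "(\<Sum>k. ennreal ((1 / 2) ^ k)) = ennreal (\<Sum>k. (1 / 2) ^ k)"
    by (rule suminf_ennreal2) (auto simp: summable_geometric)
  also have "(\<Sum>k. (1 / 2) ^ k) = (2::real)" by (simp add: suminf_geometric)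
  also have "ennreal (2 ^ (?n + 1) * unit_ball_vol ?n * A powr p / h ^ ?n) * ennreal 2
    = ennreal (2 ^ (?n + 2) * unit_ball_vol ?n * A powr p / h ^ ?n)"
    by (subst ennreal_mult''[symmetric]) (auto simp: field_simps)
  finally show ?thesis .
qed

subsection \<open>Smooth functions and bounds on their derivatives\<close>

abbreviation Dv :: "'a::euclidean_space \<Rightarrow> ('a \<Rightarrow> complex) \<Rightarrow> 'a \<Rightarrow> complex" where
  "Dv v f \<equiv> Dlist [v] f"

lemma Dlist_append: "Dlist (vs @ ws) f = Dlist vs (Dlist ws f)"
  by (induction vs) auto

lemma smooth_fun_differentiable: "smooth_fun f \<Longrightarrow> f differentiable (at y)"
  unfolding smooth_fun_def by (metis Dlist.simps(1) empty_set empty_subsetI)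

lemma smooth_fun_Dlist: "smooth_fun f \<Longrightarrow> set ws \<subseteq> Basis \<Longrightarrow> smooth_fun (Dlist ws f)"
  unfolding smooth_fun_def
  by (metis Dlist_append Un_subset_iff set_append)

lemma smooth_fun_Dv: "smooth_fun f \<Longrightarrow> v \<in> Basis \<Longrightarrow> smooth_fun (Dv v f)"
  by (rule smooth_fun_Dlist) auto

lemma smooth_fun_continuous: "smooth_fun f \<Longrightarrow> continuous_on UNIV f"
  by (auto simp: continuous_at_imp_continuous_on differentiable_imp_continuous_within smooth_fun_differentiable)

lemma smooth_fun_borel: "smooth_fun f \<Longrightarrow> f \<in> borel_measurable borel"
  by (intro borel_measurable_continuous_onI smooth_fun_continuous)

text \<open>Smoothness is the largest property that implies differentiability and survives partial
  derivatives along \<open>Basis\<close>; any invariant S with these two features is contained in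
  it.\<close>

lemma smooth_fun_coinduct:
  assumes "S f" and "\<And>f y. S f \<Longrightarrow> f differentiable (at y)" and "\<And>f v. S f \<Longrightarrow> v \<in> Basis \<Longrightarrow> S (Dv v f)"
  shows "smooth_fun f"
proof -
  have "S (Dlist vs f)" if "set vs \<subseteq> Basis" for vs
    using that by (induction vs) (use assms(1) assms(3) in \<open>auto simp: fun_eq_iff\<close>)
  then show ?thesis unfolding smooth_fun_def using assms(2) by blast
qed

lemma Dv_eqI:
  assumes "\<And>y. (f has_derivative f' y) (at y)"
  shows "Dv v f = (\<lambda>y. f' y v)"
  using frechet_derivative_at[OF assms] by (auto simp: fun_eq_iff)

lemma has_derivative_frechet: "f differentiable (at y) \<Longrightarrow> (f has_derivative frechet_derivative f (at y)) (at y)"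
  by (simp add: frechet_derivative_works)

lemma Dv_add:
  assumes "\<And>y. f differentiable (at y)" "\<And>y. g differentiable (at y)"
  shows "Dv v (\<lambda>y. f y + g y) = (\<lambda>y. Dv v f y + Dv v g y)"
  by (subst Dv_eqI[OF has_derivative_add[OF has_derivative_frechet[OF assms(1)] has_derivative_frechet[OF assms(2)]]]) simp

lemma Dv_mult:
  assumes "\<And>y. f differentiable (at y)" "\<And>y. g differentiable (at y)"
  shows "Dv v (\<lambda>y. f y * g y) = (\<lambda>y. f y * Dv v g y + Dv v f y * g y)"
  by (subst Dv_eqI[OF has_derivative_mult[OF has_derivative_frechet[OF assms(1)] has_derivative_frechet[OF assms(2)]]]) simp

lemma Dv_exp:
  assumes "\<And>y. f differentiable (at y)"
  shows "Dv v (\<lambda>y. exp (f y)) = (\<lambda>y. Dv v f y * exp (f y))"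
    and "(\<lambda>y. exp (f y)) differentiable (at y)"
proof -
  have "(exp has_derivative (\<lambda>u. exp (f y) * u)) (at (f y))" for y
    using DERIV_exp[of "f y"] by (simp add: has_field_derivative_def)
  from has_derivative_compose[OF has_derivative_frechet[OF assms] this]
  have *: "((\<lambda>y. exp (f y)) has_derivative (\<lambda>u. exp (f y) * frechet_derivative f (at y) u)) (at y)" for y .
  show "Dv v (\<lambda>y. exp (f y)) = (\<lambda>y. Dv v f y * exp (f y))"
    by (subst Dv_eqI[OF *]) (simp add: mult.commute)
  show "(\<lambda>y. exp (f y)) differentiable (at y)"
    using * unfolding differentiable_def by blast
qed

lemma Dv_const: "Dv v (\<lambda>y. c) = (\<lambda>y. 0)"
  by (subst Dv_eqI[OF has_derivative_const]) simp

lemma has_derivative_linear_form: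
  "((\<lambda>y. complex_of_real (y \<bullet> w)) has_derivative (\<lambda>u. complex_of_real (u \<bullet> w))) (at y)"
  by (auto intro!: derivative_eq_intros)

lemma has_derivative_quad_form:
  "((\<lambda>y. complex_of_real (y \<bullet> y)) has_derivative (\<lambda>u. complex_of_real (2 * (y \<bullet> u)))) (at y)"
  by (auto intro!: derivative_eq_intros simp: inner_commute)

inductive elem_smooth :: "('a::euclidean_space \<Rightarrow> complex) \<Rightarrow> bool" where
  smooth: "smooth_fun f \<Longrightarrow> elem_smooth f"
| const: "elem_smooth (\<lambda>y. c)"
| linear: "elem_smooth (\<lambda>y. complex_of_real (y \<bullet> w))"
| quad: "elem_smooth (\<lambda>y. complex_of_real (y \<bullet> y))"
| add: "elem_smooth f \<Longrightarrow> elem_smooth g \<Longrightarrow> elem_smooth (\<lambda>y. f y + g y)"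
| mult: "elem_smooth f \<Longrightarrow> elem_smooth g \<Longrightarrow> elem_smooth (\<lambda>y. f y * g y)"
| exp: "elem_smooth f \<Longrightarrow> elem_smooth (\<lambda>y. exp (f y))"

lemma elem_smooth_imp_smooth:
  assumes "elem_smooth f"
  shows "smooth_fun f"
proof (rule smooth_fun_coinduct[of elem_smooth, OF assms])
  show d: "f differentiable (at y)" if "elem_smooth f" for f :: "'a \<Rightarrow> complex" and y
    using that
  proof (induction arbitrary: y)
    case (linear w) then show ?case using has_derivative_linear_form unfolding differentiable_def by blast
  next
    case quad then show ?case using has_derivative_quad_form unfolding differentiable_def by blast
  next
    case (exp f) show ?case by (rule Dv_exp(2)[OF exp.IH])
  qed (auto simp: smooth_fun_differentiable)
  show "elem_smooth (Dv v f)" if "elem_smooth f" "v \<in> Basis" for f :: "'a \<Rightarrow> complex" and v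
    using that
  proof induction
    case (smooth f) then show ?case by (intro elem_smooth.smooth smooth_fun_Dv)
  next
    case (const c) show ?case unfolding Dv_const by (rule elem_smooth.const)
  next
    case (linear w) show ?case unfolding Dv_eqI[OF has_derivative_linear_form] by (rule elem_smooth.const)
  next
    case quad
    have "elem_smooth (\<lambda>y. complex_of_real 2 * complex_of_real (y \<bullet> v))"
      by (intro elem_smooth.intros)
    then show ?case unfolding Dv_eqI[OF has_derivative_quad_form] by simp
  next
    case (add f g)
    then show ?case unfolding Dv_add[OF d[OF add(1)] d[OF add(2)]]
      by (intro elem_smooth.add elem_smooth.mult elem_smooth.exp) assumption+
  next
    case (mult f g)
    then show ?case unfolding Dv_mult[OF d[OF mult(1)] d[OF mult(2)]]
      by (intro elem_smooth.add elem_smooth.mult elem_smooth.exp) assumption+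
  next
    case (exp f)
    then show ?case unfolding Dv_exp(1)[OF d[OF exp(1)]]
      by (intro elem_smooth.add elem_smooth.mult elem_smooth.exp) assumption+
  qed
qed

lemma smooth_fun_add: "smooth_fun f \<Longrightarrow> smooth_fun g \<Longrightarrow> smooth_fun (\<lambda>y. f y + g y)"
  and smooth_fun_mult: "smooth_fun f \<Longrightarrow> smooth_fun g \<Longrightarrow> smooth_fun (\<lambda>y. f y * g y)"
  and smooth_fun_exp: "smooth_fun f \<Longrightarrow> smooth_fun (\<lambda>y. exp (f y))"
  and smooth_fun_const: "smooth_fun (\<lambda>y. c)"
  and smooth_fun_linear: "smooth_fun (\<lambda>y. complex_of_real (y \<bullet> w))"
  and smooth_fun_quad: "smooth_fun (\<lambda>y. complex_of_real (y \<bullet> y))"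
  by (auto intro: elem_smooth_imp_smooth elem_smooth.intros)

lemma smooth_fun_power: "smooth_fun f \<Longrightarrow> smooth_fun (\<lambda>y. f y ^ k)"
  by (induction k) (auto intro: smooth_fun_const smooth_fun_mult)

lemma Dlist_add:
  assumes "smooth_fun f" "smooth_fun g" "set vs \<subseteq> Basis"
  shows "Dlist vs (\<lambda>y. f y + g y) = (\<lambda>y. Dlist vs f y + Dlist vs g y)"
  using assms(3)
proof (induction vs)
  case (Cons v vs)
  then have "Dlist vs (\<lambda>y. f y + g y) = (\<lambda>y. Dlist vs f y + Dlist vs g y)" by simp
  with Dv_add[of "Dlist vs f" "Dlist vs g" v] Cons.prems assms show ?case
    by (simp add: smooth_fun_Dlist smooth_fun_differentiable)
qed simp

lemma Dlist_cmult:
  assumes "smooth_fun f" "set vs \<subseteq> Basis"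
  shows "Dlist vs (\<lambda>y. c * f y) = (\<lambda>y. c * Dlist vs f y)"
  using assms(2)
proof (induction vs)
  case (Cons v vs)
  then have "Dlist vs (\<lambda>y. c * f y) = (\<lambda>y. c * Dlist vs f y)" by simp
  with Dv_mult[of "\<lambda>_. c" "Dlist vs f" v] Cons.prems assms show ?case
    using Dv_const[of v c] by (simp add: smooth_fun_Dlist smooth_fun_differentiable)
qed simp

text \<open>A bound at one point, with the size A kept apart from the scale \<eta> of one
  derivative. Factors that share an \<eta> can be added and multiplied with only A changing, and the
  orders up to k are treated together.\<close>

definition derivs_le :: "nat \<Rightarrow> real \<Rightarrow> real \<Rightarrow> ('a::euclidean_space \<Rightarrow> complex) \<Rightarrow> 'a \<Rightarrow> bool" where
  "derivs_le k A \<eta> f y \<longleftrightarrow> (\<forall>vs. set vs \<subseteq> Basis \<and> length vs \<le> k \<longrightarrow> norm (Dlist vs f y) \<le> A * \<eta> ^ length vs)"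

lemma derivs_leD: "derivs_le k A \<eta> f y \<Longrightarrow> set vs \<subseteq> Basis \<Longrightarrow> length vs \<le> k \<Longrightarrow> norm (Dlist vs f y) \<le> A * \<eta> ^ length vs"
  unfolding derivs_le_def by blast

lemma derivs_le_0: "derivs_le 0 A \<eta> f y \<longleftrightarrow> norm (f y) \<le> A"
  by (auto simp: derivs_le_def)

text \<open>The recursion splits off the last entry of the list, the derivative that is taken first.
  So one rule of calculus is applied to f itself and the induction goes on with
  \<open>Dv v f\<close> in place of f.\<close>

lemma derivs_le_Suc:
  "derivs_le (Suc k) A \<eta> f y \<longleftrightarrow> norm (f y) \<le> A \<and> (\<forall>v\<in>Basis. derivs_le k (A * \<eta>) \<eta> (Dv v f) y)"
proof
  assume L: "derivs_le (Suc k) A \<eta> f y"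
  have "norm (Dlist vs (Dv v f) y) \<le> A * \<eta> * \<eta> ^ length vs" if "set vs \<subseteq> Basis" "length vs \<le> k" "v \<in> Basis" for vs v
    using derivs_leD[OF L, of "vs @ [v]"] that by (simp only: Dlist_append) (simp add: mult_ac)
  then show "norm (f y) \<le> A \<and> (\<forall>v\<in>Basis. derivs_le k (A * \<eta>) \<eta> (Dv v f) y)"
    using derivs_leD[OF L, of "[]"] by (auto simp: derivs_le_def)
next
  assume R: "norm (f y) \<le> A \<and> (\<forall>v\<in>Basis. derivs_le k (A * \<eta>) \<eta> (Dv v f) y)"
  show "derivs_le (Suc k) A \<eta> f y"
    unfolding derivs_le_def
  proof (intro allI impI)
    fix vs :: "'a list" assume vs: "set vs \<subseteq> Basis \<and> length vs \<le> Suc k"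
    show "norm (Dlist vs f y) \<le> A * \<eta> ^ length vs"
    proof (cases vs rule: rev_cases)
      case (snoc ws v)
      with vs R derivs_leD[of k "A * \<eta>" \<eta> "Dv v f" y ws] show ?thesis
        unfolding snoc Dlist_append by (simp add: mult_ac)
    qed (use R in simp)
  qed
qed

lemma derivs_le_mono:
  assumes "derivs_le k A \<eta> f y" "k' \<le> k" "A \<le> A'" "0 \<le> A'" "0 \<le> \<eta>" "\<eta> \<le> \<eta>'"
  shows "derivs_le k' A' \<eta>' f y"
  unfolding derivs_le_def
proof (intro allI impI)
  fix vs :: "'a list" assume vs: "set vs \<subseteq> Basis \<and> length vs \<le> k'"
  then have "norm (Dlist vs f y) \<le> A * \<eta> ^ length vs" using derivs_leD[OF assms(1)] assms(2) by auto
  also have "\<dots> \<le> A' * \<eta>' ^ length vs" using assms by (intro mult_mono power_mono) auto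
  finally show "norm (Dlist vs f y) \<le> A' * \<eta>' ^ length vs" .
qed

lemma derivs_le_add:
  assumes "smooth_fun f" "smooth_fun g" "derivs_le k A \<eta> f y" "derivs_le k B \<eta> g y"
  shows "derivs_le k (A + B) \<eta> (\<lambda>y. f y + g y) y"
  unfolding derivs_le_def
proof (intro allI impI)
  fix vs :: "'a list" assume vs: "set vs \<subseteq> Basis \<and> length vs \<le> k"
  then have "norm (Dlist vs f y + Dlist vs g y) \<le> A * \<eta> ^ length vs + B * \<eta> ^ length vs"
    using derivs_leD[OF assms(3)] derivs_leD[OF assms(4)] by (intro norm_triangle_mono) auto
  then show "norm (Dlist vs (\<lambda>y. f y + g y) y) \<le> (A + B) * \<eta> ^ length vs"
    using vs by (simp add: Dlist_add[OF assms(1,2)] distrib_right)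
qed

text \<open>Induction on the order instead of the Leibniz formula: every order doubles the number of
  terms, hence 2^k.\<close>

lemma derivs_le_mult:
  assumes "smooth_fun f" "smooth_fun g" "derivs_le k A \<eta> f y" "derivs_le k B \<eta> g y"
    "0 \<le> A" "0 \<le> B" "0 \<le> \<eta>"
  shows "derivs_le k (2 ^ k * A * B) \<eta> (\<lambda>y. f y * g y) y"
  using assms
proof (induction k arbitrary: f g A B)
  case 0
  then show ?case by (auto simp: derivs_le_0 norm_mult intro: mult_mono)
next
  case (Suc k)
  have f: "norm (f y) \<le> A" "\<And>v. v \<in> Basis \<Longrightarrow> derivs_le k (A * \<eta>) \<eta> (Dv v f) y"
    using Suc.prems(3) by (auto simp: derivs_le_Suc)
  have g: "norm (g y) \<le> B" "\<And>v. v \<in> Basis \<Longrightarrow> derivs_le k (B * \<eta>) \<eta> (Dv v g) y"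
    using Suc.prems(4) by (auto simp: derivs_le_Suc)
  have f': "derivs_le k A \<eta> f y" and g': "derivs_le k B \<eta> g y"
    using Suc.prems by (auto intro: derivs_le_mono)
  have "norm (f y * g y) \<le> 1 * (A * B)"
    unfolding norm_mult using f(1) g(1) Suc.prems by (auto intro: mult_mono)
  also have "\<dots> \<le> 2 ^ Suc k * (A * B)" 
    using Suc.prems by (intro mult_right_mono one_le_power) auto
  finally have 1: "norm (f y * g y) \<le> 2 ^ Suc k * A * B" by (simp add: mult_ac)
  have "derivs_le k (2 ^ k * A * (B * \<eta>) + 2 ^ k * (A * \<eta>) * B) \<eta> (\<lambda>y. f y * Dv v g y + Dv v f y * g y) y"
    if v: "v \<in> Basis" for v
    using v Suc.prems f(2)[OF v] g(2)[OF v] f' g'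
    by (intro derivs_le_add Suc.IH smooth_fun_mult smooth_fun_Dv mult_nonneg_nonneg)
  moreover have "Dv v (\<lambda>y. f y * g y) = (\<lambda>y. f y * Dv v g y + Dv v f y * g y)" for v
    using Suc.prems by (intro Dv_mult smooth_fun_differentiable)
  ultimately show ?case using 1 unfolding derivs_le_Suc by (simp add: algebra_simps)
qed

lemma derivs_le_const:
  assumes "norm c \<le> A" "0 \<le> \<eta>"
  shows "derivs_le k A \<eta> (\<lambda>y. c) y"
  using assms
proof (induction k arbitrary: c A)
  case (Suc k)
  then have "0 \<le> A" using norm_ge_zero order_trans by blast
  with Suc show ?case unfolding derivs_le_Suc Dv_const by simp
qed (simp add: derivs_le_0)

lemma derivs_le_cmult:
  assumes "smooth_fun f" "derivs_le k A \<eta> f y"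
  shows "derivs_le k (norm c * A) \<eta> (\<lambda>y. c * f y) y"
  using assms(2) unfolding derivs_le_def
  by (auto simp: Dlist_cmult[OF assms(1)] norm_mult mult.assoc intro!: mult_left_mono)

lemma derivs_le_linear:
  assumes "norm w \<le> A * \<eta>" "\<bar>y \<bullet> w\<bar> \<le> A" "0 \<le> \<eta>"
  shows "derivs_le k A \<eta> (\<lambda>y. complex_of_real (y \<bullet> w)) y"
proof (cases k)
  case (Suc j)
  have "norm (complex_of_real (v \<bullet> w)) \<le> A * \<eta>" if "v \<in> Basis" for v
    using Basis_le_norm[OF that, of w] assms(1) by (simp add: inner_commute)
  then show ?thesis
    using assms unfolding Suc derivs_le_Suc Dv_eqI[OF has_derivative_linear_form]
    by (auto intro!: derivs_le_const)
qed (use assms in \<open>simp add: derivs_le_0\<close>)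

section \<open>The bracket <y> and the Erlang pieces of a symbol\<close>

lemma jbr_ge_1: "1 \<le> jbr y" and jbr_square: "(jbr y)\<^sup>2 = 1 + (norm y)\<^sup>2" and norm_le_jbr: "norm y \<le> jbr y"
proof -
  show "1 \<le> jbr y" by (simp add: jbr_def)
  show "(jbr y)\<^sup>2 = 1 + (norm y)\<^sup>2" by (simp add: jbr_def)
  show "norm y \<le> jbr y" unfolding jbr_def by (rule real_le_rsqrt) simp
qed

text \<open>The complex-valued <y>^2, written as a polynomial so that the closure rules apply; the
  square root in \<open>jbr\<close> is never differentiated.\<close>

definition jq :: "'a::euclidean_space \<Rightarrow> complex" where
  "jq y = 1 + complex_of_real (y \<bullet> y)"

lemma jq_eq: "jq y = complex_of_real ((jbr y)\<^sup>2)"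
  by (simp add: jq_def jbr_square power2_norm_eq_inner)

lemma smooth_fun_jq: "smooth_fun jq"
  unfolding jq_def[abs_def] by (intro smooth_fun_add smooth_fun_const smooth_fun_quad)

lemma Dv_jq: "Dv v jq = (\<lambda>y. 2 * complex_of_real (y \<bullet> v))"
proof -
  have "(jq has_derivative (\<lambda>u. 0 + complex_of_real (2 * (y \<bullet> u)))) (at y)" for y :: 'a
    unfolding jq_def[abs_def] by (intro has_derivative_add has_derivative_const has_derivative_quad_form)
  from Dv_eqI[OF this] show ?thesis by simp
qed

lemma abs_inner_Basis_le_jbr: "v \<in> Basis \<Longrightarrow> \<bar>y \<bullet> v\<bar> \<le> jbr y"
  using Basis_le_norm[of v y] norm_le_jbr[of y] by linarith

text \<open>The first derivatives are of size <y>, the second of size 1 and all others vanish, so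
  <y>^2 has scale 1/<y>. Any larger \<eta> is allowed, since the factors of a piece need a common
  one.\<close>

lemma derivs_le_jq:
  assumes "1 / jbr y \<le> \<eta>"
  shows "derivs_le k (2 * (jbr y)\<^sup>2) \<eta> jq y"
proof (cases k)
  case 0
  then show ?thesis by (simp add: derivs_le_0 jq_eq norm_power)
next
  case (Suc j)
  have r: "1 \<le> jbr y" by (rule jbr_ge_1)
  have \<eta>: "1 \<le> jbr y * \<eta>" "0 \<le> \<eta>" using assms r by (auto simp: field_simps intro: order_trans[of 0 "1 / jbr y"])
  have rr: "jbr y \<le> (jbr y)\<^sup>2 * \<eta>"
    using mult_left_mono[OF \<eta>(1), of "jbr y"] r by (simp add: power2_eq_square mult_ac)
  have "derivs_le j (2 * (jbr y)\<^sup>2 * \<eta>) \<eta> (\<lambda>y. 2 * complex_of_real (y \<bullet> v)) y" if v: "v \<in> Basis" for v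
  proof -
    have "derivs_le j (norm (2::complex) * ((jbr y)\<^sup>2 * \<eta>)) \<eta> (\<lambda>y. 2 * complex_of_real (y \<bullet> v)) y"
    proof (intro derivs_le_cmult smooth_fun_linear derivs_le_linear)
      have "1 \<le> (jbr y * \<eta>) * (jbr y * \<eta>)" using mult_mono[OF \<eta>(1) \<eta>(1)] \<eta> r by simp
      then show "norm v \<le> (jbr y)\<^sup>2 * \<eta> * \<eta>" using v by (simp add: power2_eq_square mult_ac)
      show "\<bar>y \<bullet> v\<bar> \<le> (jbr y)\<^sup>2 * \<eta>" using abs_inner_Basis_le_jbr[OF v, of y] rr by linarith
    qed fact
    then show ?thesis by (simp add: mult.assoc)
  qed
  then show ?thesis unfolding Suc derivs_le_Suc Dv_jq by (simp add: jq_eq norm_power)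
qed

lemma derivs_le_jq_power:
  assumes "1 / jbr y \<le> \<eta>"
  shows "derivs_le k ((2 ^ k * (2 * (jbr y)\<^sup>2)) ^ j) \<eta> (\<lambda>y. jq y ^ j) y"
proof (induction j)
  case 0
  have "0 \<le> \<eta>" using assms jbr_ge_1[of y] by (auto intro: order_trans[of 0 "1 / jbr y"])
  then show ?case by (auto intro!: derivs_le_const)
next
  case (Suc j)
  have "0 \<le> \<eta>" using assms jbr_ge_1[of y] by (auto intro: order_trans[of 0 "1 / jbr y"])
  with derivs_le_mult[OF smooth_fun_jq smooth_fun_power[OF smooth_fun_jq] derivs_le_jq[OF assms] Suc]
  show ?case by (simp add: mult_ac)
qed

text \<open>A derivative brings down the factor -2 t (y . v), and a further one may fall on that
  factor. Since \<eta> = 1/<y> + t <y>, the factor is at most a multiple of \<eta>, and its own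
  derivative is of size t = (1/<y>) (t <y>) \<le> \<eta>^2. The constant closes the recursion
  because 2^(k+1) 2^(k*k) \<le> 2^((k+1)*(k+1)).\<close>

lemma derivs_le_exp_jq:
  fixes y :: "'a::euclidean_space"
  assumes t: "0 < t" and \<eta>_def: "\<eta> = (1 + t * (jbr y)\<^sup>2) / jbr y"
  shows "derivs_le k (2 ^ (k * k) * exp (- t * (jbr y)\<^sup>2)) \<eta> (\<lambda>y. exp (complex_of_real (- t) * jq y)) y"
proof (induction k)
  case 0
  show ?case by (simp add: derivs_le_0 jq_eq)
next
  case (Suc k)
  let ?E = "\<lambda>y. exp (complex_of_real (- t) * jq y)"
  let ?e = "exp (- t * (jbr y)\<^sup>2)"
  have r: "1 \<le> jbr y" by (rule jbr_ge_1)
  have \<eta>0: "0 \<le> \<eta>" using t r by (simp add: \<eta>_def)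
  have eta: "\<eta> = 1 / jbr y + t * jbr y" using r by (simp add: \<eta>_def field_simps power2_eq_square)
  have tr: "t * jbr y \<le> \<eta>" using r eta by simp
  have tt: "t \<le> \<eta> * \<eta>"
  proof -
    have "t = (1 / jbr y) * (t * jbr y)" using r by simp
    also have "\<dots> \<le> \<eta> * \<eta>" using r t eta by (intro mult_mono) auto
    finally show ?thesis .
  qed
  have sE: "smooth_fun ?E" by (intro smooth_fun_exp smooth_fun_mult smooth_fun_const smooth_fun_jq)
  have dE: "Dv v ?E = (\<lambda>y. (complex_of_real (- 2 * t) * complex_of_real (y \<bullet> v)) * ?E y)" for v
  proof -
    have "Dv v ?E = (\<lambda>y. Dv v (\<lambda>y. complex_of_real (- t) * jq y) y * ?E y)"
      by (rule Dv_exp) (intro smooth_fun_differentiable smooth_fun_mult smooth_fun_const smooth_fun_jq)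
    also have "Dv v (\<lambda>y. complex_of_real (- t) * jq y) = (\<lambda>y. complex_of_real (- t) * Dv v jq y)"
      using Dv_mult[of "\<lambda>_. complex_of_real (- t)" jq v] Dv_const[of v "complex_of_real (- t)"]
      by (simp add: smooth_fun_differentiable smooth_fun_jq)
    finally show ?thesis unfolding Dv_jq by (simp add: mult_ac)
  qed
  have e1: "norm (?E y) = ?e" by (simp add: jq_eq)
  have p1: "(1::real) \<le> 2 ^ (Suc k * Suc k)" by (rule one_le_power) simp
  have p2: "2 ^ k * 2 * 2 ^ (k * k) \<le> (2::real) ^ (Suc k * Suc k)"
  proof -
    have "2 ^ k * 2 * 2 ^ (k * k) = (2::real) ^ (k + 1 + k * k)" by (simp add: power_add)
    also have "\<dots> \<le> 2 ^ (Suc k * Suc k)" by (rule power_increasing) auto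
    finally show ?thesis .
  qed
  have "derivs_le k (2 ^ (Suc k * Suc k) * ?e * \<eta>) \<eta> (Dv v ?E) y" if v: "v \<in> Basis" for v
  proof -
    have lin: "derivs_le k (norm (complex_of_real (- 2 * t)) * (\<eta> / t)) \<eta> (\<lambda>y. complex_of_real (- 2 * t) * complex_of_real (y \<bullet> v)) y"
    proof (intro derivs_le_cmult smooth_fun_linear derivs_le_linear)
      show "norm v \<le> \<eta> / t * \<eta>" using tt t v by (simp add: field_simps)
      show "\<bar>y \<bullet> v\<bar> \<le> \<eta> / t" using abs_inner_Basis_le_jbr[OF v, of y] tr t by (simp add: field_simps) (metis mult.commute mult_left_mono less_imp_le order_trans)
    qed fact
    have "derivs_le k (2 ^ k * (norm (complex_of_real (- 2 * t)) * (\<eta> / t)) * (2 ^ (k * k) * ?e)) \<eta> (Dv v ?E) y"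
      unfolding dE using t \<eta>0
      by (intro derivs_le_mult lin sE Suc smooth_fun_mult smooth_fun_const smooth_fun_linear) auto
    then show ?thesis
    proof (rule derivs_le_mono)
      have "2 ^ k * (norm (complex_of_real (- 2 * t)) * (\<eta> / t)) * (2 ^ (k * k) * ?e)
        = (2 ^ k * 2 * 2 ^ (k * k)) * (?e * \<eta>)" using t by (simp add: norm_mult)
      also have "\<dots> \<le> 2 ^ (Suc k * Suc k) * (?e * \<eta>)"
        using \<eta>0 by (intro mult_right_mono p2) auto
      finally show "2 ^ k * (norm (complex_of_real (- 2 * t)) * (\<eta> / t)) * (2 ^ (k * k) * ?e)
        \<le> 2 ^ (Suc k * Suc k) * ?e * \<eta>" by (simp add: mult_ac)
    qed (use \<eta>0 in auto)
  qed
  moreover have "norm (?E y) \<le> 2 ^ (Suc k * Suc k) * ?e"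
    unfolding e1 using mult_right_mono[OF p1, of ?e] by simp
  ultimately show ?case unfolding derivs_le_Suc by blast
qed

text \<open>For t \<ge> 0 this is b(y) times the Erlang density of rate <y>^2 at t. The formula
  through \<open>jq\<close> shows its smoothness in y and separates the three factors that are
  estimated one by one.\<close>

definition erlang_piece :: "nat \<Rightarrow> real \<Rightarrow> ('a::euclidean_space \<Rightarrow> complex) \<Rightarrow> 'a \<Rightarrow> complex" where
  "erlang_piece k t b y = b y * (complex_of_real (t ^ k / fact k) * (jq y ^ Suc k * exp (complex_of_real (- t) * jq y)))"

lemma erlang_piece_eq:
  "0 \<le> t \<Longrightarrow> erlang_piece k t b y = b y * complex_of_real (erlang_density k ((jbr y)\<^sup>2) t)"
  unfolding erlang_piece_def erlang_density_def jq_eq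
  by (simp add: exp_of_real[symmetric] mult_ac power_mult[symmetric] del: exp_of_real)

lemma smooth_fun_erlang_piece: "smooth_fun b \<Longrightarrow> smooth_fun (erlang_piece k t b)"
  unfolding erlang_piece_def[abs_def]
  by (intro smooth_fun_mult smooth_fun_const smooth_fun_power smooth_fun_exp smooth_fun_jq)

text \<open>The scale is a common upper bound for those of the three factors: <y>^(-\<rho>) for b,
  1/<y> for the power of \<open>jq\<close> and (1 + t <y>^2)/<y> for the exponential. The condition
  \<rho> \<le> 1 enters as 1/<y> \<le> <y>^(-\<rho>).\<close>

lemma derivs_le_erlang_piece:
  assumes b: "smooth_fun b" "derivs_le K A (jbr y powr - \<rho>) b y" and A: "0 \<le> A" and \<rho>: "\<rho> \<le> 1" and t: "0 < t"
  shows "derivs_le K (2 ^ (K + K + K * K) * (2 ^ K * 2) ^ Suc k * (A * (jbr y ^ 2) ^ Suc k * t ^ k * exp (- t * (jbr y)\<^sup>2)))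
    ((1 + t * (jbr y)\<^sup>2) * jbr y powr - \<rho>) (erlang_piece k t b) y"
proof -
  let ?\<eta> = "(1 + t * (jbr y)\<^sup>2) * jbr y powr - \<rho>"
  let ?e = "exp (- t * (jbr y)\<^sup>2)"
  have r: "1 \<le> jbr y" by (rule jbr_ge_1)
  have s: "1 \<le> 1 + t * (jbr y)\<^sup>2" using t by simp
  have ir: "1 / jbr y \<le> jbr y powr - \<rho>"
  proof -
    have "1 / jbr y = jbr y powr - 1" using r by (simp add: powr_minus_divide)
    also have "\<dots> \<le> jbr y powr - \<rho>" using \<rho> r by (intro powr_mono) auto
    finally show ?thesis .
  qed
  have le1: "jbr y powr - \<rho> \<le> ?\<eta>" using mult_right_mono[OF s, of "jbr y powr - \<rho>"] by simp
  have le2: "(1 + t * (jbr y)\<^sup>2) / jbr y \<le> ?\<eta>" using mult_left_mono[OF ir, of "1 + t * (jbr y)\<^sup>2"] s by simp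
  have le3: "1 / jbr y \<le> ?\<eta>" using ir le1 by linarith
  have \<eta>0: "0 \<le> ?\<eta>" using s by simp
  have db: "derivs_le K A ?\<eta> b y"
    by (rule derivs_le_mono[OF b(2)]) (use A le1 in auto)
  have dE: "derivs_le K (2 ^ (K * K) * ?e) ?\<eta> (\<lambda>y. exp (complex_of_real (- t) * jq y)) y"
    by (rule derivs_le_mono[OF derivs_le_exp_jq[OF t refl]]) (use le2 s r in auto)
  have s1: "smooth_fun (\<lambda>y::'a. exp (complex_of_real (- t) * jq y))"
    by (intro smooth_fun_exp smooth_fun_mult smooth_fun_const smooth_fun_jq)
  have "derivs_le K (2 ^ K * A * (norm (complex_of_real (t ^ k / fact k)) * (2 ^ K * ((2 ^ K * (2 * (jbr y)\<^sup>2)) ^ Suc k) * (2 ^ (K * K) * ?e))))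
     ?\<eta> (erlang_piece k t b) y"
    unfolding erlang_piece_def[abs_def]
    using A \<eta>0 t
    by (intro derivs_le_mult derivs_le_cmult db dE derivs_le_jq_power le3 b s1 smooth_fun_power smooth_fun_jq
        smooth_fun_mult smooth_fun_const) auto
  then show ?thesis
  proof (rule derivs_le_mono)
    have n: "norm (complex_of_real (t ^ k / fact k)) \<le> t ^ k"
    proof -
      have "t ^ k / fact k \<le> t ^ k / 1" using t by (intro divide_left_mono) (auto simp: fact_ge_1)
      then show ?thesis using t by (simp add: norm_divide norm_power)
    qed
    have "2 ^ K * A * (norm (complex_of_real (t ^ k / fact k)) * (2 ^ K * ((2 ^ K * (2 * (jbr y)\<^sup>2)) ^ Suc k) * (2 ^ (K * K) * ?e)))
      \<le> 2 ^ K * A * (t ^ k * (2 ^ K * ((2 ^ K * (2 * (jbr y)\<^sup>2)) ^ Suc k) * (2 ^ (K * K) * ?e)))"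
      using A by (intro mult_left_mono mult_right_mono n) auto
    also have "\<dots> = 2 ^ (K + K + K * K) * (2 ^ K * 2) ^ Suc k * (A * (jbr y ^ 2) ^ Suc k * t ^ k * ?e)"
      unfolding power_add power_mult_distrib by (simp add: mult_ac)
    finally show "2 ^ K * A * (norm (complex_of_real (t ^ k / fact k)) * (2 ^ K * ((2 ^ K * (2 * (jbr y)\<^sup>2)) ^ Suc k) * (2 ^ (K * K) * ?e)))
      \<le> 2 ^ (K + K + K * K) * (2 ^ K * 2) ^ Suc k * (A * (jbr y ^ 2) ^ Suc k * t ^ k * ?e)" .
  qed (use A t \<eta>0 in auto)
qed

subsection \<open>Integration by parts\<close>

lemma integrable_lborel_translate:
  fixes F :: "'a::euclidean_space \<Rightarrow> complex"
  assumes "integrable lborel F"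
  shows "integrable lborel (\<lambda>x. F (c + x))" and "(\<integral>x. F (c + x) \<partial>lborel) = (\<integral>x. F x \<partial>lborel)"
proof -
  have [measurable]: "F \<in> borel_measurable borel" using borel_measurable_integrable[OF assms] by simp
  show "integrable lborel (\<lambda>x. F (c + x))"
    using assms by (subst (asm) lborel_distr_plus[of c, symmetric]) (simp add: integrable_distr_eq)
  show "(\<integral>x. F (c + x) \<partial>lborel) = (\<integral>x. F x \<partial>lborel)"
    by (subst (2) lborel_distr_plus[of c, symmetric]) (simp add: integral_distr)
qed

text \<open>Boundary terms do not arise: F(x + e) - F(x) is the integral of the derivative over the
  unit segment from x to x + e. Integrated over x, the left side is 0 by translation invariance, and
  by Fubini the right side is the integral of the derivative.\<close>

lemma integral_Dv_eq_0:
  fixes F :: "'a::euclidean_space \<Rightarrow> complex"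
  assumes F: "smooth_fun F" "integrable lborel F" "integrable lborel (Dv e F)" and e: "e \<in> Basis"
  shows "(\<integral>x. Dv e F x \<partial>lborel) = 0"
proof -
  have cont: "continuous_on UNIV (Dv e F)"
    by (rule smooth_fun_continuous[OF smooth_fun_Dv[OF F(1) e]])
  have [measurable]: "Dv e F \<in> borel_measurable borel"
    by (rule smooth_fun_borel[OF smooth_fun_Dv[OF F(1) e]])
  have ftc: "(\<integral>\<tau>. indicator {0..1} \<tau> *\<^sub>R Dv e F (\<tau> *\<^sub>R e + x) \<partial>lborel) = F (e + x) - F x" for x
  proof -
    have "(\<integral>\<tau>. indicator {0..1} \<tau> *\<^sub>R Dv e F (\<tau> *\<^sub>R e + x) \<partial>lborel) = F (1 *\<^sub>R e + x) - F (0 *\<^sub>R e + x)"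
    proof (rule integral_FTC_Icc)
      fix \<tau> :: real
      have "((\<lambda>\<tau>. F (\<tau> *\<^sub>R e + x)) has_derivative (\<lambda>s. frechet_derivative F (at (\<tau> *\<^sub>R e + x)) (s *\<^sub>R e + 0))) (at \<tau> within {0..1})"
        by (rule has_derivative_compose[OF _ has_derivative_frechet[OF smooth_fun_differentiable[OF F(1)]]])
          (auto intro!: derivative_eq_intros)
      moreover have "frechet_derivative F (at (\<tau> *\<^sub>R e + x)) (s *\<^sub>R e + 0) = s *\<^sub>R Dv e F (\<tau> *\<^sub>R e + x)" for s
        using linear_frechet_derivative[OF smooth_fun_differentiable[OF F(1)], of "\<tau> *\<^sub>R e + x"]
        by (simp add: linear_cmul)
      ultimately show "((\<lambda>\<tau>. F (\<tau> *\<^sub>R e + x)) has_vector_derivative Dv e F (\<tau> *\<^sub>R e + x)) (at \<tau> within {0..1})"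
        by (simp only: has_vector_derivative_def)
    next
      show "continuous_on {0..1} (\<lambda>\<tau>. Dv e F (\<tau> *\<^sub>R e + x))"
        by (rule continuous_on_compose2[OF cont]) (auto intro!: continuous_intros)
    qed simp
    then show ?thesis by simp
  qed
  have int: "integrable (lborel \<Otimes>\<^sub>M lborel) (\<lambda>(\<tau>::real, x). indicator {0..1} \<tau> *\<^sub>R Dv e F (\<tau> *\<^sub>R e + x))"
  proof (rule lborel_pair.Fubini_integrable)
    have "(\<integral>x. norm (Dv e F (\<tau> *\<^sub>R e + x)) \<partial>lborel) = (\<integral>x. norm (Dv e F x) \<partial>lborel)" for \<tau>
    proof -
      have "(\<integral>x. complex_of_real (norm (Dv e F (\<tau> *\<^sub>R e + x))) \<partial>lborel) = (\<integral>x. complex_of_real (norm (Dv e F x)) \<partial>lborel)"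
        by (rule integrable_lborel_translate) (intro integrable_of_real integrable_norm F(3))
      then show ?thesis by (simp only: integral_complex_of_real of_real_eq_iff)
    qed
    then show "integrable lborel (\<lambda>\<tau>::real. \<integral>x. norm (case (\<tau>, x) of (\<tau>, x) \<Rightarrow> indicator {0..1} \<tau> *\<^sub>R Dv e F (\<tau> *\<^sub>R e + x)) \<partial>lborel)"
      by simp
    show "AE \<tau> in lborel. integrable lborel (\<lambda>x. case (\<tau>, x) of (\<tau>, x) \<Rightarrow> indicator {0..1::real} \<tau> *\<^sub>R Dv e F (\<tau> *\<^sub>R e + x))"
      using integrable_lborel_translate(1)[OF F(3)] by simp
  qed measurable
  have "(\<integral>x. (\<integral>\<tau>. indicator {0..1} \<tau> *\<^sub>R Dv e F (\<tau> *\<^sub>R e + x) \<partial>lborel) \<partial>lborel)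
    = (\<integral>\<tau>. (\<integral>x. indicator {0..1::real} \<tau> *\<^sub>R Dv e F (\<tau> *\<^sub>R e + x) \<partial>lborel) \<partial>lborel)"
    using lborel_pair.Fubini_integral[OF int] by simp
  also have "\<dots> = (\<integral>\<tau>. indicator {0..1::real} \<tau> *\<^sub>R (\<integral>x. Dv e F x \<partial>lborel) \<partial>lborel)"
    by (simp add: integrable_lborel_translate(2)[OF F(3)] del: Dlist.simps)
  also have "\<dots> = (\<integral>x. Dv e F x \<partial>lborel)" by simp
  finally have "(\<integral>x. Dv e F x \<partial>lborel) = (\<integral>x. F (e + x) - F x \<partial>lborel)" unfolding ftc by simp
  also have "\<dots> = 0" using integrable_lborel_translate[OF F(2), of e] F(2) by simp
  finally show ?thesis .
qed

lemma smooth_fun_cis: "smooth_fun (\<lambda>\<xi>. cis (- (y \<bullet> \<xi>)))"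
  and Dv_cis: "Dv e (\<lambda>\<xi>. cis (- (y \<bullet> \<xi>))) = (\<lambda>\<xi>. - \<i> * complex_of_real (y \<bullet> e) * cis (- (y \<bullet> \<xi>)))"
proof -
  have eq: "cis (- (y \<bullet> \<xi>)) = exp (- \<i> * complex_of_real (\<xi> \<bullet> y))" for \<xi>
    by (simp add: cis_conv_exp inner_commute)
  have s: "smooth_fun (\<lambda>\<xi>. - \<i> * complex_of_real (\<xi> \<bullet> y))"
    by (intro smooth_fun_mult smooth_fun_const smooth_fun_linear)
  show "smooth_fun (\<lambda>\<xi>. cis (- (y \<bullet> \<xi>)))" unfolding eq by (intro smooth_fun_exp s)
  have "Dv e (\<lambda>\<xi>. - \<i> * complex_of_real (\<xi> \<bullet> y)) = (\<lambda>\<xi>. - \<i> * complex_of_real (e \<bullet> y))"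
    using Dv_mult[of "\<lambda>_. - \<i>" "\<lambda>\<xi>. complex_of_real (\<xi> \<bullet> y)" e] Dv_const[of e "- \<i>"]
      Dv_eqI[OF has_derivative_linear_form, of e y]
    by (simp add: smooth_fun_differentiable smooth_fun_linear del: Dlist.simps)
  then show "Dv e (\<lambda>\<xi>. cis (- (y \<bullet> \<xi>))) = (\<lambda>\<xi>. - \<i> * complex_of_real (y \<bullet> e) * cis (- (y \<bullet> \<xi>)))"
    unfolding eq Dv_exp(1)[OF smooth_fun_differentiable[OF s]] by (simp add: inner_commute)
qed

text \<open>The derivative of f times the character has integral 0; the product rule splits it into
  the two sides of the claim.\<close>

lemma fourier_Dv:
  fixes f :: "'a::euclidean_space \<Rightarrow> complex"
  assumes f: "smooth_fun f" "integrable lborel f" "integrable lborel (Dv e f)" and e: "e \<in> Basis"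
  shows "fourier (Dv e f) y = \<i> * complex_of_real (y \<bullet> e) * fourier f y"
proof -
  let ?c = "\<lambda>\<xi>. cis (- (y \<bullet> \<xi>))"
  have D: "Dv e (\<lambda>\<xi>. f \<xi> * ?c \<xi>) = (\<lambda>\<xi>. (- \<i> * complex_of_real (y \<bullet> e)) * (f \<xi> * ?c \<xi>) + Dv e f \<xi> * ?c \<xi>)"
    by (subst Dv_mult) (auto simp: smooth_fun_differentiable f smooth_fun_cis Dv_cis simp del: Dlist.simps)
  have i: "integrable lborel (\<lambda>\<xi>. f \<xi> * ?c \<xi>)" "integrable lborel (\<lambda>\<xi>. Dv e f \<xi> * ?c \<xi>)"
    by (intro integrable_mult_cis f; simp)+
  have i2: "integrable lborel (\<lambda>\<xi>. (- \<i> * complex_of_real (y \<bullet> e)) * (f \<xi> * ?c \<xi>))"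
    by (intro integrable_mult_right i)
  have "(\<integral>\<xi>. (- \<i> * complex_of_real (y \<bullet> e)) * (f \<xi> * ?c \<xi>) + Dv e f \<xi> * ?c \<xi> \<partial>lborel) = 0"
    using integral_Dv_eq_0[OF smooth_fun_mult[OF f(1) smooth_fun_cis] i(1) _ e]
    unfolding D using Bochner_Integration.integrable_add[OF i2 i(2)] by blast
  then have "(- \<i> * complex_of_real (y \<bullet> e)) * fourier f y + fourier (Dv e f) y = 0"
    unfolding fourier_def by (subst (asm) Bochner_Integration.integral_add[OF i2 i(2)]) (simp only: integral_mult_right_zero)
  then show ?thesis by (simp add: algebra_simps)
qed

text \<open>The composition of the operators 1 - h \<partial>_e over a list of directions. A list
  makes the power n + 1 of the whole product a mere repetition, and every step is a single
  integration by parts.\<close>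

fun wop :: "real \<Rightarrow> 'a::euclidean_space list \<Rightarrow> ('a \<Rightarrow> complex) \<Rightarrow> 'a \<Rightarrow> complex" where
  "wop h [] f = f"
| "wop h (e # es) f = wop h es (\<lambda>y. f y + complex_of_real (- h) * Dv e f y)"

text \<open>The supply of integrable derivatives of which each factor of \<open>wop\<close> uses up
  one order.\<close>

definition Dint :: "nat \<Rightarrow> ('a::euclidean_space \<Rightarrow> complex) \<Rightarrow> bool" where
  "Dint k f \<longleftrightarrow> (\<forall>vs. set vs \<subseteq> Basis \<and> length vs \<le> k \<longrightarrow> integrable lborel (Dlist vs f))"

lemma smooth_fun_step: "smooth_fun f \<Longrightarrow> e \<in> Basis \<Longrightarrow> smooth_fun (\<lambda>y. f y + c * Dv e f y)"
  by (intro smooth_fun_add smooth_fun_mult smooth_fun_const smooth_fun_Dv)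

lemma Dlist_step:
  assumes "smooth_fun f" "e \<in> Basis" "set vs \<subseteq> Basis"
  shows "Dlist vs (\<lambda>y. f y + c * Dv e f y) = (\<lambda>y. Dlist vs f y + c * Dlist (vs @ [e]) f y)"
  using assms
  by (simp add: Dlist_add smooth_fun_mult smooth_fun_const smooth_fun_Dv Dlist_cmult Dlist_append del: Dlist.simps)

lemma Dint_step:
  assumes "smooth_fun f" "e \<in> Basis" "Dint (Suc k) f"
  shows "Dint k (\<lambda>y. f y + c * Dv e f y)"
  unfolding Dint_def
proof (intro allI impI)
  fix vs :: "'a list" assume vs: "set vs \<subseteq> Basis \<and> length vs \<le> k"
  then have "integrable lborel (Dlist vs f)" "integrable lborel (Dlist (vs @ [e]) f)"
    using assms unfolding Dint_def by (auto simp del: Dlist.simps)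
  then show "integrable lborel (Dlist vs (\<lambda>y. f y + c * Dv e f y))"
    using vs assms by (subst Dlist_step) auto
qed

lemma integrable_wop: "smooth_fun f \<Longrightarrow> set es \<subseteq> Basis \<Longrightarrow> Dint (length es) f \<Longrightarrow> integrable lborel (wop h es f)"
proof (induction es arbitrary: f)
  case Nil
  then show ?case unfolding Dint_def by (metis Dlist.simps(1) empty_set empty_subsetI le_refl list.size(3) wop.simps(1))
next
  case (Cons e es)
  then show ?case by (simp add: smooth_fun_step Dint_step del: Dlist.simps of_real_minus)
qed

lemma fourier_wop:
  fixes f :: "'a::euclidean_space \<Rightarrow> complex"
  assumes "smooth_fun f" "set es \<subseteq> Basis" "Dint (length es) f"
  shows "fourier (wop h es f) y = (\<Prod>e\<leftarrow>es. 1 - \<i> * complex_of_real (h * (y \<bullet> e))) * fourier f y"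
  using assms
proof (induction es arbitrary: f)
  case (Cons e es)
  have e: "e \<in> Basis" using Cons.prems by simp
  have i: "integrable lborel f" "integrable lborel (Dv e f)"
  proof -
    have "integrable lborel (Dlist [] f)" using Cons.prems(3) unfolding Dint_def by (metis empty_set empty_subsetI le0 list.size(3))
    then show "integrable lborel f" by simp
    show "integrable lborel (Dv e f)" using Cons.prems(3) e unfolding Dint_def by (auto simp del: Dlist.simps)
  qed
  have i2: "integrable lborel (\<lambda>y. complex_of_real (- h) * Dv e f y)"
    by (intro integrable_mult_right i)
  have "fourier (\<lambda>y. complex_of_real (- h) * Dv e f y) y = complex_of_real (- h) * fourier (Dv e f) y"
    unfolding fourier_def mult.assoc by (rule integral_mult_right_zero)
  then have "fourier (\<lambda>y. f y + complex_of_real (- h) * Dv e f y) y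
     = (1 - \<i> * complex_of_real (h * (y \<bullet> e))) * fourier f y"
    unfolding fourier_add[OF i(1) i2] using fourier_Dv[OF Cons.prems(1) i e, of y]
    by (simp add: algebra_simps del: Dlist.simps)
  then show ?case
    using Cons.IH[OF smooth_fun_step[OF Cons.prems(1) e, of "complex_of_real (- h)"]]
      Dint_step[OF Cons.prems(1) e, of "length es"] Cons.prems
    by (simp add: mult_ac del: Dlist.simps of_real_minus)
qed simp

text \<open>Every factor 1 - h \<partial>_e uses up one order and multiplies the size by 1 + h
  \<eta>, while the scale stays the same.\<close>

lemma derivs_le_wop:
  assumes "smooth_fun f" "set es \<subseteq> Basis" "derivs_le (length es) A \<eta> f y" "0 \<le> A" "0 \<le> \<eta>" "0 \<le> h"
  shows "norm (wop h es f y) \<le> A * (1 + h * \<eta>) ^ length es"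
  using assms
proof (induction es arbitrary: f A)
  case Nil
  then show ?case by (simp add: derivs_le_0)
next
  case (Cons e es)
  have e: "e \<in> Basis" using Cons.prems by simp
  have 1: "derivs_le (length es) A \<eta> f y"
    by (rule derivs_le_mono[OF Cons.prems(3)]) (use Cons.prems in auto)
  have 2: "derivs_le (length es) (A * \<eta>) \<eta> (Dv e f) y"
    using Cons.prems(3) e by (auto simp: derivs_le_Suc)
  have "derivs_le (length es) (A + norm (complex_of_real (- h)) * (A * \<eta>)) \<eta> (\<lambda>y. f y + complex_of_real (- h) * Dv e f y) y"
    by (intro derivs_le_add derivs_le_cmult 1 2 smooth_fun_mult smooth_fun_const smooth_fun_Dv Cons.prems(1) e)
  then have "derivs_le (length es) (A * (1 + h * \<eta>)) \<eta> (\<lambda>y. f y + complex_of_real (- h) * Dv e f y) y"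
    using Cons.prems by (simp add: algebra_simps del: Dlist.simps of_real_minus)
  then have "norm (wop h es (\<lambda>y. f y + complex_of_real (- h) * Dv e f y) y) \<le> A * (1 + h * \<eta>) * (1 + h * \<eta>) ^ length es"
    using Cons.prems e by (intro Cons.IH smooth_fun_step) auto
  then show ?case by (simp add: mult.assoc del: Dlist.simps of_real_minus)
qed

subsection \<open>Decomposition of the symbol\<close>

text \<open>The frequency R at which the piece at time t lives. As <\<Xi>> \<ge> 1, nothing lives
  below frequency 1: times t > 1 are kept at R = 1, where the exponential decay in t takes
  over.\<close>

abbreviation freq_scale :: "real \<Rightarrow> real" where
  "freq_scale t \<equiv> max 1 (t powr (- 1 / 2))"

abbreviation tail_decay :: "real \<Rightarrow> real" where
  "tail_decay t \<equiv> if t \<le> 1 then 1 else exp (- t / 2)"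

text \<open>One term of the exponential series at (1 + s)/2 is at most its sum. Half of the decay is
  spent on the polynomial, and the other half becomes the Gaussian.\<close>

lemma power_exp_bound:
  fixes s :: real
  assumes "0 \<le> s"
  shows "(1 + s) ^ N * exp (- s) \<le> 2 ^ N * fact N * exp (1 / 2) * exp (- s / 2)"
proof -
  have "(\<Sum>n\<in>{N}. inverse (fact n) * ((1 + s) / 2) ^ n) \<le> (\<Sum>n. inverse (fact n) * ((1 + s) / 2) ^ n)"
    using assms by (intro sum_le_suminf summable_exp) auto
  also have "\<dots> = exp ((1 + s) / 2)" unfolding exp_def by simp
  finally have "(1 + s) ^ N \<le> 2 ^ N * fact N * exp ((1 + s) / 2)"
    by (simp add: power_divide field_simps)
  then have "(1 + s) ^ N * exp (- s) \<le> 2 ^ N * fact N * exp ((1 + s) / 2) * exp (- s)"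
    by (rule mult_right_mono) simp
  also have "exp ((1 + s) / 2) * exp (- s) = exp (1 / 2) * exp (- s / 2)"
    unfolding exp_add[symmetric] by (rule arg_cong[of _ _ exp]) (simp add: field_simps)
  then have "2 ^ N * fact N * exp ((1 + s) / 2) * exp (- s) = 2 ^ N * fact N * exp (1 / 2) * exp (- s / 2)"
    by (simp add: mult.assoc)
  finally show ?thesis .
qed

text \<open>Put s = t r^2. For t \<le> 1 one has r = R s^(1/2), so powers of r become powers of R
  times powers of s. For small s each of the K derivatives may cost s^(-1/2) and r^m costs s^(m/2);
  the condition on k says that s^(k+1) outweighs all of this. What remains grows polynomially in s
  and is absorbed by half of the exponential. For t > 1 one has R = 1, and the powers of r are at
  most 1.\<close>

lemma symbol_scalar_bound:
  fixes m \<rho> r t :: real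
  assumes \<rho>: "0 \<le> \<rho>" "\<rho> \<le> 1" and m: "m \<le> 0" and k: "real K \<le> 2 * real (Suc k) + m"
    and t: "0 < t" and r: "1 \<le> r"
  defines "R \<equiv> freq_scale t"
  shows "r powr m * (r\<^sup>2) ^ Suc k * t ^ k * exp (- t * r\<^sup>2) * (1 + R powr \<rho> * ((1 + t * r\<^sup>2) * r powr - \<rho>)) ^ K
    \<le> 4 ^ K * (2 ^ (2 * K + Suc k) * fact (2 * K + Suc k) * exp (1 / 2)) * (R powr m / t * exp (- (t * r\<^sup>2) / 2))"
proof -
  define s where "s = t * r\<^sup>2"
  have s: "0 < s" using t r by (simp add: s_def)
  have rk: "(r\<^sup>2) ^ Suc k * t ^ k = s ^ Suc k / t"
    using t by (simp add: s_def power_mult_distrib field_simps)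
  have key: "r powr m * s ^ Suc k * (1 + R powr \<rho> * ((1 + s) * r powr - \<rho>)) ^ K
     \<le> R powr m * (4 ^ K * (1 + s) ^ (2 * K + Suc k))"
  proof (cases "t \<le> 1")
    case True
    have tp: "1 \<le> t powr (- 1 / 2)"
      using powr_mono2'[of "- 1 / 2" t 1] True t by simp
    then have R: "R = t powr (- 1 / 2)" by (simp add: R_def)
    have R1: "1 \<le> R" by (simp add: R_def)
    have Rs: "r = R * s powr (1 / 2)"
    proof -
      have "R * s powr (1 / 2) = t powr (- 1 / 2) * t powr (1 / 2) * (r\<^sup>2) powr (1 / 2)"
        unfolding R s_def using t r by (subst powr_mult) auto
      also have "t powr (- 1 / 2) * t powr (1 / 2) = 1" using t by (simp add: powr_add[symmetric])
      also have "(r\<^sup>2) powr (1 / 2) = r" using r by (simp add: powr_half_sqrt)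
      finally show ?thesis by simp
    qed
    have rm: "r powr m = R powr m * s powr (m / 2)"
      unfolding Rs using R1 s by (subst powr_mult) (auto simp: powr_powr)
    have Rr: "R powr \<rho> * r powr - \<rho> = s powr (- \<rho> / 2)"
    proof -
      have "R powr \<rho> * r powr - \<rho> = (R powr \<rho> * R powr - \<rho>) * (s powr (1 / 2)) powr - \<rho>"
        using Rs R1 s by (metis mult.assoc powr_mult powr_ge_zero)
      also have "R powr \<rho> * R powr - \<rho> = 1" using R1 by (simp add: powr_add[symmetric])
      finally show ?thesis by (simp add: powr_powr)
    qed
    \<comment> \<open>For s < 1 the exponent \<rho> is replaced by its worst value 1, so that the
      condition on k need not involve \<rho>.\<close>
    have sr: "s powr (- \<rho> / 2) \<le> 1 + s powr (- 1 / 2)"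
    proof (cases "1 \<le> s")
      case True
      then have "s powr (- \<rho> / 2) \<le> s powr 0" using \<rho> by (intro powr_mono) auto
      then show ?thesis using s by (simp add: add_increasing2)
    next
      case False
      then have "s powr (- \<rho> / 2) \<le> s powr (- 1 / 2)" using \<rho> s by (intro powr_mono') auto
      then show ?thesis by simp
    qed
    \<comment> \<open>Both summands are brought to the form s^(-1/2) (1 + s), the first one by 2
      s^(1/2) \<le> 1 + s; then the power s^(-K/2) can be split off.\<close>
    have s12: "1 + s powr (- 1 / 2) \<le> 2 * (s powr (- 1 / 2) * (1 + s))"
    proof -
      have "2 * s powr (1 / 2) \<le> 1 + s"
      proof -
        have "0 \<le> (sqrt s - 1)\<^sup>2" by simp
        also have "\<dots> = s + 1 - 2 * sqrt s" using s by (simp add: power2_diff)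
        finally show ?thesis using s by (simp add: powr_half_sqrt)
      qed
      from mult_left_mono[OF this, of "s powr (- 1 / 2)"]
      have "2 * (s powr (- 1 / 2) * s powr (1 / 2)) \<le> s powr (- 1 / 2) * (1 + s)" by (simp add: mult_ac)
      then have a: "2 \<le> s powr (- 1 / 2) * (1 + s)" using s by (simp add: powr_add[symmetric])
      have "s powr (- 1 / 2) * 1 \<le> s powr (- 1 / 2) * (1 + s)" using s by (intro mult_left_mono) auto
      with a show ?thesis by linarith
    qed
    have "1 + R powr \<rho> * ((1 + s) * r powr - \<rho>) = 1 + (1 + s) * s powr (- \<rho> / 2)"
      using Rr by (simp add: mult_ac)
    also have "\<dots> \<le> 1 + (1 + s) * (1 + s powr (- 1 / 2))"
      using sr s by (intro add_left_mono mult_left_mono) auto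
    also have "\<dots> \<le> 2 * ((1 + s) * (1 + s powr (- 1 / 2)))"
      using mult_mono[of 1 "1 + s" 1 "1 + s powr (- 1 / 2)"] s by simp
    also have "\<dots> \<le> 2 * ((1 + s) * (2 * (s powr (- 1 / 2) * (1 + s))))"
      using s12 s by (intro mult_left_mono) auto
    also have "\<dots> = 4 * (1 + s)\<^sup>2 * s powr (- 1 / 2)" by (simp add: power2_eq_square)
    finally have "(1 + R powr \<rho> * ((1 + s) * r powr - \<rho>)) ^ K \<le> (4 * (1 + s)\<^sup>2 * s powr (- 1 / 2)) ^ K"
      using s by (intro power_mono) auto
    also have "\<dots> = 4 ^ K * (1 + s) ^ (2 * K) * s powr (- real K / 2)"
    proof -
      have "(s powr (- 1 / 2)) ^ K = s powr (- real K / 2)" using s by (simp add: powr_power)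
      then show ?thesis by (simp add: power_mult_distrib power_mult)
    qed
    finally have A: "(1 + R powr \<rho> * ((1 + s) * r powr - \<rho>)) ^ K \<le> 4 ^ K * (1 + s) ^ (2 * K) * s powr (- real K / 2)" .
    have "r powr m * s ^ Suc k * (1 + R powr \<rho> * ((1 + s) * r powr - \<rho>)) ^ K
      \<le> r powr m * s ^ Suc k * (4 ^ K * (1 + s) ^ (2 * K) * s powr (- real K / 2))"
      using s by (intro mult_left_mono A) auto
    also have "\<dots> = R powr m * (4 ^ K * (1 + s) ^ (2 * K) * (s powr (m / 2) * s powr real (Suc k) * s powr (- real K / 2)))"
      unfolding rm powr_realpow[OF s] by (simp add: mult_ac)
    also have "s powr (m / 2) * s powr real (Suc k) * s powr (- real K / 2) = s powr (m / 2 + real (Suc k) - real K / 2)"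
      using s by (simp add: powr_add[symmetric])
    \<comment> \<open>The exponent is nonnegative by the condition on k, so s may be replaced by 1 +
      s.\<close>
    also have "s powr (m / 2 + real (Suc k) - real K / 2) \<le> (1 + s) powr (m / 2 + real (Suc k) - real K / 2)"
      using s k by (intro powr_mono2) auto
    also have "\<dots> \<le> (1 + s) powr real (Suc k)"
      using s m by (intro powr_mono) auto
    also have "\<dots> = (1 + s) ^ Suc k" using s by (subst powr_realpow) auto
    also have "R powr m * (4 ^ K * (1 + s) ^ (2 * K) * (1 + s) ^ Suc k) = R powr m * (4 ^ K * (1 + s) ^ (2 * K + Suc k))"
      by (simp add: power_add mult_ac)
    finally show ?thesis using s by (simp add: mult_left_mono)
  next
    case False
    then have "t powr (- 1 / 2) \<le> 1" using powr_mono2'[of "- 1 / 2" 1 t] by simp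
    then have R: "R = 1" by (simp add: R_def)
    have "r powr m \<le> r powr 0" "r powr - \<rho> \<le> r powr 0" using m \<rho> r by (intro powr_mono; linarith)+
    then have r1: "r powr m \<le> 1" "r powr - \<rho> \<le> 1" using r by auto
    have "1 + R powr \<rho> * ((1 + s) * r powr - \<rho>) \<le> 1 + 1 * ((1 + s) * 1)"
      unfolding R using r1 s by (intro add_left_mono mult_mono) auto
    also have "\<dots> \<le> 4 * (1 + s)\<^sup>2" using s by (simp add: power2_eq_square algebra_simps)
    finally have XK: "(1 + R powr \<rho> * ((1 + s) * r powr - \<rho>)) ^ K \<le> (4 * (1 + s)\<^sup>2) ^ K"
      using s by (intro power_mono) auto
    have sk: "s ^ Suc k \<le> (1 + s) ^ Suc k" using s by (intro power_mono) auto
    have "r powr m * s ^ Suc k * (1 + R powr \<rho> * ((1 + s) * r powr - \<rho>)) ^ K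
      \<le> 1 * (1 + s) ^ Suc k * (4 * (1 + s)\<^sup>2) ^ K"
      using s by (intro mult_mono sk XK r1) auto
    also have "\<dots> = R powr m * (4 ^ K * (1 + s) ^ (2 * K + Suc k))"
      unfolding R power_mult_distrib power_mult[symmetric] power_add by (simp add: mult_ac)
    finally show ?thesis .
  qed
  have "r powr m * (r\<^sup>2) ^ Suc k * t ^ k * exp (- t * r\<^sup>2) * (1 + R powr \<rho> * ((1 + t * r\<^sup>2) * r powr - \<rho>)) ^ K
    = (r powr m * s ^ Suc k * (1 + R powr \<rho> * ((1 + s) * r powr - \<rho>)) ^ K) * (exp (- s) / t)"
    unfolding mult.assoc[of "r powr m"] rk by (simp add: s_def mult_ac)
  also have "\<dots> \<le> (R powr m * (4 ^ K * (1 + s) ^ (2 * K + Suc k))) * (exp (- s) / t)"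
    using t by (intro mult_right_mono key) auto
  also have "\<dots> = 4 ^ K * (R powr m / t) * ((1 + s) ^ (2 * K + Suc k) * exp (- s))" by simp
  also have "\<dots> \<le> 4 ^ K * (R powr m / t) * (2 ^ (2 * K + Suc k) * fact (2 * K + Suc k) * exp (1 / 2) * exp (- s / 2))"
    using t s by (intro mult_left_mono power_exp_bound) auto
  also have "\<dots> = 4 ^ K * (2 ^ (2 * K + Suc k) * fact (2 * K + Suc k) * exp (1 / 2)) * (R powr m / t * exp (- s / 2))"
    by (simp add: mult_ac)
  finally show ?thesis unfolding s_def by simp
qed

text \<open>The exponential is exp(-t/2) exp(-t |y|^2/2). For t \<le> 1 the second factor is the
  Gaussian of width R = t^(-1/2) and the first is dropped; for t > 1 the first is kept and t is
  replaced by 1 in the second.\<close>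

lemma exp_le_gauss:
  fixes y :: "'a::euclidean_space"
  assumes "0 < t"
  shows "exp (- (t * (jbr y)\<^sup>2) / 2) \<le> tail_decay t * gauss (freq_scale t) y"
proof (cases "t \<le> 1")
  case True
  have "1 \<le> t powr (- 1 / 2)"
    using powr_mono2'[of "- 1 / 2" t 1] True assms by simp
  then have R: "freq_scale t = t powr (- 1 / 2)" by simp
  have R2: "(t powr (- 1 / 2))\<^sup>2 = 1 / t"
    using assms by (simp add: power2_eq_square powr_add[symmetric] powr_minus_divide)
  show ?thesis using True assms unfolding R gauss_def jbr_square R2 by (simp add: field_simps)
next
  case False
  then have "t powr (- 1 / 2) \<le> 1" using powr_mono2'[of "- 1 / 2" 1 t] by simp
  then have R: "freq_scale t = 1" by simp
  have "(norm y)\<^sup>2 * 1 \<le> (norm y)\<^sup>2 * t" using False by (intro mult_left_mono) auto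
  then have "- (t * (1 + (norm y)\<^sup>2)) / 2 \<le> - t / 2 + - (norm y)\<^sup>2 / (2 * 1\<^sup>2)"
    by (simp add: field_simps)
  then have "exp (- (t * (1 + (norm y)\<^sup>2)) / 2) \<le> exp (- t / 2) * exp (- (norm y)\<^sup>2 / (2 * 1\<^sup>2))"
    by (simp only: exp_add[symmetric] exp_le_cancel_iff)
  then show ?thesis using False unfolding R gauss_def jbr_square by simp
qed

lemma one_plus_sum_le_prod:
  fixes a :: "'i \<Rightarrow> real"
  assumes "finite I" "\<And>i. i \<in> I \<Longrightarrow> 0 \<le> a i"
  shows "1 + sum a I \<le> (\<Prod>i\<in>I. 1 + a i)"
  using assms
proof induction
  case (insert x F)
  have "0 \<le> sum a F" "0 \<le> a x" using insert by (auto intro: sum_nonneg)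
  then have "1 + (a x + sum a F) \<le> (1 + a x) * (1 + sum a F)" by (simp add: algebra_simps)
  also have "\<dots> \<le> (1 + a x) * (\<Prod>i\<in>F. 1 + a i)"
    using insert \<open>0 \<le> a x\<close> by (intro mult_left_mono) auto
  finally show ?case using insert by simp
qed simp

text \<open>The reciprocal of the part of the \<open>wop\<close> multiplier that belongs to one
  component. It is complex because the multiplier of a first-order operator with real coefficients
  is; the estimates use only its modulus.\<close>

definition decay_weight :: "real \<Rightarrow> 'a::euclidean_space \<Rightarrow> complex" where
  "decay_weight h z = 1 / (\<Prod>b\<in>Basis. 1 - \<i> * complex_of_real (h * (z \<bullet> b))) ^ (DIM('a) + 1)"

lemma decay_weight_measurable [measurable]: "decay_weight h \<in> borel_measurable borel"
  unfolding decay_weight_def[abs_def] by measurable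

text \<open>Since |1 - i c|^2 = 1 + c^2, the claim is that the product of the 1 + h^2 z_b^2 is at
  least 1 + h^2 |z|^2, which is the expansion with the mixed terms omitted.\<close>

lemma norm_decay_weight_le:
  fixes z :: "'a::euclidean_space"
  shows "norm (decay_weight h z) \<le> (1 + h\<^sup>2 * (norm z)\<^sup>2) powr (- (real DIM('a) + 1) / 2)"
    and "norm (decay_weight h z) \<le> 1"
proof -
  define P where "P = (\<Prod>b\<in>Basis. 1 + h\<^sup>2 * (z \<bullet> b)\<^sup>2)"
  have n1: "norm (1 - \<i> * complex_of_real c) = (1 + c\<^sup>2) powr (1 / 2)" for c
    by (simp add: cmod_def powr_half_sqrt)
  have "norm (\<Prod>b\<in>Basis. 1 - \<i> * complex_of_real (h * (z \<bullet> b))) = (\<Prod>b\<in>Basis. (1 + (h * (z \<bullet> b))\<^sup>2) powr (1 / 2))"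
    unfolding prod_norm[symmetric] n1 ..
  also have "\<dots> = P powr (1 / 2)"
    unfolding P_def power_mult_distrib by (subst prod_powr_distrib) (auto simp: add_nonneg_nonneg)
  finally have nP: "norm (\<Prod>b\<in>Basis. 1 - \<i> * complex_of_real (h * (z \<bullet> b))) = P powr (1 / 2)" .
  have "(norm z)\<^sup>2 = (\<Sum>b\<in>Basis. (z \<bullet> b)\<^sup>2)"
    by (subst power2_norm_eq_inner, subst euclidean_inner) (simp add: power2_eq_square)
  then have P: "1 + h\<^sup>2 * (norm z)\<^sup>2 \<le> P"
    unfolding P_def using one_plus_sum_le_prod[of Basis "\<lambda>b. h\<^sup>2 * (z \<bullet> b)\<^sup>2"]
    by (simp add: sum_distrib_left)
  have P1: "1 \<le> 1 + h\<^sup>2 * (norm z)\<^sup>2" by simp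
  have P0: "0 < 1 + h\<^sup>2 * (norm z)\<^sup>2" using P1 by linarith
  then have Ppos: "0 < P" using P by linarith
  have "norm (decay_weight h z) = 1 / (P powr (1 / 2)) ^ (DIM('a) + 1)"
    unfolding decay_weight_def norm_divide norm_power nP by simp
  also have "\<dots> = P powr (- (real DIM('a) + 1) / 2)"
  proof -
    have "(P powr (1 / 2)) ^ (DIM('a) + 1) = P powr (real (DIM('a) + 1) * (1 / 2))"
      by (rule powr_power) (use Ppos in auto)
    then have "1 / (P powr (1 / 2)) ^ (DIM('a) + 1) = P powr (- (real (DIM('a) + 1) * (1 / 2)))"
      by (simp only: powr_minus_divide)
    moreover have "- (real (DIM('a) + 1) * (1 / 2)) = - (real DIM('a) + 1) / 2" by (simp add: field_simps)
    ultimately show ?thesis by (simp only:)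
  qed
  finally have e: "norm (decay_weight h z) = P powr (- (real DIM('a) + 1) / 2)" .
  have "P powr (- (real DIM('a) + 1) / 2) \<le> (1 + h\<^sup>2 * (norm z)\<^sup>2) powr (- (real DIM('a) + 1) / 2)"
    using P P0 by (intro powr_mono2') auto
  then show "norm (decay_weight h z) \<le> (1 + h\<^sup>2 * (norm z)\<^sup>2) powr (- (real DIM('a) + 1) / 2)" unfolding e .
  have "P powr (- (real DIM('a) + 1) / 2) \<le> P powr 0"
    using order_trans[OF P1 P] by (intro powr_mono) auto
  also have "\<dots> \<le> 1" by simp
  finally show "norm (decay_weight h z) \<le> 1" unfolding e .
qed

lemma fourier_vec_prod:
  fixes U :: "'N::finite \<Rightarrow> 'a::euclidean_space \<Rightarrow> complex"
  assumes "\<And>j. integrable lborel (U j)"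
  shows "integrable lborel (\<lambda>y. \<Prod>j\<in>UNIV. U j (y $ j))"
    and "fourier (\<lambda>y. \<Prod>j\<in>UNIV. U j (y $ j)) \<Xi> = (\<Prod>j\<in>UNIV. fourier (U j) (\<Xi> $ j))"
proof -
  show "integrable lborel (\<lambda>y. \<Prod>j\<in>UNIV. U j (y $ j))" by (rule integral_vec_prod) fact
  have c: "cis (- (\<Xi> \<bullet> y)) = (\<Prod>j\<in>UNIV. cis (- (\<Xi> $ j \<bullet> y $ j)))" for y
    by (simp add: inner_vec_def cis_conv_exp exp_sum[symmetric] sum_negf sum_distrib_left)
  show "fourier (\<lambda>y. \<Prod>j\<in>UNIV. U j (y $ j)) \<Xi> = (\<Prod>j\<in>UNIV. fourier (U j) (\<Xi> $ j))"
    unfolding fourier_def c prod.distrib[symmetric]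
    by (rule integral_vec_prod(2)[of "\<lambda>j y. U j y * cis (- (\<Xi> $ j \<bullet> y))"]) (intro integrable_mult_cis assms, simp)
qed

text \<open>Let g be the tensor product of the U_j and g = Q g' with Q the multiplier of
  \<open>wop\<close>. The exchange formula moves the transform from g to f, integration by parts
  turns Q times the transform of f into the transform of \<open>wop h es f\<close>, and the exchange
  formula moves it back to g'. As Q splits over the components, g' is again a tensor
  product.\<close>

lemma integral_weighted_wop:
  fixes U :: "'N::finite \<Rightarrow> 'a::euclidean_space \<Rightarrow> complex" and f :: "'a ^ 'N \<Rightarrow> complex"
  assumes U: "\<And>j. integrable lborel (U j)"
    and f: "smooth_fun f" "Dint (length es) f"
    and es: "es = concat (replicate (DIM('a) + 1) bs)" "distinct bs" "set bs = Basis"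
  shows "(\<integral>\<Xi>. f \<Xi> * (\<Prod>j\<in>UNIV. fourier (U j) (\<Xi> $ j)) \<partial>lborel)
    = (\<integral>\<Xi>. wop h es f \<Xi> * (\<Prod>j\<in>UNIV. fourier (\<lambda>z. U j z * decay_weight h z) (\<Xi> $ j)) \<partial>lborel)"
proof -
  have [measurable]: "U j \<in> borel_measurable borel" for j using borel_measurable_integrable[OF U] by simp
  have es_B: "set es \<subseteq> Basis" using es(3) unfolding es(1) by auto
  have Uw: "integrable lborel (\<lambda>z. U j z * decay_weight h z)" for j
    by (rule Bochner_Integration.integrable_bound[OF U[of j]])
      (auto simp: norm_mult intro!: mult_left_le norm_decay_weight_le(2))
  define g where "g = (\<lambda>y::'a^'N. \<Prod>j\<in>UNIV. U j (y $ j))"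
  define g' where "g' = (\<lambda>y::'a^'N. \<Prod>j\<in>UNIV. U j (y $ j) * decay_weight h (y $ j))"
  have gi: "integrable lborel g" unfolding g_def by (rule fourier_vec_prod(1)[OF U])
  have gi': "integrable lborel g'" unfolding g'_def by (rule fourier_vec_prod(1)[OF Uw])
  have fi: "integrable lborel f"
    using f(2) unfolding Dint_def by (metis Dlist.simps(1) empty_set empty_subsetI le0 list.size(3))
  have wi: "integrable lborel (wop h es f)" by (rule integrable_wop[OF f(1) es_B f(2)])
  define Q where "Q = (\<lambda>y::'a^'N. \<Prod>e\<leftarrow>es. 1 - \<i> * complex_of_real (h * (y \<bullet> e)))"
  have Q_pow: "Q y = (\<Prod>e\<in>Basis. 1 - \<i> * complex_of_real (h * (y \<bullet> e))) ^ (DIM('a) + 1)" for y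
  proof -
    have 1: "(\<Prod>e\<leftarrow>concat (replicate k bs). F e) = (\<Prod>e\<leftarrow>bs. F e) ^ k" for F :: "'a^'N \<Rightarrow> complex" and k
      by (induction k) auto
    show ?thesis unfolding Q_def es(1) 1 using prod.distinct_set_conv_list[OF es(2)] es(3) by metis
  qed
  have Q_prod: "Q y = (\<Prod>j\<in>UNIV. (\<Prod>b\<in>Basis. 1 - \<i> * complex_of_real (h * (y $ j \<bullet> b))) ^ (DIM('a) + 1))" for y
    unfolding Q_pow by (subst Basis_vec_prod) (simp add: inner_axis prod_power_distrib prod.distrib)
  have Q0: "Q y \<noteq> 0" for y
  proof -
    have "1 - \<i> * complex_of_real c \<noteq> 0" for c by (simp add: complex_eq_iff)
    then show ?thesis unfolding Q_pow by simp
  qed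
  have gQ: "g y = Q y * g' y" for y
    unfolding g'_def prod.distrib decay_weight_def g_def[symmetric] prod_dividef Q_prod[symmetric]
    using Q0[of y] by (simp add: g_def)
  have fw: "fourier (wop h es f) y = Q y * fourier f y" for y
    unfolding Q_def by (rule fourier_wop[OF f(1) es_B f(2)])
  have "(\<integral>\<Xi>. f \<Xi> * (\<Prod>j\<in>UNIV. fourier (U j) (\<Xi> $ j)) \<partial>lborel) = (\<integral>\<Xi>. f \<Xi> * fourier g \<Xi> \<partial>lborel)"
    unfolding g_def fourier_vec_prod(2)[OF U] ..
  also have "\<dots> = (\<integral>y. fourier f y * g y \<partial>lborel)" by (rule fourier_exchange[OF fi gi])
  also have "\<dots> = (\<integral>y. fourier (wop h es f) y * g' y \<partial>lborel)"
    unfolding fw gQ by (simp add: mult_ac)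
  also have "\<dots> = (\<integral>\<Xi>. wop h es f \<Xi> * fourier g' \<Xi> \<partial>lborel)" by (rule fourier_exchange[OF wi gi', symmetric])
  also have "\<dots> = (\<integral>\<Xi>. wop h es f \<Xi> * (\<Prod>j\<in>UNIV. fourier (\<lambda>z. U j z * decay_weight h z) (\<Xi> $ j)) \<partial>lborel)"
    unfolding g'_def fourier_vec_prod(2)[OF Uw] ..
  finally show ?thesis .
qed

lemma gauss_vec: "gauss R (\<Xi> :: 'a::euclidean_space ^ 'N) = (\<Prod>j\<in>UNIV. gauss R (\<Xi> $ j))"
proof -
  have "(norm \<Xi>)\<^sup>2 = (\<Sum>j\<in>UNIV. (norm (\<Xi> $ j))\<^sup>2)"
    by (simp add: power2_norm_eq_inner inner_vec_def)
  then show ?thesis by (simp add: gauss_def exp_sum[symmetric] sum_negf sum_divide_distrib)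
qed

text \<open>A consequence of \<open>maxfun p U 0 \<le> A\<close>, and all that is used of it; unlike \<open>maxfun\<close> it is easily translated.\<close>

definition weighted_bound :: "real \<Rightarrow> ('a::euclidean_space \<Rightarrow> complex) \<Rightarrow> real \<Rightarrow> bool" where
  "weighted_bound p U A \<longleftrightarrow> (\<forall>h>0. (\<integral>\<^sup>+ y. ennreal (norm (U y) powr p * (1 + h\<^sup>2 * (norm y)\<^sup>2) powr (- (real DIM('a) + 1) / 2)) \<partial>lborel)
    \<le> ennreal (2 ^ (DIM('a) + 2) * unit_ball_vol (DIM('a)) * A powr p / h ^ DIM('a)))"

text \<open>The weight has modulus at most 1, so its p-th power is at most the weight itself, and
  the weighted p-th power of U has integral of order A^p / h^n. With h = R^\<rho> the product R^n I
  in \<open>gauss_fourier_L1\<close> becomes R^((1-\<rho>) n) A^p.\<close>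

lemma gauss_fourier_weighted:
  fixes U :: "'a::euclidean_space \<Rightarrow> complex"
  assumes U: "integrable lborel U" and p: "1 \<le> p" "p \<le> 2" and A: "0 < A" "weighted_bound p U A"
    and R: "0 < R" and h: "h = R powr \<rho>"
  shows "(\<integral>\<^sup>+\<xi>. ennreal (gauss R \<xi> * norm (fourier (\<lambda>z. U z * decay_weight h z) \<xi>)) \<partial>lborel)
    \<le> ennreal (2 * (2 * pi) ^ DIM('a) * (2 ^ (DIM('a) + 2) * unit_ball_vol (DIM('a))) powr (1 / p)
         * R powr ((1 - \<rho>) * (real DIM('a) / p)) * A)"
proof -
  have [measurable]: "U \<in> borel_measurable borel" using borel_measurable_integrable[OF U] by simp
  let ?c = "2 ^ (DIM('a) + 2) * unit_ball_vol (DIM('a))"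
  have c: "0 < ?c" by simp
  have h0: "0 < h" using R by (simp add: h)
  define I where "I = ?c * A powr p / h ^ DIM('a)"
  have I: "0 < I" using c A h0 by (simp add: I_def)
  have Uw: "integrable lborel (\<lambda>z. U z * decay_weight h z)"
    by (rule Bochner_Integration.integrable_bound[OF U])
      (auto simp: norm_mult intro!: mult_left_le norm_decay_weight_le(2))
  have "(\<integral>\<^sup>+y. ennreal (norm (U y * decay_weight h y) powr p) \<partial>lborel)
    \<le> (\<integral>\<^sup>+ y. ennreal (norm (U y) powr p * (1 + h\<^sup>2 * (norm y)\<^sup>2) powr (- (real DIM('a) + 1) / 2)) \<partial>lborel)"
  proof (intro nn_integral_mono ennreal_leI)
    fix y :: 'a
    have "norm (decay_weight h y) powr p \<le> norm (decay_weight h y) powr 1"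
      using norm_decay_weight_le(2)[of h y] p by (intro powr_mono') auto
    also have "\<dots> \<le> (1 + h\<^sup>2 * (norm y)\<^sup>2) powr (- (real DIM('a) + 1) / 2)"
      using norm_decay_weight_le(1)[of h y] by simp
    finally show "norm (U y * decay_weight h y) powr p \<le> norm (U y) powr p * (1 + h\<^sup>2 * (norm y)\<^sup>2) powr (- (real DIM('a) + 1) / 2)"
      by (auto simp: norm_mult powr_mult intro!: mult_left_mono)
  qed
  also have "\<dots> \<le> ennreal I" using A(2) h0 unfolding weighted_bound_def I_def by blast
  finally have "(\<integral>\<^sup>+y. ennreal (norm (U y * decay_weight h y) powr p) \<partial>lborel) \<le> ennreal I" .
  from gauss_fourier_L1[OF R Uw p I this]
  have "(\<integral>\<^sup>+\<xi>. ennreal (gauss R \<xi> * norm (fourier (\<lambda>z. U z * decay_weight h z) \<xi>)) \<partial>lborel)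
    \<le> ennreal (2 * (2 * pi) ^ DIM('a) * (R ^ DIM('a) * I) powr (1 / p))" .
  also have "(R ^ DIM('a) * I) powr (1 / p) = ?c powr (1 / p) * R powr ((1 - \<rho>) * (real DIM('a) / p)) * A"
  proof -
    have "R ^ DIM('a) / h ^ DIM('a) = R powr ((1 - \<rho>) * real DIM('a))"
      unfolding h using R by (simp add: powr_realpow[symmetric] powr_powr powr_diff[symmetric] algebra_simps)
    note rh = this
    have "R ^ DIM('a) * I = ?c * (R powr ((1 - \<rho>) * real DIM('a)) * A powr p)"
      unfolding I_def rh[symmetric] by simp
    then have "(R ^ DIM('a) * I) powr (1 / p) = (?c * (R powr ((1 - \<rho>) * real DIM('a)) * A powr p)) powr (1 / p)"
      by (rule arg_cong)
    also have "\<dots> = ?c powr (1 / p) * ((R powr ((1 - \<rho>) * real DIM('a))) powr (1 / p) * (A powr p) powr (1 / p))"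
      by (rule trans[OF powr_mult]) (rule arg_cong[OF powr_mult])
    also have "(A powr p) powr (1 / p) = A" using A p by (simp add: powr_powr)
    also have "(R powr ((1 - \<rho>) * real DIM('a))) powr (1 / p) = R powr ((1 - \<rho>) * (real DIM('a) / p))"
      by (simp add: powr_powr)
    finally show ?thesis by (simp only: mult.assoc)
  qed
  finally show ?thesis by (simp only: mult.assoc)
qed

text \<open>The symbol estimates at one frozen x, with a single constant B for the finitely many
  orders in use.\<close>

definition symbol_bounds :: "nat \<Rightarrow> real \<Rightarrow> real \<Rightarrow> real \<Rightarrow> ('a::euclidean_space \<Rightarrow> complex) \<Rightarrow> bool" where
  "symbol_bounds K m \<rho> B b \<longleftrightarrow> (\<forall>vs. set vs \<subseteq> Basis \<and> length vs \<le> K \<longrightarrow>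
     (\<forall>\<Xi>. norm (Dlist vs b \<Xi>) \<le> B * jbr \<Xi> powr (m - \<rho> * real (length vs))))"

text \<open>Two bounds of the same size: the one for plain derivatives supplies the integrability
  that integration by parts asks for, the one for \<open>wop\<close> is the estimate proper. C comes
  before b, B and t, which is what makes the final constant uniform.\<close>

lemma erlang_piece_bounds:
  fixes b :: "'a::euclidean_space \<Rightarrow> complex"
  assumes \<rho>: "0 \<le> \<rho>" "\<rho> \<le> 1" and m: "m \<le> 0" and k: "real K \<le> 2 * real (Suc k) + m"
  obtains C where "0 < C"
    and "\<And>(b :: 'a \<Rightarrow> complex) B t y vs. \<lbrakk>smooth_fun b; 0 \<le> B; 0 < t; set vs \<subseteq> Basis; length vs \<le> K;
       symbol_bounds K m \<rho> B b\<rbrakk>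
       \<Longrightarrow> norm (Dlist vs (erlang_piece k t b) y)
         \<le> C * B * ((freq_scale t) powr m / t * (tail_decay t * gauss (freq_scale t) y))"
    and "\<And>(b :: 'a \<Rightarrow> complex) B t y es. \<lbrakk>smooth_fun b; 0 \<le> B; 0 < t; set es \<subseteq> Basis; length es = K;
       symbol_bounds K m \<rho> B b\<rbrakk>
       \<Longrightarrow> norm (wop ((freq_scale t) powr \<rho>) es (erlang_piece k t b) y)
         \<le> C * B * ((freq_scale t) powr m / t * (tail_decay t * gauss (freq_scale t) y))"
proof -
  define C0 :: real where "C0 = 2 ^ (K + K + K * K) * (2 ^ K * 2) ^ Suc k"
  define C1 :: real where "C1 = 4 ^ K * (2 ^ (2 * K + Suc k) * fact (2 * K + Suc k) * exp (1 / 2))"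
  have C0: "0 < C0" and C1: "0 < C1" by (simp_all add: C0_def C1_def)
  have main: "norm (Dlist vs (erlang_piece k t b) y) \<le> C0 * C1 * B * (R powr m / t * (E * gauss R y)) \<and>
     (length es = K \<and> set es \<subseteq> Basis \<longrightarrow> norm (wop (R powr \<rho>) es (erlang_piece k t b) y) \<le> C0 * C1 * B * (R powr m / t * (E * gauss R y)))"
    if b: "smooth_fun b" and B: "0 \<le> B" and t: "0 < t" and vs: "set vs \<subseteq> Basis" "length vs \<le> K" and
     H: "symbol_bounds K m \<rho> B b"
     and R: "R = freq_scale t" and E: "E = tail_decay t"
    for b :: "'a \<Rightarrow> complex" and B t y vs es R E
  proof -
    define r where "r = jbr y"
    have r: "1 \<le> r" unfolding r_def by (rule jbr_ge_1)
    define \<eta> where "\<eta> = (1 + t * r\<^sup>2) * r powr - \<rho>"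
    have \<eta>: "0 \<le> \<eta>" using t by (simp add: \<eta>_def)
    have R1: "1 \<le> R" by (simp add: R)
    have h: "1 \<le> R powr \<rho>" using R1 \<rho> by (intro ge_one_powr_ge_zero) auto
    have "derivs_le K (B * r powr m) (r powr - \<rho>) b y"
      unfolding derivs_le_def
    proof (intro allI impI)
      fix vs :: "'a list" assume v: "set vs \<subseteq> Basis \<and> length vs \<le> K"
      have "r powr (m - \<rho> * real (length vs)) = r powr m * (r powr - \<rho>) ^ length vs"
        using r by (simp add: powr_power powr_add[symmetric] algebra_simps)
      then show "norm (Dlist vs b y) \<le> B * r powr m * (r powr - \<rho>) ^ length vs"
        using H[unfolded symbol_bounds_def, rule_format, OF v, of y] by (simp add: r_def mult.assoc)
    qed
    then have d: "derivs_le K (C0 * (B * r powr m * (r\<^sup>2) ^ Suc k * t ^ k * exp (- t * r\<^sup>2))) \<eta> (erlang_piece k t b) y"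
      unfolding C0_def \<eta>_def r_def using B \<rho> t by (intro derivs_le_erlang_piece b) auto
    let ?A = "C0 * (B * r powr m * (r\<^sup>2) ^ Suc k * t ^ k * exp (- t * r\<^sup>2))"
    have A0: "0 \<le> ?A" using B C0 t by (intro mult_nonneg_nonneg) auto
    have "?A * (1 + R powr \<rho> * \<eta>) ^ K = (C0 * B) * (r powr m * (r\<^sup>2) ^ Suc k * t ^ k * exp (- t * r\<^sup>2) * (1 + R powr \<rho> * \<eta>) ^ K)"
      by (simp only: mult_ac)
    also have "\<dots> \<le> (C0 * B) * (C1 * (R powr m / t * exp (- (t * r\<^sup>2) / 2)))"
      using C0 B unfolding \<eta>_def R C1_def by (intro mult_left_mono symbol_scalar_bound \<rho> m k t r) auto
    also have "\<dots> = C0 * C1 * B * (R powr m / t * exp (- (t * r\<^sup>2) / 2))"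
      by (simp only: mult_ac)
    also have "\<dots> \<le> C0 * C1 * B * (R powr m / t * (E * gauss R y))"
      using C0 C1 B t exp_le_gauss[OF t, of y] unfolding R E r_def
      by (intro mult_left_mono) auto
    finally have fin: "?A * (1 + R powr \<rho> * \<eta>) ^ K \<le> C0 * C1 * B * (R powr m / t * (E * gauss R y))" .
    have "norm (Dlist vs (erlang_piece k t b) y) \<le> ?A * \<eta> ^ length vs"
      by (rule derivs_leD[OF d vs])
    also have "\<dots> \<le> ?A * (1 + R powr \<rho> * \<eta>) ^ K"
    proof (intro mult_left_mono A0)
      \<comment> \<open>As R^\<rho> \<ge> 1, plain derivatives also obey the bound with 1 + R^\<rho>
        \<eta>, so one scalar inequality serves both estimates.\<close>
      have "1 * \<eta> \<le> R powr \<rho> * \<eta>" using h \<eta> by (intro mult_right_mono) auto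
      then have "\<eta> ^ length vs \<le> (1 + R powr \<rho> * \<eta>) ^ length vs" using \<eta> by (intro power_mono) auto
      also have "\<dots> \<le> (1 + R powr \<rho> * \<eta>) ^ K" using vs \<eta> by (intro power_increasing) auto
      finally show "\<eta> ^ length vs \<le> (1 + R powr \<rho> * \<eta>) ^ K" .
    qed
    also note fin
    finally have 1: "norm (Dlist vs (erlang_piece k t b) y) \<le> C0 * C1 * B * (R powr m / t * (E * gauss R y))" .
    have 2: "norm (wop (R powr \<rho>) es (erlang_piece k t b) y) \<le> C0 * C1 * B * (R powr m / t * (E * gauss R y))"
      if es: "length es = K" "set es \<subseteq> Basis"
    proof -
      have "norm (wop (R powr \<rho>) es (erlang_piece k t b) y) \<le> ?A * (1 + R powr \<rho> * \<eta>) ^ length es"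
        using d es A0 \<eta> by (intro derivs_le_wop smooth_fun_erlang_piece b) auto
      with fin es show ?thesis by simp
    qed
    from 1 2 show ?thesis by blast
  qed
  show thesis
  proof (rule that[of "C0 * C1"])
    show "0 < C0 * C1" using C0 C1 by simp
  next
    fix b :: "'a \<Rightarrow> complex" and B t :: real and y and vs :: "'a list"
    assume "smooth_fun b" "0 \<le> B" "0 < t" "set vs \<subseteq> Basis" "length vs \<le> K"
       "symbol_bounds K m \<rho> B b"
    then show "norm (Dlist vs (erlang_piece k t b) y)
         \<le> C0 * C1 * B * ((freq_scale t) powr m / t * (tail_decay t * gauss (freq_scale t) y))"
      by (intro main[THEN conjunct1]) (assumption | rule refl)+
  next
    fix b :: "'a \<Rightarrow> complex" and B t :: real and y and es :: "'a list"
    assume a: "smooth_fun b" "0 \<le> B" "0 < t" "set es \<subseteq> Basis" "length es = K"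
       and H: "symbol_bounds K m \<rho> B b"
    show "norm (wop ((freq_scale t) powr \<rho>) es (erlang_piece k t b) y)
         \<le> C0 * C1 * B * ((freq_scale t) powr m / t * (tail_decay t * gauss (freq_scale t) y))"
      by (rule main[where vs = "[]", THEN conjunct2, THEN mp]) (rule a H refl | assumption | (use a in simp))+
  qed
qed

section \<open>Integration over the time t\<close>

lemma integrable_erlang_density:
  assumes "0 < l"
  shows "integrable lborel (erlang_density k l)" "(\<integral>t. erlang_density k l t \<partial>lborel) = 1"
proof -
  have "(\<integral>\<^sup>+t. ennreal (erlang_density k l t) \<partial>lborel) = ennreal 1"
    using nn_integral_erlang_ith_moment[OF assms, of k 0] by simp
  then have "has_bochner_integral lborel (erlang_density k l) 1"
    using assms by (intro has_bochner_integral_nn_integral) auto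
  then show "integrable lborel (erlang_density k l)" "(\<integral>t. erlang_density k l t \<partial>lborel) = 1"
    by (auto simp: has_bochner_integral_iff)
qed

text \<open>The density of rate <\<Xi>>^2 has mass 1 in t, so it is a continuous partition of unity.
  It is nonnegative, hence the hypothesis of Fubini reduces to integrability of b G.\<close>

lemma integral_erlang_pieces:
  fixes b G :: "'a::euclidean_space \<Rightarrow> complex"
  assumes b: "smooth_fun b" and bG: "integrable lborel (\<lambda>\<Xi>. b \<Xi> * G \<Xi>)"
  shows "(\<integral>\<Xi>. b \<Xi> * G \<Xi> \<partial>lborel)
    = (\<integral>t. (\<integral>\<Xi>. complex_of_real (erlang_density k ((jbr \<Xi>)\<^sup>2) t) * (b \<Xi> * G \<Xi>) \<partial>lborel) \<partial>lborel)"
proof -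
  define H where "H = (\<lambda>\<Xi>. b \<Xi> * G \<Xi>)"
  have [measurable]: "H \<in> borel_measurable borel" using borel_measurable_integrable[OF bG] by (simp add: H_def)
  have [measurable]: "(jbr :: 'a \<Rightarrow> real) \<in> borel_measurable borel" unfolding jbr_def[abs_def] by measurable
  have q: "0 < (jbr \<Xi>)\<^sup>2" for \<Xi> :: 'a using jbr_ge_1[of \<Xi>] by simp
  have int: "integrable (lborel \<Otimes>\<^sub>M lborel) (\<lambda>(\<Xi>::'a, t). complex_of_real (erlang_density k ((jbr \<Xi>)\<^sup>2) t) * H \<Xi>)"
  proof (rule lborel_pair.Fubini_integrable)
    show "(\<lambda>(\<Xi>::'a, t). complex_of_real (erlang_density k ((jbr \<Xi>)\<^sup>2) t) * H \<Xi>) \<in> borel_measurable (lborel \<Otimes>\<^sub>M lborel)"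
      unfolding erlang_density_def by measurable
    have "(\<integral>t. norm (complex_of_real (erlang_density k ((jbr \<Xi>)\<^sup>2) t) * H \<Xi>) \<partial>lborel) = norm (H \<Xi>)" for \<Xi>
      by (simp add: norm_mult integrable_erlang_density(2)[OF q])
    then show "integrable lborel (\<lambda>\<Xi>. \<integral>t. norm (case (\<Xi>, t) of (\<Xi>::'a, t) \<Rightarrow> complex_of_real (erlang_density k ((jbr \<Xi>)\<^sup>2) t) * H \<Xi>) \<partial>lborel)"
      using bG by (simp add: H_def)
    show "AE \<Xi> in lborel. integrable lborel (\<lambda>t. case (\<Xi>, t) of (\<Xi>::'a, t) \<Rightarrow> complex_of_real (erlang_density k ((jbr \<Xi>)\<^sup>2) t) * H \<Xi>)"
      by (auto intro!: integrable_mult_left integrable_of_real integrable_erlang_density(1)[OF q])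
  qed
  have "(\<integral>\<Xi>. H \<Xi> \<partial>lborel) = (\<integral>\<Xi>. (\<integral>t. complex_of_real (erlang_density k ((jbr \<Xi>)\<^sup>2) t) * H \<Xi> \<partial>lborel) \<partial>lborel)"
    by (simp add: integral_complex_of_real integrable_erlang_density(2)[OF q])
  also have "\<dots> = (\<integral>t. (\<integral>\<Xi>. complex_of_real (erlang_density k ((jbr \<Xi>)\<^sup>2) t) * H \<Xi> \<partial>lborel) \<partial>lborel)"
    using lborel_pair.Fubini_integral[OF int] by simp
  finally show ?thesis unfolding H_def .
qed

text \<open>The size R^(-2d) of a piece, with respect to dt/t. On (0, 1] it is t^(d-1).\<close>

definition dyadic_kernel :: "real \<Rightarrow> real \<Rightarrow> real" where
  "dyadic_kernel d t = (if t \<le> 0 then 0 else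
     freq_scale t powr (- 2 * d) / t * tail_decay t)"

text \<open>The integral of t^(d-1) over (0, 1] is 1/d. For t > 1 the kernel is at most exp(-t/2),
  twice an exponential density of rate 1/2, which accounts for the summand 2.\<close>

lemma nn_integral_dyadic_kernel:
  assumes d: "0 < d"
  shows "(\<integral>\<^sup>+t. ennreal (dyadic_kernel d t) \<partial>lborel) \<le> ennreal (1 / d + 2)"
proof -
  have 1: "(\<integral>\<^sup>+t. ennreal (indicator {0..1} t * t powr (d - 1)) \<partial>lborel) = ennreal (1 / d)"
  proof -
    have "((\<lambda>t. t powr (d - 1)) has_integral (1 powr (d - 1 + 1) / (d - 1 + 1))) {0..1}"
      using d by (intro has_integral_powr_from_0) auto
    then have "((\<lambda>t. t powr (d - 1)) has_integral (1 / d)) {0..1}" by simp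
    then have "(\<integral>\<^sup>+t. ennreal (t powr (d - 1)) * indicator {0..1} t \<partial>lborel) = ennreal (1 / d)"
      by (intro nn_integral_has_integral_lebesgue') auto
    then show ?thesis by (simp add: ennreal_mult' mult.commute ennreal_indicator)
  qed
  have 2: "(\<integral>\<^sup>+t. ennreal (2 * erlang_density 0 (1 / 2) t) \<partial>lborel) = ennreal 2"
    using nn_integral_erlang_ith_moment[of "1 / 2" 0 0] by (simp add: ennreal_mult' nn_integral_cmult)
  have "dyadic_kernel d t \<le> indicator {0..1} t * t powr (d - 1) + 2 * erlang_density 0 (1 / 2) t" for t
  proof -
    consider "t \<le> 0" | "0 < t" "t \<le> 1" | "1 < t" by linarith
    then show ?thesis
    proof cases
      case 1
      then show ?thesis by (auto simp: dyadic_kernel_def)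
    next
      case 2
      have "1 \<le> t powr (- 1 / 2)"
        using powr_mono2'[of "- 1 / 2" t 1] 2 by simp
      then have "freq_scale t powr (- 2 * d) = t powr d" using 2 by (simp add: powr_powr)
      then show ?thesis using 2 by (simp add: dyadic_kernel_def powr_diff)
    next
      case 3
      then have "t powr (- 1 / 2) \<le> 1" using powr_mono2'[of "- 1 / 2" 1 t] by simp
      then have "dyadic_kernel d t = 1 / t * exp (- t / 2)" using 3 by (simp add: dyadic_kernel_def max_def)
      also have "\<dots> \<le> 1 * exp (- t / 2)" using 3 by (intro mult_right_mono) auto
      also have "\<dots> = 2 * erlang_density 0 (1 / 2) t" using 3 by (simp add: erlang_density_def)
      finally show ?thesis using 3 by simp
    qed
  qed
  then have "(\<integral>\<^sup>+t. ennreal (dyadic_kernel d t) \<partial>lborel)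
    \<le> (\<integral>\<^sup>+t. ennreal (indicator {0..1} t * t powr (d - 1)) + ennreal (2 * erlang_density 0 (1 / 2) t) \<partial>lborel)"
    by (intro nn_integral_mono) (auto simp: ennreal_plus[symmetric] simp del: ennreal_plus intro!: ennreal_leI)
  also have "\<dots> = ennreal (1 / d + 2)"
  proof -
    have "(\<integral>\<^sup>+t. ennreal (indicator {0..1} t * t powr (d - 1)) + ennreal (2 * erlang_density 0 (1 / 2) t) \<partial>lborel)
      = ennreal (1 / d) + ennreal 2"
      unfolding 1[symmetric] 2[symmetric] by (rule nn_integral_add) auto
    also have "\<dots> = ennreal (1 / d + 2)" using d by (intro ennreal_plus[symmetric]) auto
    finally show ?thesis .
  qed
  finally show ?thesis .
qed

subsection \<open>The pointwise bound\<close>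

text \<open>After integration by parts the modulus of the symbol factor is at most Q times a
  Gaussian, and everything is a product over j: the integral becomes a product of integrals to which
  \<open>gauss_fourier_weighted\<close> applies. The powers of R multiply to R^(-2d) by the choice
  of d.\<close>

lemma erlang_piece_estimate:
  fixes p :: "'N::finite \<Rightarrow> real" and m \<rho> :: real and bs :: "('a::euclidean_space ^ 'N) list"
  assumes p: "\<And>j. 1 \<le> p j \<and> p j \<le> 2" and \<rho>: "0 \<le> \<rho>" "\<rho> \<le> 1" and m: "m \<le> 0"
    and bs: "distinct bs" "set bs = Basis" and es: "es = concat (replicate (DIM('a) + 1) bs)"
    and k: "real (length es) \<le> 2 * real (Suc k) + m"
    and d: "- 2 * d = m + (1 - \<rho>) * (\<Sum>j\<in>UNIV. real DIM('a) / p j)"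
  obtains C where "0 < C"
    and "\<And>(b :: 'a ^ 'N \<Rightarrow> complex) B (U :: 'N \<Rightarrow> 'a \<Rightarrow> complex) A t. \<lbrakk>smooth_fun b; 0 \<le> B;
       symbol_bounds (length es) m \<rho> B b;
       \<And>j. integrable lborel (U j); \<And>j. 0 < A j; \<And>j. weighted_bound (p j) (U j) (A j); 0 < t\<rbrakk>
       \<Longrightarrow> norm (\<integral>\<Xi>. erlang_piece k t b \<Xi> * (\<Prod>j\<in>UNIV. fourier (U j) (\<Xi> $ j)) \<partial>lborel)
         \<le> C * B * (\<Prod>j\<in>UNIV. A j) * dyadic_kernel d t"
proof -
  obtain C1 where C1: "0 < C1"
    and D1: "\<And>(b :: 'a ^ 'N \<Rightarrow> complex) B t y vs. \<lbrakk>smooth_fun b; 0 \<le> B; 0 < t; set vs \<subseteq> Basis; length vs \<le> length es;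
       symbol_bounds (length es) m \<rho> B b\<rbrakk>
       \<Longrightarrow> norm (Dlist vs (erlang_piece k t b) y)
         \<le> C1 * B * ((freq_scale t) powr m / t * (tail_decay t * gauss (freq_scale t) y))"
    and W1: "\<And>(b :: 'a ^ 'N \<Rightarrow> complex) B t y fs. \<lbrakk>smooth_fun b; 0 \<le> B; 0 < t; set fs \<subseteq> Basis; length fs = length es;
       symbol_bounds (length es) m \<rho> B b\<rbrakk>
       \<Longrightarrow> norm (wop ((freq_scale t) powr \<rho>) fs (erlang_piece k t b) y)
         \<le> C1 * B * ((freq_scale t) powr m / t * (tail_decay t * gauss (freq_scale t) y))"
    using erlang_piece_bounds[where 'a="'a^'N", OF \<rho> m k] by blast
  define c where "c = (\<lambda>j. 2 * (2 * pi) ^ DIM('a) * (2 ^ (DIM('a) + 2) * unit_ball_vol (DIM('a))) powr (1 / p j))"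
  have c: "0 < c j" for j
  proof -
    have "unit_ball_vol (real DIM('a)) > 0" by simp
    then have "unit_ball_vol (real DIM('a)) \<noteq> 0" by linarith
    then show ?thesis unfolding c_def
      by (intro mult_pos_pos zero_less_power powr_gt_zero[THEN iffD2]) auto
  qed
  have es_B: "set es \<subseteq> Basis" using bs(2) unfolding es by auto
  show thesis
  proof (rule that[of "C1 * (\<Prod>j\<in>UNIV. c j)"])
    show "0 < C1 * (\<Prod>j\<in>UNIV. c j)" using C1 c by (simp add: prod_pos)
  next
    fix b :: "'a ^ 'N \<Rightarrow> complex" and B :: real and U :: "'N \<Rightarrow> 'a \<Rightarrow> complex" and A :: "'N \<Rightarrow> real" and t :: real
    assume b: "smooth_fun b" and B: "0 \<le> B"
      and H: "symbol_bounds (length es) m \<rho> B b"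
      and U: "\<And>j. integrable lborel (U j)" and A: "\<And>j. 0 < A j" and wb: "\<And>j. weighted_bound (p j) (U j) (A j)" and t: "0 < t"
    define R where "R = freq_scale t"
    define E where "E = tail_decay t"
    define h where "h = R powr \<rho>"
    define f where "f = erlang_piece k t b"
    define Q where "Q = C1 * B * (R powr m / t * E)"
    have R: "0 < R" by (simp add: R_def)
    have E: "0 < E" by (simp add: E_def)
    have Q0: "0 \<le> Q" unfolding Q_def using C1 B t E by auto
    have sf: "smooth_fun f" unfolding f_def by (rule smooth_fun_erlang_piece[OF b])
    have Df: "norm (Dlist vs f y) \<le> Q * gauss R y" if "set vs \<subseteq> Basis" "length vs \<le> length es" for vs y
      using D1[OF b B t that H, of y] unfolding f_def Q_def R_def E_def by (simp only: mult.assoc)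
    have Wf: "norm (wop h es f y) \<le> Q * gauss R y" for y
      using W1[OF b B t es_B refl H, of y] unfolding f_def Q_def R_def E_def h_def by (simp only: mult.assoc)
    have Df_int: "Dint (length es) f"
      unfolding Dint_def
    proof (intro allI impI)
      fix vs :: "('a^'N) list" assume vs: "set vs \<subseteq> Basis \<and> length vs \<le> length es"
      show "integrable lborel (Dlist vs f)"
      proof (rule Bochner_Integration.integrable_bound)
        show "integrable lborel (\<lambda>y::'a^'N. Q * gauss R y)"
          by (intro integrable_mult_right gauss_integrable R)
        show "Dlist vs f \<in> borel_measurable lborel"
          using smooth_fun_borel[OF smooth_fun_Dlist[OF sf]] vs by simp
        show "AE y in lborel. norm (Dlist vs f y) \<le> norm (Q * gauss R y)"
          using Df vs by (auto intro!: order_trans[OF Df] abs_ge_self)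
      qed
    qed
    have [measurable]: "U j \<in> borel_measurable borel" for j using borel_measurable_integrable[OF U[of j]] by simp
    have nn: "0 \<le> c j * R powr ((1 - \<rho>) * (real DIM('a) / p j)) * A j" for j
      using c[of j] A[of j] by (intro mult_nonneg_nonneg) auto
    let ?F = "\<lambda>j. fourier (\<lambda>z. U j z * decay_weight h z)"
    have "ennreal (norm (\<integral>\<Xi>. f \<Xi> * (\<Prod>j\<in>UNIV. fourier (U j) (\<Xi> $ j)) \<partial>lborel))
      = ennreal (norm (\<integral>\<Xi>. wop h es f \<Xi> * (\<Prod>j\<in>UNIV. ?F j (\<Xi> $ j)) \<partial>lborel))"
      by (subst integral_weighted_wop[OF U sf Df_int es bs, where h = h]) (rule refl)
    also have "\<dots> \<le> (\<integral>\<^sup>+\<Xi>. ennreal (norm (wop h es f \<Xi> * (\<Prod>j\<in>UNIV. ?F j (\<Xi> $ j)))) \<partial>lborel)"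
      by (rule norm_integral_le_nn)
    also have "\<dots> \<le> (\<integral>\<^sup>+\<Xi>. ennreal Q * (\<Prod>j\<in>UNIV. ennreal (gauss R (\<Xi> $ j) * norm (?F j (\<Xi> $ j)))) \<partial>lborel)"
    proof (rule nn_integral_mono)
      fix \<Xi> :: "'a^'N"
      have "norm (wop h es f \<Xi> * (\<Prod>j\<in>UNIV. ?F j (\<Xi> $ j))) \<le> (Q * gauss R \<Xi>) * (\<Prod>j\<in>UNIV. norm (?F j (\<Xi> $ j)))"
        unfolding norm_mult prod_norm[symmetric] by (intro mult_right_mono Wf prod_nonneg) auto
      also have "\<dots> = Q * (\<Prod>j\<in>UNIV. gauss R (\<Xi> $ j) * norm (?F j (\<Xi> $ j)))"
        unfolding gauss_vec prod.distrib by (simp only: mult.assoc)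
      finally have "ennreal (norm (wop h es f \<Xi> * (\<Prod>j\<in>UNIV. ?F j (\<Xi> $ j)))) \<le> ennreal (Q * (\<Prod>j\<in>UNIV. gauss R (\<Xi> $ j) * norm (?F j (\<Xi> $ j))))"
        by (rule ennreal_leI)
      also have "\<dots> = ennreal Q * (\<Prod>j\<in>UNIV. ennreal (gauss R (\<Xi> $ j) * norm (?F j (\<Xi> $ j))))"
        unfolding ennreal_mult'[OF Q0] by (subst prod_ennreal) auto
      finally show "ennreal (norm (wop h es f \<Xi> * (\<Prod>j\<in>UNIV. ?F j (\<Xi> $ j)))) \<le> ennreal Q * (\<Prod>j\<in>UNIV. ennreal (gauss R (\<Xi> $ j) * norm (?F j (\<Xi> $ j))))" .
    qed
    also have "\<dots> = ennreal Q * (\<integral>\<^sup>+\<Xi>. (\<Prod>j\<in>UNIV. ennreal (gauss R (\<Xi> $ j) * norm (?F j (\<Xi> $ j)))) \<partial>lborel)"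
      by (rule nn_integral_cmult) measurable
    also have "(\<integral>\<^sup>+\<Xi>. (\<Prod>j\<in>UNIV. ennreal (gauss R (\<Xi> $ j) * norm (?F j (\<Xi> $ j)))) \<partial>lborel)
        = (\<Prod>j\<in>UNIV. \<integral>\<^sup>+\<xi>. ennreal (gauss R \<xi> * norm (?F j \<xi>)) \<partial>lborel)"
      by (rule nn_integral_vec_prod[of "\<lambda>j \<xi>. ennreal (gauss R \<xi> * norm (?F j \<xi>))"]) measurable
    also have "\<dots> \<le> (\<Prod>j\<in>UNIV. ennreal (c j * R powr ((1 - \<rho>) * (real DIM('a) / p j)) * A j))"
      unfolding c_def
      by (intro prod_mono_ennreal gauss_fourier_weighted U A wb R h_def conjunct1[OF p] conjunct2[OF p])
    also have "\<dots> = ennreal (\<Prod>j\<in>UNIV. c j * R powr ((1 - \<rho>) * (real DIM('a) / p j)) * A j)"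
      by (intro prod_ennreal nn)
    finally have "ennreal (norm (\<integral>\<Xi>. f \<Xi> * (\<Prod>j\<in>UNIV. fourier (U j) (\<Xi> $ j)) \<partial>lborel))
       \<le> ennreal Q * ennreal (\<Prod>j\<in>UNIV. c j * R powr ((1 - \<rho>) * (real DIM('a) / p j)) * A j)"
      by (simp add: mult_left_mono)
    also have "\<dots> = ennreal (Q * (\<Prod>j\<in>UNIV. c j * R powr ((1 - \<rho>) * (real DIM('a) / p j)) * A j))"
      using Q0 by (simp add: ennreal_mult')
    finally have "norm (\<integral>\<Xi>. f \<Xi> * (\<Prod>j\<in>UNIV. fourier (U j) (\<Xi> $ j)) \<partial>lborel)
       \<le> Q * (\<Prod>j\<in>UNIV. c j * R powr ((1 - \<rho>) * (real DIM('a) / p j)) * A j)"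
      by (subst (asm) ennreal_le_iff) (intro mult_nonneg_nonneg prod_nonneg Q0 nn)
    also have "Q * (\<Prod>j\<in>UNIV. c j * R powr ((1 - \<rho>) * (real DIM('a) / p j)) * A j)
      = C1 * (\<Prod>j\<in>UNIV. c j) * B * (\<Prod>j\<in>UNIV. A j) * dyadic_kernel d t"
    proof -
      have 1: "(\<Prod>j\<in>UNIV. c j * R powr ((1 - \<rho>) * (real DIM('a) / p j)) * A j)
        = (\<Prod>j\<in>UNIV. c j) * R powr ((1 - \<rho>) * (\<Sum>j\<in>UNIV. real DIM('a) / p j)) * (\<Prod>j\<in>UNIV. A j)"
        using R by (simp add: prod.distrib powr_sum sum_distrib_left)
      have 2: "R powr m * R powr ((1 - \<rho>) * (\<Sum>j\<in>UNIV. real DIM('a) / p j)) / t * E = dyadic_kernel d t"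
        unfolding powr_add[symmetric] d[symmetric] dyadic_kernel_def R_def E_def using t by simp
      show ?thesis unfolding 1 2[symmetric] Q_def by (simp add: mult_ac)
    qed
    finally show "norm (\<integral>\<Xi>. erlang_piece k t b \<Xi> * (\<Prod>j\<in>UNIV. fourier (U j) (\<Xi> $ j)) \<partial>lborel)
         \<le> C1 * (\<Prod>j\<in>UNIV. c j) * B * (\<Prod>j\<in>UNIV. A j) * dyadic_kernel d t"
      unfolding f_def .
  qed
qed

text \<open>K is the number of derivatives spent on the weight, n + 1 in every coordinate of the
  product space. K and C are fixed before the symbol, B and the U_j are.\<close>

lemma multilinear_pointwise_bound:
  fixes p :: "'N::finite \<Rightarrow> real" and m \<rho> :: real
  assumes p: "\<And>j. 1 \<le> p j \<and> p j \<le> 2" and \<rho>: "0 \<le> \<rho>" "\<rho> \<le> 1"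
    and m: "m < (\<rho> - 1) * (\<Sum>j\<in>UNIV. real DIM('a::euclidean_space) / p j)"
  obtains K C where "0 < C"
    and "\<forall>(b :: 'a ^ 'N \<Rightarrow> complex) B (U :: 'N \<Rightarrow> 'a \<Rightarrow> complex) A. smooth_fun b \<longrightarrow> 0 \<le> B \<longrightarrow>
       symbol_bounds K m \<rho> B b \<longrightarrow>
       (\<forall>j. integrable lborel (U j) \<and> 0 < A j \<and> weighted_bound (p j) (U j) (A j)) \<longrightarrow>
       norm (\<integral>\<Xi>. b \<Xi> * (\<Prod>j\<in>UNIV. fourier (U j) (\<Xi> $ j)) \<partial>lborel) \<le> C * B * (\<Prod>j\<in>UNIV. A j)"
proof -
  obtain bs :: "('a^'N) list" where bs: "set bs = Basis" "distinct bs"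
    using finite_distinct_list[OF finite_Basis] by blast
  define es where "es = concat (replicate (DIM('a) + 1) bs)"
  define S where "S = (\<Sum>j\<in>UNIV. real DIM('a) / p j)"
  have S: "0 \<le> S" unfolding S_def using p by (intro sum_nonneg divide_nonneg_nonneg) (auto intro: order_trans[of 0 1])
  have "(\<rho> - 1) * S \<le> 0" using \<rho> S by (simp add: mult_nonpos_nonneg)
  then have m0: "m \<le> 0" using m unfolding S_def by linarith
  \<comment> \<open>Half the margin in the condition on m; it is positive because that inequality is
    strict.\<close>
  define d where "d = - (m + (1 - \<rho>) * S) / 2"
  have d: "0 < d" using m unfolding S_def[symmetric] d_def by (simp add: algebra_simps)
  have d2: "- 2 * d = m + (1 - \<rho>) * (\<Sum>j\<in>UNIV. real DIM('a) / p j)" unfolding S_def[symmetric] d_def by simp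
  \<comment> \<open>Large enough that 2 (k + 1) + m is at least the number of derivatives, as the
    scalar estimate requires.\<close>
  obtain k :: nat where "real (length es) - m \<le> real k" using real_arch_simple by blast
  then have k: "real (length es) \<le> 2 * real (Suc k) + m" by simp
  obtain C where C: "0 < C"
    and est: "\<And>(b :: 'a ^ 'N \<Rightarrow> complex) B (U :: 'N \<Rightarrow> 'a \<Rightarrow> complex) A t. \<lbrakk>smooth_fun b; 0 \<le> B;
       symbol_bounds (length es) m \<rho> B b;
       \<And>j. integrable lborel (U j); \<And>j. 0 < A j; \<And>j. weighted_bound (p j) (U j) (A j); 0 < t\<rbrakk>
       \<Longrightarrow> norm (\<integral>\<Xi>. erlang_piece k t b \<Xi> * (\<Prod>j\<in>UNIV. fourier (U j) (\<Xi> $ j)) \<partial>lborel)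
         \<le> C * B * (\<Prod>j\<in>UNIV. A j) * dyadic_kernel d t"
    using erlang_piece_estimate[OF p \<rho> m0 bs(2,1) es_def k d2] by blast
  show thesis
  proof (rule that[of "C * (1 / d + 2)" "length es"], goal_cases)
    case 1
    show ?case using C d by (simp add: add_pos_pos)
  next
    case 2
    show ?case
    proof (intro allI impI)
      fix b :: "'a ^ 'N \<Rightarrow> complex" and B :: real and U :: "'N \<Rightarrow> 'a \<Rightarrow> complex" and A :: "'N \<Rightarrow> real"
      assume b: "smooth_fun b" and B: "0 \<le> B"
        and H: "symbol_bounds (length es) m \<rho> B b"
        and UA: "\<forall>j. integrable lborel (U j) \<and> 0 < A j \<and> weighted_bound (p j) (U j) (A j)"
      have U: "integrable lborel (U j)" and A: "0 < A j" and wb: "weighted_bound (p j) (U j) (A j)" for j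
        using UA by auto
      define G where "G = (\<lambda>\<Xi>::'a^'N. \<Prod>j\<in>UNIV. fourier (U j) (\<Xi> $ j))"
      define c where "c = C * B * (\<Prod>j\<in>UNIV. A j)"
      have c: "0 \<le> c" unfolding c_def using C B A by (intro mult_nonneg_nonneg prod_nonneg) (auto intro: less_imp_le)
      have "norm (\<integral>\<Xi>. b \<Xi> * G \<Xi> \<partial>lborel) \<le> c * (1 / d + 2)"
      proof (cases "integrable lborel (\<lambda>\<Xi>. b \<Xi> * G \<Xi>)")
        case False \<comment> \<open>then the Bochner integral is 0, so no decay of the transforms has to be established\<close>
        then show ?thesis using c d by (simp add: not_integrable_integral_eq)
      next
        case True
        let ?I = "\<lambda>t. \<integral>\<Xi>. complex_of_real (erlang_density k ((jbr \<Xi>)\<^sup>2) t) * (b \<Xi> * G \<Xi>) \<partial>lborel"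
        have I: "norm (?I t) \<le> c * dyadic_kernel d t" if "t \<noteq> 0" for t
        proof (cases "t < 0")
          case True
          then show ?thesis by (simp add: erlang_density_def dyadic_kernel_def)
        next
          case False
          with that have t: "0 < t" by simp
          have "?I t = (\<integral>\<Xi>. erlang_piece k t b \<Xi> * G \<Xi> \<partial>lborel)"
            using t by (intro Bochner_Integration.integral_cong) (auto simp: erlang_piece_eq mult_ac)
          then show ?thesis unfolding c_def G_def by (simp only: est[OF b B H U A wb t])
        qed
        have "ennreal (norm (\<integral>\<Xi>. b \<Xi> * G \<Xi> \<partial>lborel)) = ennreal (norm (\<integral>t. ?I t \<partial>lborel))"
          unfolding integral_erlang_pieces[OF b True, of k] ..
        also have "\<dots> \<le> (\<integral>\<^sup>+t. ennreal (norm (?I t)) \<partial>lborel)" by (rule norm_integral_le_nn)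
        also have "\<dots> \<le> (\<integral>\<^sup>+t. ennreal c * ennreal (dyadic_kernel d t) \<partial>lborel)"
        proof (rule nn_integral_mono_AE)
          show "AE t in lborel. ennreal (norm (?I t)) \<le> ennreal c * ennreal (dyadic_kernel d t)"
            using AE_lborel_singleton[of "0::real"]
          proof eventually_elim
            case (elim t)
            then show ?case using I[of t] c by (auto simp: ennreal_mult'[symmetric] intro!: ennreal_leI)
          qed
        qed
        also have "\<dots> = ennreal c * (\<integral>\<^sup>+t. ennreal (dyadic_kernel d t) \<partial>lborel)"
          by (rule nn_integral_cmult) (unfold dyadic_kernel_def, measurable)
        also have "\<dots> \<le> ennreal c * ennreal (1 / d + 2)"
          by (intro mult_left_mono nn_integral_dyadic_kernel d) simp
        also have "\<dots> = ennreal (c * (1 / d + 2))" using c by (simp add: ennreal_mult')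
        finally show ?thesis using c d by (subst (asm) ennreal_le_iff) auto
      qed
      then show "norm (\<integral>\<Xi>. b \<Xi> * (\<Prod>j\<in>UNIV. fourier (U j) (\<Xi> $ j)) \<partial>lborel) \<le> C * (1 / d + 2) * B * (\<Prod>j\<in>UNIV. A j)"
        unfolding G_def c_def by (simp add: mult_ac)
    qed
  qed
qed

subsection \<open>The maximal operator of a doubling measure\<close>

lemma enn_powr_ennreal: "0 \<le> x \<Longrightarrow> enn_powr (ennreal x) e = ennreal (x powr e)"
  by (simp add: enn_powr_def)

lemma enn_powr_top [simp]: "enn_powr \<top> e = \<top>"
  by (simp add: enn_powr_def)

lemma enn_powr_0 [simp]: "enn_powr 0 e = 0"
  by (simp add: enn_powr_def)

lemma enn_powr_1 [simp]: "enn_powr X 1 = X"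
  by (cases X) (auto simp: enn_powr_def)

lemma enn_powr_mono: "0 \<le> e \<Longrightarrow> X \<le> Y \<Longrightarrow> enn_powr X e \<le> enn_powr Y e"
  by (cases X; cases Y) (auto simp: enn_powr_ennreal top_unique intro!: ennreal_leI powr_mono2)

lemma enn_powr_mult: "enn_powr (X * Y) e = enn_powr X e * enn_powr Y e"
proof (cases "X = 0 \<or> Y = 0")
  case False
  show ?thesis
  proof (cases "X = \<top> \<or> Y = \<top>")
    case True
    have "enn_powr X e \<noteq> 0" "enn_powr Y e \<noteq> 0"
      using False by (cases X; cases Y; auto simp: enn_powr_ennreal)+
    then show ?thesis using True False by (auto simp: ennreal_mult_top ennreal_top_mult)
  next
    case False
    then show ?thesis by (cases X; cases Y) (auto simp: enn_powr_ennreal ennreal_mult[symmetric] powr_mult)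
  qed
qed auto

lemma enn_powr_powr: "enn_powr (enn_powr X a) b = enn_powr X (a * b)"
  by (cases X) (auto simp: enn_powr_ennreal powr_powr)

text \<open>Valid for exponents of every sign because of the conventions: 0 and \<infinity> are
  fixed by all exponents, including 0.\<close>

lemma enn_powr_add: "enn_powr X (a + b) = enn_powr X a * enn_powr X b"
  by (cases X) (auto simp: enn_powr_ennreal powr_add ennreal_mult)

lemma enn_powr_measurable [measurable (raw)]:
  assumes [measurable]: "f \<in> borel_measurable M"
  shows "(\<lambda>x. enn_powr (f x) e) \<in> borel_measurable M"
  unfolding enn_powr_def by measurable

lemma enn_powr_le_iff: "0 < e \<Longrightarrow> enn_powr X e \<le> Y \<longleftrightarrow> X \<le> enn_powr Y (1 / e)"
  using enn_powr_mono[of "1 / e" "enn_powr X e" Y] enn_powr_mono[of e X "enn_powr Y (1 / e)"]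
  by (auto simp: enn_powr_powr)

text \<open>For e > 0 the powers e and 1/e form a Galois connection, so suprema are
  preserved.\<close>

lemma enn_powr_SUP:
  assumes "0 < e"
  shows "enn_powr (SUP i\<in>I. f i) e = (SUP i\<in>I. enn_powr (f i) e)"
proof (rule antisym)
  show "(SUP i\<in>I. enn_powr (f i) e) \<le> enn_powr (SUP i\<in>I. f i) e"
    using assms by (intro SUP_least enn_powr_mono SUP_upper) auto
  show "enn_powr (SUP i\<in>I. f i) e \<le> (SUP i\<in>I. enn_powr (f i) e)"
    unfolding enn_powr_le_iff[OF assms]
  proof (rule SUP_least)
    fix i assume "i \<in> I"
    then show "f i \<le> enn_powr (SUP i\<in>I. enn_powr (f i) e) (1 / e)"
      unfolding enn_powr_le_iff[OF assms, symmetric] by (rule SUP_upper)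
  qed
qed

text \<open>The layer-cake formula. For X = \<infinity> the integral dominates the one for every
  finite value and is therefore infinite.\<close>

lemma enn_powr_eq_integral:
  assumes a: "0 < a"
  shows "enn_powr X a = (\<integral>\<^sup>+l. ennreal (a * l powr (a - 1)) * (indicator {0<..} l * (if ennreal l < X then 1 else 0)) \<partial>lborel)"
proof -
  have fin: "(\<integral>\<^sup>+l. ennreal (a * l powr (a - 1)) * (indicator {0<..} l * (if ennreal l < ennreal x then 1 else 0)) \<partial>lborel) = ennreal (x powr a)"
    if x: "0 \<le> x" for x
  proof -
    have "((\<lambda>l. l powr (a - 1)) has_integral (x powr (a - 1 + 1) / (a - 1 + 1))) {0..x}"
      using a x by (intro has_integral_powr_from_0) auto
    from has_integral_mult_right[OF this, of a]
    have "((\<lambda>l. a * l powr (a - 1)) has_integral (x powr a)) {0..x}" using a by simp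
    then have "(\<integral>\<^sup>+l. ennreal (a * l powr (a - 1)) * indicator {0..x} l \<partial>lborel) = ennreal (x powr a)"
      using a by (intro nn_integral_has_integral_lebesgue') auto
    moreover have "(\<integral>\<^sup>+l. ennreal (a * l powr (a - 1)) * indicator {0..x} l \<partial>lborel)
      = (\<integral>\<^sup>+l. ennreal (a * l powr (a - 1)) * (indicator {0<..} l * (if ennreal l < ennreal x then 1 else 0)) \<partial>lborel)"
    proof (rule nn_integral_cong_AE)
      show "AE l in lborel. ennreal (a * l powr (a - 1)) * indicator {0..x} l
         = ennreal (a * l powr (a - 1)) * (indicator {0<..} l * (if ennreal l < ennreal x then 1 else 0))"
        using AE_lborel_singleton[of "0::real"] AE_lborel_singleton[of x]
        by eventually_elim (auto simp: indicator_def ennreal_less_iff)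
    qed
    ultimately show ?thesis by simp
  qed
  show ?thesis
  proof (cases X)
    case (real x)
    then show ?thesis using fin[of x] by (simp add: enn_powr_ennreal)
  next
    case top
    let ?J = "\<integral>\<^sup>+l. ennreal (a * l powr (a - 1)) * (indicator {0<..} l * (if ennreal l < X then 1 else 0)) \<partial>lborel"
    have "ennreal y \<le> ?J" if "0 \<le> y" for y
    proof -
      have "ennreal y = ennreal ((y powr (1 / a)) powr a)" using a that by (simp add: powr_powr)
      also have "\<dots> = (\<integral>\<^sup>+l. ennreal (a * l powr (a - 1)) * (indicator {0<..} l * (if ennreal l < ennreal (y powr (1 / a)) then 1 else 0)) \<partial>lborel)"
        by (rule fin[symmetric]) simp
      also have "\<dots> \<le> ?J" unfolding top by (intro nn_integral_mono mult_left_mono) auto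
      finally show ?thesis .
    qed
    note ge = this
    have "?J = \<top>"
    proof (cases ?J)
      case (real j)
      then show ?thesis using ge[of "j + 1"] by (simp add: ennreal_le_iff)
    qed
    then show ?thesis using top by simp
  qed
qed

section \<open>The uncentred maximal operator of a measure\<close>

definition maximal :: "'a::euclidean_space measure \<Rightarrow> ('a \<Rightarrow> ennreal) \<Rightarrow> 'a \<Rightarrow> ennreal" where
  "maximal M f x = (SUP B \<in> {ball c r | c r. 0 < r \<and> x \<in> ball c r}. (\<integral>\<^sup>+ y. f y * indicator B y \<partial>M) / emeasure M B)"

lemma maximal_upper:
  "0 < r \<Longrightarrow> x \<in> ball c r \<Longrightarrow> (\<integral>\<^sup>+ y. f y * indicator (ball c r) y \<partial>M) / emeasure M (ball c r) \<le> maximal M f x"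
  unfolding maximal_def by (rule SUP_upper) blast

lemma maximal_least:
  "(\<And>c r. 0 < r \<Longrightarrow> x \<in> ball c r \<Longrightarrow> (\<integral>\<^sup>+ y. f y * indicator (ball c r) y \<partial>M) / emeasure M (ball c r) \<le> Y) \<Longrightarrow> maximal M f x \<le> Y"
  unfolding maximal_def by (rule SUP_least) blast

text \<open>A ball whose average exceeds l witnesses this for every one of its points. This is the
  benefit of the uncentred operator, and the source of all measurability of maximal
  functions.\<close>

lemma open_maximal_greater: "open {x. l < maximal M f x}"
proof (subst open_subopen, intro ballI)
  fix x assume "x \<in> {x. l < maximal M f x}"
  then obtain c r where B: "0 < r" "x \<in> ball c r" "l < (\<integral>\<^sup>+ y. f y * indicator (ball c r) y \<partial>M) / emeasure M (ball c r)"
    unfolding maximal_def less_SUP_iff by blast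
  then have "ball c r \<subseteq> {x. l < maximal M f x}"
    by (auto intro: less_le_trans maximal_upper simp del: mem_ball)
  then show "\<exists>T. open T \<and> x \<in> T \<and> T \<subseteq> {x. l < maximal M f x}" using B(2) open_ball by blast
qed

lemma maximal_measurable [measurable]: "maximal M f \<in> borel_measurable borel"
  by (rule borel_measurableI_greater) (simp add: borel_open open_maximal_greater)

text \<open>Doubling is stated for the dilation by 5 that the Vitali covering lemma
  produces.\<close>

locale doubling_measure =
  fixes M :: "'a::euclidean_space measure" and D :: real
  assumes sets_M [simp, measurable_cong]: "sets M = sets borel"
    and ball_pos: "0 < r \<Longrightarrow> 0 < emeasure M (ball c r)"
    and ball_finite: "emeasure M (ball c r) < \<infinity>"
    and doubling: "0 < r \<Longrightarrow> emeasure M (ball c (5 * r)) \<le> ennreal D * emeasure M (ball c r)"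
begin

lemma space_M [simp]: "space M = UNIV"
  using sets_eq_imp_space_eq[OF sets_M] by simp

sublocale sigma_finite_measure M
proof
  show "\<exists>A. countable A \<and> A \<subseteq> sets M \<and> \<Union> A = space M \<and> (\<forall>a\<in>A. emeasure M a \<noteq> \<infinity>)"
  proof (intro exI[of _ "range (\<lambda>n::nat. ball 0 (real n))"] conjI)
    show "\<Union> (range (\<lambda>n. ball 0 (real n))) = space M"
      using reals_Archimedean2 by auto
  qed (use ball_finite in \<open>auto simp: less_top[symmetric]\<close>)
qed

text \<open>The superlevel set is covered by balls B with l M(B) < \<integral>_B f. The Vitali lemma
  selects disjoint ones whose fivefold enlargements still cover; then l M(5B) \<le> D l M(B) \<le> D
  \<integral>_B f, and the integrals over disjoint balls add up to at most the integral of f. The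
  covering lemma needs bounded radii, so the argument runs with radii at most n and passes to the
  limit.\<close>

lemma weak_type:
  assumes [measurable]: "f \<in> borel_measurable borel" and l: "0 < l"
  shows "ennreal l * emeasure M {x. ennreal l < maximal M f x} \<le> ennreal D * (\<integral>\<^sup>+x. f x \<partial>M)"
proof -
  define I where "I = (\<lambda>B. \<integral>\<^sup>+y. f y * indicator B y \<partial>M)"
  define K where "K = (\<lambda>n::nat. {(c, r). 0 < r \<and> r \<le> real n \<and> ennreal l * emeasure M (ball c r) < I (ball c r)})"
  define E where "E = (\<lambda>n. \<Union>(c, r)\<in>K n. ball c r)"
  have E_open: "open (E n)" for n unfolding E_def by auto
  have E_sets [simp]: "E n \<in> sets borel" for n using E_open by auto
  have "K m \<subseteq> K n" if "m \<le> n" for m n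
    using that unfolding K_def by auto
  then have incE: "incseq E"
    unfolding incseq_def E_def by blast
  have E_eq: "{x. ennreal l < maximal M f x} = (\<Union>n. E n)"
  proof (intro equalityI subsetI)
    fix x assume "x \<in> {x. ennreal l < maximal M f x}"
    then obtain c r where B: "0 < r" "x \<in> ball c r" "ennreal l < I (ball c r) / emeasure M (ball c r)"
      unfolding maximal_def less_SUP_iff I_def by blast
    have "ennreal l * emeasure M (ball c r) < I (ball c r)"
    proof (rule ccontr)
      assume "\<not> ennreal l * emeasure M (ball c r) < I (ball c r)"
      then have "I (ball c r) / emeasure M (ball c r) \<le> ennreal l * emeasure M (ball c r) / emeasure M (ball c r)"
        by (intro divide_right_mono_ennreal) auto
      also have "\<dots> = ennreal l" using ball_pos[OF B(1), of c] ball_finite[of c r]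
        by (simp add: ennreal_mult_divide_eq)
      finally show False using B(3) by simp
    qed
    moreover obtain n :: nat where "r \<le> real n" using real_arch_simple by blast
    ultimately have "(c, r) \<in> K n" using B(1) by (simp add: K_def)
    then show "x \<in> (\<Union>n. E n)" using B(2) unfolding E_def by blast
  next
    fix x assume "x \<in> (\<Union>n. E n)"
    then obtain c r where B: "0 < r" "x \<in> ball c r" "ennreal l * emeasure M (ball c r) < I (ball c r)"
      unfolding E_def K_def by auto
    have "ennreal l < I (ball c r) / emeasure M (ball c r)"
    proof (rule ccontr)
      assume "\<not> ennreal l < I (ball c r) / emeasure M (ball c r)"
      then have "I (ball c r) / emeasure M (ball c r) * emeasure M (ball c r) \<le> ennreal l * emeasure M (ball c r)"
        by (intro mult_right_mono) auto
      moreover have "I (ball c r) / emeasure M (ball c r) * emeasure M (ball c r) = I (ball c r)"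
        using ball_pos[OF B(1), of c] ball_finite[of c r] by (simp add: ennreal_divide_times mult_divide_eq_ennreal)
      ultimately show False using B(3) by simp
    qed
    then show "x \<in> {x. ennreal l < maximal M f x}"
      using maximal_upper[OF B(1,2), where f = f and M = M] unfolding I_def by (auto intro: less_le_trans)
  qed
  have En: "ennreal l * emeasure M (E n) \<le> ennreal D * (\<integral>\<^sup>+x. f x \<partial>M)" for n
  proof -
    have cov: "E n \<subseteq> (\<Union>i\<in>K n. ball (fst i) (snd i))" unfolding E_def by auto
    obtain C where C: "countable C" "C \<subseteq> K n"
      and disj: "pairwise (\<lambda>i j. disjnt (ball (fst i) (snd i)) (ball (fst j) (snd j))) C"
      and cover: "E n \<subseteq> (\<Union>i\<in>C. ball (fst i) (5 * snd i))"
    proof -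
      have r: "0 < snd i \<and> snd i \<le> real n" if "i \<in> K n" for i using that by (auto simp: K_def)
      show ?thesis
        apply (rule Vitali_covering_lemma_balls[OF cov r], assumption)
        apply (rule that)
           apply assumption+
        done
    qed
    \<comment> \<open>The selected balls are indexed by natural numbers, with empty sets as padding,
      so that they form a disjoint sequence.\<close>
    define T where "T = to_nat_on C ` C"
    define B where "B = (\<lambda>k. if k \<in> T then ball (fst (from_nat_into C k)) (snd (from_nat_into C k)) else {})"
    define B5 where "B5 = (\<lambda>k. if k \<in> T then ball (fst (from_nat_into C k)) (5 * snd (from_nat_into C k)) else {})"
    have TC: "from_nat_into C k \<in> C" "to_nat_on C (from_nat_into C k) = k" if "k \<in> T" for k
      using that C(1) unfolding T_def by auto
    have [measurable]: "B k \<in> sets M" "B5 k \<in> sets M" for k by (auto simp: B_def B5_def)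
    have B5_sets: "B5 k \<in> sets borel" and B_sets [simp]: "B k \<in> sets borel" for k by (auto simp: B5_def B_def)
    have dB: "disjoint_family B"
      unfolding disjoint_family_on_def
    proof (intro ballI impI)
      fix i j :: nat assume "i \<noteq> j"
      show "B i \<inter> B j = {}"
      proof (cases "i \<in> T \<and> j \<in> T")
        case True
        then have "from_nat_into C i \<noteq> from_nat_into C j" using \<open>i \<noteq> j\<close> TC(2) by metis
        with True TC(1) have "disjnt (B i) (B j)"
          using disj unfolding pairwise_def B_def by auto
        then show ?thesis by (simp add: disjnt_def)
      qed (auto simp: B_def)
    qed
    have cov5: "E n \<subseteq> (\<Union>k. B5 k)"
    proof
      fix x assume "x \<in> E n"
      then obtain i where i: "i \<in> C" "x \<in> ball (fst i) (5 * snd i)" using cover by auto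
      have "to_nat_on C i \<in> T" using i by (simp add: T_def)
      then have "x \<in> B5 (to_nat_on C i)" using i C(1) by (simp add: B5_def)
      then show "x \<in> (\<Union>k. B5 k)" by blast
    qed
    have step: "ennreal l * emeasure M (B5 k) \<le> ennreal D * I (B k)" for k
    proof (cases "k \<in> T")
      case True
      then obtain c r where cr: "from_nat_into C k = (c, r)" "(c, r) \<in> K n" using TC(1) C(2) by (metis subsetD surj_pair)
      have "ennreal l * emeasure M (B5 k) \<le> ennreal l * (ennreal D * emeasure M (B k))"
        using True cr doubling[of r c] by (intro mult_left_mono) (auto simp: B5_def B_def K_def)
      also have "\<dots> = ennreal D * (ennreal l * emeasure M (B k))" by (simp only: mult_ac)
      also have "\<dots> \<le> ennreal D * I (B k)"
        using True cr by (intro mult_left_mono) (auto simp: B_def K_def)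
      finally show ?thesis .
    qed (simp add: B5_def)
    have "ennreal l * emeasure M (E n) \<le> ennreal l * (\<Sum>k. emeasure M (B5 k))"
    proof (intro mult_left_mono)
      have "emeasure M (E n) \<le> emeasure M (\<Union>k. B5 k)" using B5_sets by (intro emeasure_mono cov5) auto
      also have "\<dots> \<le> (\<Sum>k. emeasure M (B5 k))" using B5_sets by (intro emeasure_subadditive_countably) auto
      finally show "emeasure M (E n) \<le> (\<Sum>k. emeasure M (B5 k))" .
    qed simp
    also have "\<dots> = (\<Sum>k. ennreal l * emeasure M (B5 k))" by simp
    also have "\<dots> \<le> (\<Sum>k. ennreal D * I (B k))" by (intro suminf_le step summableI)
    also have "\<dots> = ennreal D * (\<Sum>k. I (B k))" by simp
    also have "(\<Sum>k. I (B k)) = (\<Sum>k. emeasure (density M f) (B k))"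
      unfolding I_def by (subst emeasure_density) auto
    also have "\<dots> = emeasure (density M f) (\<Union>k. B k)"
      by (intro suminf_emeasure dB) auto
    also have "\<dots> \<le> emeasure (density M f) (space M)" by (intro emeasure_mono) auto
    also have "\<dots> = (\<integral>\<^sup>+x. f x \<partial>M)" by (subst emeasure_density) (auto intro!: nn_integral_cong)
    finally show ?thesis by (simp add: mult_left_mono)
  qed
  have "ennreal l * emeasure M (\<Union>n. E n) = (SUP n. ennreal l * emeasure M (E n))"
    by (subst SUP_emeasure_incseq[OF _ incE, symmetric]) (auto simp: SUP_mult_left_ennreal)
  also have "\<dots> \<le> ennreal D * (\<integral>\<^sup>+x. f x \<partial>M)" by (intro SUP_least En)
  finally show ?thesis unfolding E_eq .
qed

lemma maximal_truncate:
  assumes [measurable]: "f \<in> borel_measurable borel"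
  shows "maximal M f x \<le> maximal M (\<lambda>y. if a < f y then f y else 0) x + a"
proof (rule maximal_least)
  fix c r assume B: "0 < r" "x \<in> ball c r"
  have [measurable]: "ball c r \<in> sets M" by simp
  let ?g = "\<lambda>y. if a < f y then f y else 0"
  have "(\<integral>\<^sup>+ y. f y * indicator (ball c r) y \<partial>M) \<le> (\<integral>\<^sup>+ y. ?g y * indicator (ball c r) y + a * indicator (ball c r) y \<partial>M)"
    by (intro nn_integral_mono) (auto simp: indicator_def)
  also have "\<dots> = (\<integral>\<^sup>+ y. ?g y * indicator (ball c r) y \<partial>M) + a * emeasure M (ball c r)"
    by (subst nn_integral_add) (auto simp: nn_integral_cmult_indicator)
  finally have "(\<integral>\<^sup>+ y. f y * indicator (ball c r) y \<partial>M) / emeasure M (ball c r)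
    \<le> ((\<integral>\<^sup>+ y. ?g y * indicator (ball c r) y \<partial>M) + a * emeasure M (ball c r)) / emeasure M (ball c r)"
    by (rule divide_right_mono_ennreal)
  also have "\<dots> = (\<integral>\<^sup>+ y. ?g y * indicator (ball c r) y \<partial>M) / emeasure M (ball c r) + a"
    using ball_pos[OF B(1), of c] ball_finite[of c r]
    by (simp add: add_divide_distrib_ennreal ennreal_mult_divide_eq)
  also have "\<dots> \<le> maximal M ?g x + a"
    by (intro add_right_mono maximal_upper B)
  finally show "(\<integral>\<^sup>+ y. f y * indicator (ball c r) y \<partial>M) / emeasure M (ball c r) \<le> maximal M ?g x + a" .
qed

text \<open>The part of f below l/2 contributes at most l/2 to the maximal function, so only the
  part above it is charged. The condition is written as l < 2 f to match the layer-cake formula for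
  2 f.\<close>

lemma weak_type_truncated:
  assumes [measurable]: "f \<in> borel_measurable borel" and l: "0 < l"
  shows "ennreal l * emeasure M {x. ennreal l < maximal M f x}
    \<le> ennreal (2 * D) * (\<integral>\<^sup>+x. f x * (if ennreal l < 2 * f x then 1 else 0) \<partial>M)"
proof -
  let ?g = "\<lambda>y. if ennreal (l / 2) < f y then f y else 0"
  have lt: "ennreal (l / 2) < X \<longleftrightarrow> ennreal l < 2 * X" for X
    using l by (cases X) (auto simp: ennreal_mult_top ennreal_less_iff simp flip: ennreal_numeral ennreal_mult')
  have "{x. ennreal l < maximal M f x} \<subseteq> {x. ennreal (l / 2) < maximal M ?g x}"
  proof safe
    fix x assume *: "ennreal l < maximal M f x"
    show "ennreal (l / 2) < maximal M ?g x"
    proof (rule ccontr)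
      assume "\<not> ennreal (l / 2) < maximal M ?g x"
      then have "maximal M ?g x + ennreal (l / 2) \<le> ennreal (l / 2) + ennreal (l / 2)" by (intro add_right_mono) auto
      also have "\<dots> = ennreal l" using l by (simp flip: ennreal_plus)
      finally show False using * maximal_truncate[of f x "ennreal (l / 2)"] by auto
    qed
  qed
  then have "ennreal l * emeasure M {x. ennreal l < maximal M f x} \<le> ennreal l * emeasure M {x. ennreal (l / 2) < maximal M ?g x}"
    by (intro mult_left_mono emeasure_mono) (auto simp: borel_open open_maximal_greater)
  also have "ennreal l * emeasure M {x. ennreal (l / 2) < maximal M ?g x}
     = 2 * (ennreal (l / 2) * emeasure M {x. ennreal (l / 2) < maximal M ?g x})"
  proof -
    have "ennreal l = 2 * ennreal (l / 2)" using l by (simp flip: ennreal_numeral ennreal_mult')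
    then show ?thesis by (simp only: mult.assoc)
  qed
  also have "\<dots> \<le> 2 * (ennreal D * (\<integral>\<^sup>+x. ?g x \<partial>M))"
    using l by (intro mult_left_mono weak_type) auto
  also have "\<dots> = ennreal (2 * D) * (\<integral>\<^sup>+x. ?g x \<partial>M)"
    by (simp add: ennreal_mult' mult.assoc)
  also have "(\<integral>\<^sup>+x. ?g x \<partial>M) = (\<integral>\<^sup>+x. f x * (if ennreal l < 2 * f x then 1 else 0) \<partial>M)"
    by (intro nn_integral_cong) (auto simp: lt)
  finally show ?thesis .
qed

text \<open>Marcinkiewicz interpolation between the weak bound and the trivial bound for bounded
  functions: layer cake for the maximal function, the truncated weak bound, Fubini, and layer cake
  read backwards for (2 f)^(s-1). The factor s/(s-1) comes from trading s l^(s-2) for (s-1) l^(s-2),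
  which is integrable at 0 because s > 1.\<close>

lemma strong_type:
  assumes [measurable]: "f \<in> borel_measurable borel" and s: "1 < s"
  shows "(\<integral>\<^sup>+x. enn_powr (maximal M f x) s \<partial>M)
    \<le> ennreal (2 * D * (s / (s - 1)) * 2 powr (s - 1)) * (\<integral>\<^sup>+x. enn_powr (f x) s \<partial>M)"
proof -
  interpret P: pair_sigma_finite M lborel ..
  let ?k = "\<lambda>X l. ennreal (s * l powr (s - 1)) * (indicator {0<..} l * (if ennreal l < X then 1 else 0))"
  let ?k' = "\<lambda>X l. ennreal ((s - 1) * l powr (s - 1 - 1)) * (indicator {0<..} l * (if ennreal l < X then 1 else 0))"
  have "(\<integral>\<^sup>+x. enn_powr (maximal M f x) s \<partial>M) = (\<integral>\<^sup>+x. (\<integral>\<^sup>+l. ?k (maximal M f x) l \<partial>lborel) \<partial>M)"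
    using s by (subst enn_powr_eq_integral) auto
  also have "\<dots> = (\<integral>\<^sup>+l. (\<integral>\<^sup>+x. ?k (maximal M f x) l \<partial>M) \<partial>lborel)"
    by (rule P.Fubini'[symmetric]) measurable
  also have "\<dots> \<le> (\<integral>\<^sup>+l. (\<integral>\<^sup>+x. ennreal (2 * D * (s / (s - 1))) * (f x * ?k' (2 * f x) l) \<partial>M) \<partial>lborel)"
  proof (rule nn_integral_mono)
    fix l :: real
    show "(\<integral>\<^sup>+x. ?k (maximal M f x) l \<partial>M) \<le> (\<integral>\<^sup>+x. ennreal (2 * D * (s / (s - 1))) * (f x * ?k' (2 * f x) l) \<partial>M)"
    proof (cases "0 < l")
      case True
      have "(\<integral>\<^sup>+x. ?k (maximal M f x) l \<partial>M) = (\<integral>\<^sup>+x. ennreal (s * l powr (s - 1)) * indicator {x. ennreal l < maximal M f x} x \<partial>M)"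
        using True by (intro nn_integral_cong) (auto simp: indicator_def)
      also have "\<dots> = ennreal (s * l powr (s - 1)) * emeasure M {x. ennreal l < maximal M f x}"
        by (rule nn_integral_cmult_indicator) (auto simp: borel_open open_maximal_greater)
      also have "\<dots> = ennreal (s * l powr (s - 1 - 1)) * (ennreal l * emeasure M {x. ennreal l < maximal M f x})"
      proof -
        have "s * l powr (s - 1) = s * l powr (s - 1 - 1) * l" using True powr_add[of l "s - 1 - 1" 1] by simp
        then have "ennreal (s * l powr (s - 1)) = ennreal (s * l powr (s - 1 - 1)) * ennreal l"
          using True s by (simp only: ennreal_mult'')
        then show ?thesis by (simp only: mult.assoc)
      qed
      also have "\<dots> \<le> ennreal (s * l powr (s - 1 - 1)) * (ennreal (2 * D) * (\<integral>\<^sup>+x. f x * (if ennreal l < 2 * f x then 1 else 0) \<partial>M))"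
        by (intro mult_left_mono weak_type_truncated True) auto
      also have "\<dots> = ennreal (2 * D * (s / (s - 1))) * ennreal ((s - 1) * l powr (s - 1 - 1)) * (\<integral>\<^sup>+x. f x * (if ennreal l < 2 * f x then 1 else 0) \<partial>M)"
      proof -
        have "ennreal (s * l powr (s - 1 - 1)) * ennreal (2 * D) = ennreal (s * l powr (s - 1 - 1) * (2 * D))"
          using s by (intro ennreal_mult'[symmetric]) auto
        also have "s * l powr (s - 1 - 1) * (2 * D) = 2 * D * (s / (s - 1)) * ((s - 1) * l powr (s - 1 - 1))" using s by (simp add: field_simps)
        also have "ennreal \<dots> = ennreal (2 * D * (s / (s - 1))) * ennreal ((s - 1) * l powr (s - 1 - 1))"
          using s by (intro ennreal_mult'') auto
        finally show ?thesis by (simp only: mult.assoc[symmetric])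
      qed
      also have "\<dots> = (\<integral>\<^sup>+x. ennreal (2 * D * (s / (s - 1))) * (f x * ?k' (2 * f x) l) \<partial>M)"
        using True by (subst nn_integral_cmult[symmetric]) (auto intro!: nn_integral_cong simp: mult_ac)
      finally show ?thesis .
    qed auto
  qed
  also have "\<dots> = (\<integral>\<^sup>+x. (\<integral>\<^sup>+l. ennreal (2 * D * (s / (s - 1))) * (f x * ?k' (2 * f x) l) \<partial>lborel) \<partial>M)"
    by (rule P.Fubini') measurable
  also have "\<dots> = (\<integral>\<^sup>+x. ennreal (2 * D * (s / (s - 1))) * (f x * (\<integral>\<^sup>+l. ?k' (2 * f x) l \<partial>lborel)) \<partial>M)"
    by (intro nn_integral_cong) (simp add: nn_integral_cmult)
  also have "\<dots> = (\<integral>\<^sup>+x. ennreal (2 * D * (s / (s - 1))) * (ennreal (2 powr (s - 1)) * enn_powr (f x) s) \<partial>M)"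
  proof (rule nn_integral_cong)
    fix x
    have "(\<integral>\<^sup>+l. ?k' (2 * f x) l \<partial>lborel) = enn_powr (2 * f x) (s - 1)"
      using s by (intro enn_powr_eq_integral[symmetric]) simp
    also have "\<dots> = ennreal (2 powr (s - 1)) * enn_powr (f x) (s - 1)"
      unfolding enn_powr_mult using enn_powr_ennreal[of 2 "s - 1"] by simp
    finally have "f x * (\<integral>\<^sup>+l. ?k' (2 * f x) l \<partial>lborel) = ennreal (2 powr (s - 1)) * (enn_powr (f x) 1 * enn_powr (f x) (s - 1))"
      by (simp add: mult_ac)
    then show "ennreal (2 * D * (s / (s - 1))) * (f x * (\<integral>\<^sup>+l. ?k' (2 * f x) l \<partial>lborel))
      = ennreal (2 * D * (s / (s - 1))) * (ennreal (2 powr (s - 1)) * enn_powr (f x) s)"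
      by (simp only: enn_powr_add[symmetric] add_diff_cancel_left' diff_add_cancel) simp
  qed
  also have "\<dots> = ennreal (2 * D * (s / (s - 1)) * 2 powr (s - 1)) * (\<integral>\<^sup>+x. enn_powr (f x) s \<partial>M)"
  proof -
    have e: "ennreal (2 * D * (s / (s - 1)) * 2 powr (s - 1)) = ennreal (2 * D * (s / (s - 1))) * ennreal (2 powr (s - 1))"
      by (rule ennreal_mult'') simp
    show ?thesis unfolding e by (subst nn_integral_cmult, measurable)+ (simp only: mult.assoc)
  qed
  finally show ?thesis .
qed

end

subsection \<open>Muckenhoupt weights\<close>

lemma weighted_am_gm:
  fixes y \<theta> :: "'i \<Rightarrow> real"
  assumes I: "finite I" "sum \<theta> I = 1" and \<theta>: "\<And>i. i \<in> I \<Longrightarrow> 0 < \<theta> i" and y: "\<And>i. i \<in> I \<Longrightarrow> 0 \<le> y i"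
  shows "(\<Prod>i\<in>I. y i powr \<theta> i) \<le> (\<Sum>i\<in>I. \<theta> i * y i)"
proof (cases "\<exists>i\<in>I. y i = 0")
  case True
  then have "(\<Prod>i\<in>I. y i powr \<theta> i) = 0" using I(1) by (auto simp: prod_zero_iff)
  then show ?thesis using \<theta>[THEN less_imp_le] y by (auto intro!: sum_nonneg)
next
  case False
  then have y: "\<And>i. i \<in> I \<Longrightarrow> 0 < y i" using y by force
  have ne: "I \<noteq> {}" using I(2) by auto
  have "(\<Prod>i\<in>I. y i powr \<theta> i) = (\<Prod>i\<in>I. exp (\<theta> i * ln (y i)))"
    by (intro prod.cong refl) (use y in \<open>force simp: powr_def\<close>)
  also have "\<dots> = exp (\<Sum>i\<in>I. \<theta> i *\<^sub>R ln (y i))" using I(1) by (simp add: exp_sum)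
  also have "\<dots> \<le> (\<Sum>i\<in>I. \<theta> i * exp (ln (y i)))"
    using I ne \<theta> by (intro convex_on_sum[OF _ _ exp_convex]) (auto intro: less_imp_le)
  also have "\<dots> = (\<Sum>i\<in>I. \<theta> i * y i)" using y by (intro sum.cong) auto
  finally show ?thesis .
qed

lemma prod_ennreal_top:
  fixes f :: "'i \<Rightarrow> ennreal"
  assumes "finite I" "i \<in> I" "f i = \<top>" "\<And>j. j \<in> I \<Longrightarrow> f j \<noteq> 0"
  shows "(\<Prod>j\<in>I. f j) = \<top>"
proof -
  have "(\<Prod>j\<in>I - {i}. f j) \<noteq> 0" using assms by (simp add: prod_zero_iff)
  then show ?thesis using assms by (subst prod.remove[of I i]) (auto simp: ennreal_top_mult)
qed

text \<open>Once every f_i is normalised to integral 1, weighted AM-GM holds pointwise and is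
  integrated. Degenerate integrals are treated apart: a vanishing one is considered before an
  infinite one because 0 times \<infinity> is 0.\<close>

lemma nn_integral_prod_powr_le:
  fixes f :: "'i \<Rightarrow> 'b \<Rightarrow> ennreal" and \<theta> :: "'i \<Rightarrow> real"
  assumes I: "finite I" "sum \<theta> I = 1" and \<theta>: "\<And>i. i \<in> I \<Longrightarrow> 0 < \<theta> i"
    and [measurable]: "\<And>i. i \<in> I \<Longrightarrow> f i \<in> borel_measurable M"
  shows "(\<integral>\<^sup>+x. (\<Prod>i\<in>I. enn_powr (f i x) (\<theta> i)) \<partial>M) \<le> (\<Prod>i\<in>I. enn_powr (\<integral>\<^sup>+x. f i x \<partial>M) (\<theta> i))"
proof -
  let ?F = "\<lambda>i. \<integral>\<^sup>+x. f i x \<partial>M"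
  have pow0: "enn_powr X e = 0 \<longleftrightarrow> X = 0" if "0 < e" for X e
    using that by (cases X) (auto simp: enn_powr_ennreal)
  consider (zero) i where "i \<in> I" "?F i = 0"
    | (top) i where "i \<in> I" "?F i = \<top>" "\<And>j. j \<in> I \<Longrightarrow> ?F j \<noteq> 0"
    | (real) "\<And>j. j \<in> I \<Longrightarrow> ?F j \<noteq> 0 \<and> ?F j \<noteq> \<top>"
    by blast
  then show ?thesis
  proof cases
    case zero
    then have "AE x in M. f i x = 0" by (subst (asm) nn_integral_0_iff_AE) auto
    then have "AE x in M. (\<Prod>i\<in>I. enn_powr (f i x) (\<theta> i)) = 0"
      by eventually_elim (use zero I(1) in \<open>auto intro!: prod_zero bexI[of _ i]\<close>)
    then have "(\<integral>\<^sup>+x. (\<Prod>i\<in>I. enn_powr (f i x) (\<theta> i)) \<partial>M) = 0" by (subst nn_integral_0_iff_AE) auto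
    then show ?thesis by simp
  next
    case top
    have "(\<Prod>i\<in>I. enn_powr (?F i) (\<theta> i)) = \<top>"
      by (rule prod_ennreal_top[OF I(1) top(1)]) (use top pow0 \<theta> in auto)
    then show ?thesis by simp
  next
    case real
    define c where "c = (\<lambda>i. enn2real (?F i))"
    have c: "0 < c i" "?F i = ennreal (c i)" if "i \<in> I" for i
    proof -
      show "?F i = ennreal (c i)" using real[OF that] by (simp add: c_def less_top)
      then show "0 < c i" using real[OF that] by (metis ennreal_eq_0_iff not_less)
    qed
    define P where "P = (\<Prod>i\<in>I. c i powr \<theta> i)"
    have P: "0 < P" unfolding P_def using c by (intro prod_pos) force
    have "(\<integral>\<^sup>+x. (\<Prod>i\<in>I. enn_powr (f i x) (\<theta> i)) \<partial>M) \<le> (\<integral>\<^sup>+x. (\<Sum>i\<in>I. ennreal (P * \<theta> i / c i) * f i x) \<partial>M)"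
    proof (rule nn_integral_mono)
      fix x
      show "(\<Prod>i\<in>I. enn_powr (f i x) (\<theta> i)) \<le> (\<Sum>i\<in>I. ennreal (P * \<theta> i / c i) * f i x)"
      proof (cases "\<exists>i\<in>I. f i x = \<top>")
        case True
        then obtain i where i: "i \<in> I" "f i x = \<top>" by blast
        have "0 < P * \<theta> i / c i" using P \<theta>[OF i(1)] c(1)[OF i(1)] by simp
        then have "ennreal (P * \<theta> i / c i) \<noteq> 0" by (simp only: ennreal_eq_0_iff not_le)
        then have "ennreal (P * \<theta> i / c i) * f i x = \<top>" unfolding i(2) ennreal_mult_eq_top_iff by blast
        moreover have "ennreal (P * \<theta> i / c i) * f i x \<le> (\<Sum>i\<in>I. ennreal (P * \<theta> i / c i) * f i x)"
          using i I(1) by (intro member_le_sum) auto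
        ultimately show ?thesis by (simp add: top_unique)
      next
        case False
        define y where "y = (\<lambda>i. enn2real (f i x))"
        have y: "f i x = ennreal (y i)" "0 \<le> y i" if "i \<in> I" for i
          using False that by (auto simp: y_def less_top)
        have "(\<Prod>i\<in>I. enn_powr (f i x) (\<theta> i)) = ennreal (\<Prod>i\<in>I. y i powr \<theta> i)"
          using y by (subst prod_ennreal[symmetric]) (auto intro!: prod.cong simp: enn_powr_ennreal)
        also have "(\<Prod>i\<in>I. y i powr \<theta> i) = P * (\<Prod>i\<in>I. (y i / c i) powr \<theta> i)"
          unfolding P_def prod.distrib[symmetric] using c y
          by (intro prod.cong) (auto simp: powr_mult[symmetric] dest!: c(1))
        also have "\<dots> \<le> P * (\<Sum>i\<in>I. \<theta> i * (y i / c i))"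
          using P c y by (intro mult_left_mono weighted_am_gm I \<theta>) (auto intro!: divide_nonneg_nonneg intro: less_imp_le)
        also have "\<dots> = (\<Sum>i\<in>I. P * \<theta> i / c i * y i)" by (simp add: sum_distrib_left mult_ac)
        also have "ennreal \<dots> = (\<Sum>i\<in>I. ennreal (P * \<theta> i / c i * y i))"
          using P \<theta> c y by (intro sum_ennreal[symmetric] mult_nonneg_nonneg divide_nonneg_nonneg) (auto intro: less_imp_le)
        also have "\<dots> = (\<Sum>i\<in>I. ennreal (P * \<theta> i / c i) * f i x)"
        proof (rule sum.cong[OF refl])
          fix i assume i: "i \<in> I"
          show "ennreal (P * \<theta> i / c i * y i) = ennreal (P * \<theta> i / c i) * f i x"
            unfolding y(1)[OF i] by (rule ennreal_mult''[OF y(2)[OF i]])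
        qed
        finally show ?thesis by (simp add: ennreal_leI)
      qed
    qed
    also have "\<dots> = (\<Sum>i\<in>I. ennreal (P * \<theta> i / c i) * ?F i)"
      by (subst nn_integral_sum) (auto intro!: sum.cong nn_integral_cmult)
    also have "\<dots> = (\<Sum>i\<in>I. ennreal (P * \<theta> i))"
    proof (rule sum.cong)
      fix i assume i: "i \<in> I"
      have "ennreal (P * \<theta> i / c i) * ?F i = ennreal (P * \<theta> i / c i * c i)"
        unfolding c(2)[OF i] using c(1)[OF i] by (intro ennreal_mult''[symmetric]) simp
      then show "ennreal (P * \<theta> i / c i) * ?F i = ennreal (P * \<theta> i)" using c(1)[OF i] by simp
    qed simp
    also have "\<dots> = ennreal (\<Sum>i\<in>I. P * \<theta> i)" using P \<theta> by (intro sum_ennreal) (auto intro: less_imp_le)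
    also have "(\<Sum>i\<in>I. P * \<theta> i) = P" using I(2) by (simp add: sum_distrib_left[symmetric])
    also have "ennreal P = (\<Prod>i\<in>I. ennreal (c i powr \<theta> i))" unfolding P_def by (intro prod_ennreal[symmetric]) simp
    also have "\<dots> = (\<Prod>i\<in>I. enn_powr (?F i) (\<theta> i))"
      using c by (intro prod.cong) (auto simp: enn_powr_ennreal less_imp_le)
    finally show ?thesis .
  qed
qed

lemma nn_integral_ball_pos:
  fixes w :: "'a::euclidean_space \<Rightarrow> real"
  assumes [measurable]: "w \<in> borel_measurable borel" and w: "\<And>x. 0 < w x" and r: "0 < r"
  shows "0 < (\<integral>\<^sup>+y. ennreal (w y) * indicator (ball c r) y \<partial>lborel)"
proof (rule ccontr)
  have [measurable]: "ball c r \<in> sets borel" by simp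
  assume "\<not> 0 < (\<integral>\<^sup>+y. ennreal (w y) * indicator (ball c r) y \<partial>lborel)"
  then have "AE y in lborel. ennreal (w y) * indicator (ball c r) y = 0"
    by (subst (asm) not_gr_zero, subst (asm) nn_integral_0_iff_AE) auto
  then have "AE y in lborel. y \<notin> ball c r"
    by eventually_elim (use w in \<open>auto simp: indicator_def less_le split: if_splits\<close>)
  then have "ball c r \<in> null_sets lborel" by (subst (asm) AE_iff_null_sets[symmetric]) auto
  moreover have "unit_ball_vol (real DIM('a)) > 0" by simp
  then have "unit_ball_vol (real DIM('a)) \<noteq> 0" by linarith
  ultimately show False using r by (simp add: null_sets_def emeasure_ball)
qed

text \<open>The Muckenhoupt condition with denominators cleared, for a Borel weight that is positive
  everywhere. Positivity allows division by the weight; a general weight is reduced to this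
  situation in \<open>muckenhoupt_cases\<close>.\<close>

locale Ap_weight =
  fixes w :: "'a::euclidean_space \<Rightarrow> real" and s A :: real
  assumes s: "1 < s" and w_meas [measurable]: "w \<in> borel_measurable borel" and w_pos: "\<And>x. 0 < w x"
    and Ap: "\<And>c r. 0 < r \<Longrightarrow> (\<integral>\<^sup>+y. ennreal (w y) * indicator (ball c r) y \<partial>lborel)
       * enn_powr (\<integral>\<^sup>+y. ennreal (w y powr (- 1 / (s - 1))) * indicator (ball c r) y \<partial>lborel) (s - 1)
       \<le> ennreal A * enn_powr (emeasure lborel (ball c r)) s"
begin

text \<open>The dual weight, for which \<sigma>^(1-s) = w.\<close>

definition \<sigma> :: "'a \<Rightarrow> real" where "\<sigma> y = w y powr (- 1 / (s - 1))"

lemma \<sigma>_meas [measurable]: "\<sigma> \<in> borel_measurable borel" unfolding \<sigma>_def[abs_def] by measurable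

lemma \<sigma>_pos: "0 < \<sigma> y" using w_pos[of y] by (simp add: \<sigma>_def)

definition \<mu>w :: "'a measure" where "\<mu>w = density lborel (\<lambda>y. ennreal (w y))"
definition \<mu>s :: "'a measure" where "\<mu>s = density lborel (\<lambda>y. ennreal (\<sigma> y))"

lemma nn_integral_\<mu>w: "f \<in> borel_measurable borel \<Longrightarrow> (\<integral>\<^sup>+x. f x \<partial>\<mu>w) = (\<integral>\<^sup>+x. ennreal (w x) * f x \<partial>lborel)"
  unfolding \<mu>w_def by (subst nn_integral_density) auto

lemma nn_integral_\<mu>s: "f \<in> borel_measurable borel \<Longrightarrow> (\<integral>\<^sup>+x. f x \<partial>\<mu>s) = (\<integral>\<^sup>+x. ennreal (\<sigma> x) * f x \<partial>lborel)"
  unfolding \<mu>s_def by (subst nn_integral_density) auto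

lemma emeasure_\<mu>w: "emeasure \<mu>w (ball c r) = (\<integral>\<^sup>+y. ennreal (w y) * indicator (ball c r) y \<partial>lborel)"
  unfolding \<mu>w_def by (rule emeasure_density) auto

lemma emeasure_\<mu>s: "emeasure \<mu>s (ball c r) = (\<integral>\<^sup>+y. ennreal (\<sigma> y) * indicator (ball c r) y \<partial>lborel)"
  unfolding \<mu>s_def by (rule emeasure_density) auto

lemma Ap': "0 < r \<Longrightarrow> emeasure \<mu>w (ball c r) * enn_powr (emeasure \<mu>s (ball c r)) (s - 1) \<le> ennreal A * enn_powr (emeasure lborel (ball c r)) s"
  unfolding emeasure_\<mu>w emeasure_\<mu>s \<sigma>_def by (rule Ap)

lemma \<mu>w_pos: "0 < r \<Longrightarrow> 0 < emeasure \<mu>w (ball c r)"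
  unfolding emeasure_\<mu>w by (intro nn_integral_ball_pos w_pos) auto

lemma \<mu>s_pos: "0 < r \<Longrightarrow> 0 < emeasure \<mu>s (ball c r)"
  unfolding emeasure_\<mu>s by (intro nn_integral_ball_pos \<sigma>_pos) auto

text \<open>Local integrability of w and \<sigma> is forced by the condition: both factors on its
  left are nonzero and their product is finite.\<close>

lemma finite_balls: "emeasure \<mu>w (ball c r) < \<infinity>" "emeasure \<mu>s (ball c r) < \<infinity>"
proof -
  have "emeasure \<mu>w (ball c r) < \<infinity> \<and> emeasure \<mu>s (ball c r) < \<infinity>"
  proof (cases "0 < r")
    case True
    have "enn_powr (emeasure lborel (ball c r)) s < \<infinity>"
      using True by (simp add: emeasure_ball enn_powr_ennreal)
    then have "ennreal A * enn_powr (emeasure lborel (ball c r)) s < \<top>"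
      by (simp add: ennreal_mult_less_top)
    then have *: "emeasure \<mu>w (ball c r) * enn_powr (emeasure \<mu>s (ball c r)) (s - 1) \<noteq> \<top>"
      using le_less_trans[OF Ap'[OF True, of c]] by (simp only: less_top)
    have "enn_powr (emeasure \<mu>s (ball c r)) (s - 1) \<noteq> 0"
      using \<mu>s_pos[OF True, of c] by (cases "emeasure \<mu>s (ball c r)") (auto simp: enn_powr_ennreal)
    then have "emeasure \<mu>w (ball c r) \<noteq> \<top>" "enn_powr (emeasure \<mu>s (ball c r)) (s - 1) \<noteq> \<top>"
      using * \<mu>w_pos[OF True, of c] by (auto simp: ennreal_mult_eq_top_iff)
    then show ?thesis by (cases "emeasure \<mu>s (ball c r) = \<top>") (auto simp: less_top)
  qed (simp add: ball_empty)
  then show "emeasure \<mu>w (ball c r) < \<infinity>" "emeasure \<mu>s (ball c r) < \<infinity>" by auto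
qed

text \<open>Hoelder's inequality for 1 = w^(1/s) \<sigma>^((s-1)/s). Together with
  \<open>Ap'\<close> it makes w(B) \<sigma>(B)^(s-1) comparable to |B|^s.\<close>

lemma holder_ball:
  assumes r: "0 < r"
  shows "enn_powr (emeasure lborel (ball c r)) s \<le> emeasure \<mu>w (ball c r) * enn_powr (emeasure \<mu>s (ball c r)) (s - 1)"
proof -
  \<comment> \<open>The type \<open>bool\<close> serves as the index set for the two
    factors.\<close>
  define f where "f = (\<lambda>(i::bool) y. ennreal (if i then w y else \<sigma> y) * indicator (ball c r) y)"
  define \<theta> where "\<theta> = (\<lambda>i::bool. if i then 1 / s else (s - 1) / s)"
  have [measurable]: "ball c r \<in> sets borel" by simp
  have "emeasure lborel (ball c r) = (\<integral>\<^sup>+y. indicator (ball c r) y \<partial>lborel)" by simp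
  also have "\<dots> = (\<integral>\<^sup>+y. (\<Prod>i\<in>UNIV. enn_powr (f i y) (\<theta> i)) \<partial>lborel)"
  proof (rule nn_integral_cong)
    fix y
    have "w y powr (1 / s) * \<sigma> y powr ((s - 1) / s) = 1"
      using s w_pos[of y] by (simp add: \<sigma>_def powr_powr powr_add[symmetric] field_simps)
    then show "indicator (ball c r) y = (\<Prod>i\<in>UNIV. enn_powr (f i y) (\<theta> i))"
      using w_pos[of y] \<sigma>_pos[of y]
      by (auto simp: f_def \<theta>_def UNIV_bool indicator_def enn_powr_ennreal less_imp_le ennreal_mult''[symmetric] mult.commute)
  qed
  also have "\<dots> \<le> (\<Prod>i\<in>UNIV. enn_powr (\<integral>\<^sup>+y. f i y \<partial>lborel) (\<theta> i))"
    using s by (intro nn_integral_prod_powr_le) (auto simp: \<theta>_def UNIV_bool f_def add_divide_distrib[symmetric])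
  also have "\<dots> = enn_powr (emeasure \<mu>w (ball c r)) (1 / s) * enn_powr (emeasure \<mu>s (ball c r)) ((s - 1) / s)"
    by (simp add: UNIV_bool \<theta>_def f_def emeasure_\<mu>w emeasure_\<mu>s mult.commute)
  finally have "enn_powr (emeasure lborel (ball c r)) s \<le>
    enn_powr (enn_powr (emeasure \<mu>w (ball c r)) (1 / s) * enn_powr (emeasure \<mu>s (ball c r)) ((s - 1) / s)) s"
    using s by (intro enn_powr_mono) auto
  also have "\<dots> = emeasure \<mu>w (ball c r) * enn_powr (emeasure \<mu>s (ball c r)) (s - 1)"
    using s by (simp add: enn_powr_mult enn_powr_powr)
  finally show ?thesis .
qed

end

lemma ennreal_mult_right_cancel_le:
  fixes X Y c :: ennreal
  assumes "X * c \<le> Y * c" "c \<noteq> 0" "c \<noteq> \<top>"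
  shows "X \<le> Y"
proof -
  have "X * c / c \<le> Y * c / c" by (intro divide_right_mono_ennreal assms)
  then show ?thesis using assms by (simp add: ennreal_mult_divide_eq)
qed

lemma enn_powr_neq_0: "X \<noteq> 0 \<Longrightarrow> enn_powr X e \<noteq> 0"
  by (cases X) (auto simp: enn_powr_ennreal)

lemma enn_powr_neq_top: "X \<noteq> \<top> \<Longrightarrow> enn_powr X e \<noteq> \<top>"
  by (cases X) (auto simp: enn_powr_ennreal)

lemma emeasure_ball_5:
  fixes c :: "'a::euclidean_space"
  assumes "0 < r"
  shows "emeasure lborel (ball c (5 * r)) = ennreal (5 ^ DIM('a)) * emeasure lborel (ball c r)"
  using assms by (simp add: emeasure_ball power_mult_distrib ennreal_mult'[symmetric] mult_ac)

lemma emeasure_ball_neq: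
  fixes c :: "'a::euclidean_space"
  assumes "0 < r"
  shows "emeasure lborel (ball c r) \<noteq> 0" "emeasure lborel (ball c r) \<noteq> \<top>"
proof -
  have "unit_ball_vol (real DIM('a)) > 0" by simp
  then have "unit_ball_vol (real DIM('a)) \<noteq> 0" by linarith
  then show "emeasure lborel (ball c r) \<noteq> 0" "emeasure lborel (ball c r) \<noteq> \<top>"
    using assms by (simp_all add: emeasure_ball)
qed

section \<open>Doubling of w and \<sigma>, and the weighted maximal theorem\<close>

context Ap_weight
begin

text \<open>The second factor is the growth of |B|^s under dilation by 5. The maximum is taken
  because A may be negative, in which case \<open>ennreal A\<close> is 0.\<close>

definition D5 :: real where "D5 = max A 0 * (5 ^ DIM('a)) powr s"

text \<open>The Muckenhoupt condition bounds the product from above on 5B, Hoelder bounds it from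
  below on B. Doubling of w follows by cancelling the \<sigma>-factor, which only grows from B to
  5B, and doubling of \<sigma> in the same way.\<close>

lemma D5_bound:
  assumes r: "0 < r"
  shows "emeasure \<mu>w (ball c (5 * r)) * enn_powr (emeasure \<mu>s (ball c (5 * r))) (s - 1)
    \<le> ennreal D5 * (emeasure \<mu>w (ball c r) * enn_powr (emeasure \<mu>s (ball c r)) (s - 1))"
proof -
  have "emeasure \<mu>w (ball c (5 * r)) * enn_powr (emeasure \<mu>s (ball c (5 * r))) (s - 1)
    \<le> ennreal A * enn_powr (emeasure lborel (ball c (5 * r))) s" using r by (intro Ap') simp
  also have "\<dots> = ennreal (max A 0) * (ennreal ((5 ^ DIM('a)) powr s) * enn_powr (emeasure lborel (ball c r)) s)"
    unfolding emeasure_ball_5[OF r] enn_powr_mult by (simp add: enn_powr_ennreal max_def ennreal_neg)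
  also have "\<dots> = ennreal D5 * enn_powr (emeasure lborel (ball c r)) s"
    unfolding D5_def by (simp add: ennreal_mult mult.assoc)
  also have "\<dots> \<le> ennreal D5 * (emeasure \<mu>w (ball c r) * enn_powr (emeasure \<mu>s (ball c r)) (s - 1))"
    by (intro mult_left_mono holder_ball r) simp
  finally show ?thesis .
qed

lemma ball_neq:
  assumes "0 < r"
  shows "emeasure \<mu>w (ball c r) \<noteq> 0" "emeasure \<mu>w (ball c r) \<noteq> \<top>"
    "emeasure \<mu>s (ball c r) \<noteq> 0" "emeasure \<mu>s (ball c r) \<noteq> \<top>"
  using \<mu>w_pos[OF assms, of c] \<mu>s_pos[OF assms, of c] finite_balls[of c r] by auto

lemma doubling_w: "doubling_measure \<mu>w D5"
proof
  show "sets \<mu>w = sets borel" by (simp add: \<mu>w_def)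
  fix c :: 'a and r :: real assume r: "0 < r"
  show "0 < emeasure \<mu>w (ball c r)" by (rule \<mu>w_pos[OF r])
  show "emeasure \<mu>w (ball c (5 * r)) \<le> ennreal D5 * emeasure \<mu>w (ball c r)"
  proof (rule ennreal_mult_right_cancel_le)
    let ?b = "enn_powr (emeasure \<mu>s (ball c r)) (s - 1)"
    have "emeasure \<mu>s (ball c r) \<le> emeasure \<mu>s (ball c (5 * r))"
      using r by (intro emeasure_mono) (auto simp: \<mu>s_def)
    then have "emeasure \<mu>w (ball c (5 * r)) * ?b \<le> emeasure \<mu>w (ball c (5 * r)) * enn_powr (emeasure \<mu>s (ball c (5 * r))) (s - 1)"
      using s by (intro mult_left_mono enn_powr_mono) auto
    also note D5_bound[OF r]
    finally show "emeasure \<mu>w (ball c (5 * r)) * ?b \<le> ennreal D5 * emeasure \<mu>w (ball c r) * ?b"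
      by (simp only: mult.assoc)
    show "?b \<noteq> 0" "?b \<noteq> \<top>" using ball_neq[OF r] by (auto intro!: enn_powr_neq_0 enn_powr_neq_top)
  qed
qed (rule finite_balls)

lemma doubling_s: "doubling_measure \<mu>s (D5 powr (1 / (s - 1)))"
proof
  show "sets \<mu>s = sets borel" by (simp add: \<mu>s_def)
  fix c :: 'a and r :: real assume r: "0 < r"
  show "0 < emeasure \<mu>s (ball c r)" by (rule \<mu>s_pos[OF r])
  have D5: "0 \<le> D5" by (simp add: D5_def)
  have "enn_powr (emeasure \<mu>s (ball c (5 * r))) (s - 1) \<le> ennreal D5 * enn_powr (emeasure \<mu>s (ball c r)) (s - 1)"
  proof (rule ennreal_mult_right_cancel_le)
    let ?a = "emeasure \<mu>w (ball c r)"
    have "?a \<le> emeasure \<mu>w (ball c (5 * r))"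
      using r by (intro emeasure_mono) (auto simp: \<mu>w_def)
    then have "enn_powr (emeasure \<mu>s (ball c (5 * r))) (s - 1) * ?a \<le> emeasure \<mu>w (ball c (5 * r)) * enn_powr (emeasure \<mu>s (ball c (5 * r))) (s - 1)"
      by (subst mult.commute) (intro mult_right_mono, auto)
    also note D5_bound[OF r]
    finally show "enn_powr (emeasure \<mu>s (ball c (5 * r))) (s - 1) * ?a \<le> ennreal D5 * enn_powr (emeasure \<mu>s (ball c r)) (s - 1) * ?a"
      by (simp only: mult_ac)
    show "?a \<noteq> 0" "?a \<noteq> \<top>" using ball_neq[OF r] by auto
  qed
  then have "emeasure \<mu>s (ball c (5 * r)) \<le> enn_powr (ennreal D5 * enn_powr (emeasure \<mu>s (ball c r)) (s - 1)) (1 / (s - 1))"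
    using s by (subst (asm) enn_powr_le_iff) auto
  also have "\<dots> = ennreal (D5 powr (1 / (s - 1))) * emeasure \<mu>s (ball c r)"
    using s D5 by (simp add: enn_powr_mult enn_powr_powr enn_powr_ennreal)
  finally show "emeasure \<mu>s (ball c (5 * r)) \<le> ennreal (D5 powr (1 / (s - 1))) * emeasure \<mu>s (ball c r)" .
qed (rule finite_balls)

lemma ennreal_inverse_cancel: "0 < x \<Longrightarrow> ennreal x * (Z * ennreal (1 / x)) = Z"
proof -
  assume "0 < x"
  then have "ennreal x * ennreal (1 / x) = 1" by (simp add: ennreal_mult'[symmetric])
  then show ?thesis by (metis mult.left_commute mult.right_neutral)
qed

text \<open>For a ball B the condition converts the Lebesgue average into the \<sigma>-average of
  f/\<sigma>: w(B) times the (s-1)-th power of the former is at most A |B| times that of the latter.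
  The \<sigma>-average is at most the \<sigma>-maximal function at every point of B, so |B| times
  its power is at most an integral over B, which becomes a w-integral on dividing the integrand by
  w. Division by w(B) leaves a w-average.\<close>

lemma lerner_pointwise:
  assumes [measurable]: "f \<in> borel_measurable borel"
  shows "enn_powr (maximal lborel f x) (s - 1) \<le> ennreal A *
    maximal \<mu>w (\<lambda>y. enn_powr (maximal \<mu>s (\<lambda>y. f y * ennreal (1 / \<sigma> y)) y) (s - 1) * ennreal (1 / w y)) x"
proof -
  let ?F = "\<lambda>y. f y * ennreal (1 / \<sigma> y)"
  let ?S = "maximal \<mu>s ?F"
  let ?H = "\<lambda>y. enn_powr (?S y) (s - 1) * ennreal (1 / w y)"
  have s1: "0 < s - 1" using s by simp
  have "maximal lborel f x \<le> enn_powr (ennreal A * maximal \<mu>w ?H x) (1 / (s - 1))"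
  proof (rule maximal_least)
    fix c r assume B: "0 < r" "x \<in> ball c r"
    have [measurable]: "ball c r \<in> sets borel" by simp
    let ?B = "ball c r"
    define I where "I = (\<integral>\<^sup>+ y. f y * indicator ?B y \<partial>lborel)"
    define m where "m = emeasure lborel ?B"
    define a where "a = emeasure \<mu>w ?B"
    define b where "b = emeasure \<mu>s ?B"
    define J where "J = (\<integral>\<^sup>+ y. ?H y * indicator ?B y \<partial>\<mu>w)"
    have m: "m \<noteq> 0" "m \<noteq> \<top>" unfolding m_def using emeasure_ball_neq[OF B(1)] by auto
    have a: "a \<noteq> 0" "a \<noteq> \<top>" and b: "b \<noteq> 0" "b \<noteq> \<top>" unfolding a_def b_def using ball_neq[OF B(1)] by auto
    have cancel: "X / k * k = X" if "k \<noteq> 0" "k \<noteq> \<top>" for X k :: ennreal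
      using that by (simp add: ennreal_divide_times mult_divide_eq_ennreal less_top)
    have IF: "(\<integral>\<^sup>+ y. ?F y * indicator ?B y \<partial>\<mu>s) = I"
      unfolding I_def
      by (subst nn_integral_\<mu>s) (auto intro!: nn_integral_cong simp: mult.assoc[symmetric] ennreal_inverse_cancel[OF \<sigma>_pos, simplified mult.assoc[symmetric]])
    have S: "I / b \<le> ?S y" if "y \<in> ?B" for y
      using maximal_upper[OF B(1) that, where M = \<mu>s and f = ?F] unfolding IF b_def .
    define X where "X = enn_powr (I / b) (s - 1)"
    define Y where "Y = enn_powr (I / m) (s - 1)"
    have Xb: "enn_powr I (s - 1) = X * enn_powr b (s - 1)"
      unfolding X_def enn_powr_mult[symmetric] cancel[OF b] ..
    have Ym: "enn_powr I (s - 1) = Y * enn_powr m (s - 1)"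
      unfolding Y_def enn_powr_mult[symmetric] cancel[OF m] ..
    \<comment> \<open>Multiplication by |B|^(s-1) turns Y into the power of the integral itself,
      which equals X \<sigma>(B)^(s-1); then the condition bounds w(B) \<sigma>(B)^(s-1).\<close>
    have "Y * a \<le> ennreal A * (X * m)"
    proof (rule ennreal_mult_right_cancel_le)
      have "Y * a * enn_powr m (s - 1) = X * (a * enn_powr b (s - 1))"
        unfolding mult.assoc mult.commute[of a] using Xb Ym by (simp only: mult.assoc[symmetric])
      also have "\<dots> \<le> X * (ennreal A * enn_powr m s)"
        unfolding a_def b_def m_def by (intro mult_left_mono Ap' B) simp
      also have "enn_powr m s = m * enn_powr m (s - 1)"
        using enn_powr_add[of m 1 "s - 1"] by simp
      finally show "Y * a * enn_powr m (s - 1) \<le> ennreal A * (X * m) * enn_powr m (s - 1)"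
        by (simp only: mult_ac)
      show "enn_powr m (s - 1) \<noteq> 0" "enn_powr m (s - 1) \<noteq> \<top>"
        using m by (auto intro!: enn_powr_neq_0 enn_powr_neq_top)
    qed
    also have "X * m = (\<integral>\<^sup>+ y. X * indicator ?B y \<partial>lborel)"
      unfolding m_def by (rule nn_integral_cmult_indicator[symmetric]) simp
    also have "\<dots> \<le> (\<integral>\<^sup>+ y. enn_powr (?S y) (s - 1) * indicator ?B y \<partial>lborel)"
      unfolding X_def using S s1 by (intro nn_integral_mono) (auto simp: indicator_def intro!: enn_powr_mono)
    also have "\<dots> = J"
      unfolding J_def
      by (subst nn_integral_\<mu>w) (auto intro!: nn_integral_cong simp: mult.assoc[symmetric] ennreal_inverse_cancel[OF w_pos, simplified mult.assoc[symmetric]])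
    finally have YaJ: "Y * a \<le> ennreal A * J" by (simp add: mult_left_mono)
    have "Y \<le> ennreal A * (J / a)"
    proof (rule ennreal_mult_right_cancel_le[OF _ a])
      show "Y * a \<le> ennreal A * (J / a) * a" using YaJ by (simp only: mult.assoc cancel[OF a])
    qed
    also have "\<dots> \<le> ennreal A * maximal \<mu>w ?H x"
      unfolding J_def a_def by (intro mult_left_mono maximal_upper B) simp
    finally have "enn_powr (I / m) (s - 1) \<le> ennreal A * maximal \<mu>w ?H x" unfolding Y_def .
    then show "I / m \<le> enn_powr (ennreal A * maximal \<mu>w ?H x) (1 / (s - 1))"
      by (simp only: enn_powr_le_iff[OF s1])
  qed
  then show ?thesis by (simp only: enn_powr_le_iff[OF s1])
qed

text \<open>The pointwise estimate is raised to the dual exponent s' = s/(s-1). The strong bound for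
  w with exponent s' and then the one for \<sigma> with exponent s apply; the identities w^(1-s') =
  \<sigma> and \<sigma>^(1-s) = w carry one integral into the next.\<close>

lemma maximal_weighted_bound:
  obtains C where "0 \<le> C"
    and "\<And>f. f \<in> borel_measurable borel \<Longrightarrow>
      (\<integral>\<^sup>+x. ennreal (w x) * enn_powr (maximal lborel f x) s \<partial>lborel) \<le> ennreal C * (\<integral>\<^sup>+x. ennreal (w x) * enn_powr (f x) s \<partial>lborel)"
proof -
  interpret W: doubling_measure \<mu>w D5 by (rule doubling_w)
  interpret S: doubling_measure \<mu>s "D5 powr (1 / (s - 1))" by (rule doubling_s)
  define s' where "s' = s / (s - 1)"
  have s': "1 < s'" "(s - 1) * s' = s" using s by (auto simp: s'_def)
  define C1 where "C1 = 2 * D5 * (s' / (s' - 1)) * 2 powr (s' - 1)"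
  define C2 where "C2 = 2 * D5 powr (1 / (s - 1)) * (s / (s - 1)) * 2 powr (s - 1)"
  have C: "0 \<le> C1" "0 \<le> C2" unfolding C1_def C2_def D5_def using s s' by auto
  show thesis
  proof (rule that[of "max A 0 powr s' * C1 * C2"])
    show "0 \<le> max A 0 powr s' * C1 * C2" using C by simp
  next
    fix f :: "'a \<Rightarrow> ennreal" assume f[measurable]: "f \<in> borel_measurable borel"
    let ?F = "\<lambda>y. f y * ennreal (1 / \<sigma> y)"
    let ?S = "maximal \<mu>s ?F"
    let ?H = "\<lambda>y. enn_powr (?S y) (s - 1) * ennreal (1 / w y)"
    have "(\<integral>\<^sup>+x. ennreal (w x) * enn_powr (maximal lborel f x) s \<partial>lborel) = (\<integral>\<^sup>+x. enn_powr (maximal lborel f x) s \<partial>\<mu>w)"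
      by (subst nn_integral_\<mu>w) auto
    also have "\<dots> \<le> (\<integral>\<^sup>+x. ennreal (max A 0 powr s') * enn_powr (maximal \<mu>w ?H x) s' \<partial>\<mu>w)"
    proof (rule nn_integral_mono)
      fix x
      have "enn_powr (maximal lborel f x) s = enn_powr (enn_powr (maximal lborel f x) (s - 1)) s'"
        by (simp add: enn_powr_powr s')
      also have "\<dots> \<le> enn_powr (ennreal A * maximal \<mu>w ?H x) s'"
        using s' by (intro enn_powr_mono lerner_pointwise f) auto
      also have "\<dots> = enn_powr (ennreal (max A 0)) s' * enn_powr (maximal \<mu>w ?H x) s'"
      proof -
        have "ennreal A = ennreal (max A 0)" by (simp add: max_def ennreal_neg)
        then show ?thesis unfolding enn_powr_mult by (simp only:)
      qed
      also have "enn_powr (ennreal (max A 0)) s' = ennreal (max A 0 powr s')"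
        by (rule enn_powr_ennreal) simp
      finally show "enn_powr (maximal lborel f x) s \<le> ennreal (max A 0 powr s') * enn_powr (maximal \<mu>w ?H x) s'" .
    qed
    also have "\<dots> = ennreal (max A 0 powr s') * (\<integral>\<^sup>+x. enn_powr (maximal \<mu>w ?H x) s' \<partial>\<mu>w)"
      by (rule nn_integral_cmult) measurable
    also have "\<dots> \<le> ennreal (max A 0 powr s') * (ennreal C1 * (\<integral>\<^sup>+x. enn_powr (?H x) s' \<partial>\<mu>w))"
      unfolding C1_def by (intro mult_left_mono W.strong_type s') auto
    also have "(\<integral>\<^sup>+x. enn_powr (?H x) s' \<partial>\<mu>w) = (\<integral>\<^sup>+x. enn_powr (?S x) s \<partial>\<mu>s)"
    proof -
      have "ennreal (w x) * enn_powr (?H x) s' = ennreal (\<sigma> x) * enn_powr (?S x) s" for x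
      proof -
        have eH: "enn_powr (?H x) s' = enn_powr (?S x) s * ennreal ((1 / w x) powr s')"
          unfolding enn_powr_mult enn_powr_powr s' using w_pos[of x] by (simp add: enn_powr_ennreal)
        have "w x * (1 / w x) powr s' = \<sigma> x"
        proof -
          have "w x * (1 / w x) powr s' = w x powr 1 * w x powr (- s')"
            using w_pos[of x] by (simp add: powr_divide powr_minus_divide)
          also have "\<dots> = w x powr (1 - s')" unfolding powr_add[symmetric] by simp
          also have "1 - s' = - 1 / (s - 1)" using s by (simp add: s'_def field_simps)
          finally show ?thesis by (simp add: \<sigma>_def)
        qed
        then have ew: "ennreal (w x) * ennreal ((1 / w x) powr s') = ennreal (\<sigma> x)"
          using w_pos[of x] by (simp add: ennreal_mult'[symmetric])
        show ?thesis unfolding eH ew[symmetric] by (simp only: mult_ac)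
      qed
      then show ?thesis
        by (subst nn_integral_\<mu>w, measurable, subst nn_integral_\<mu>s, measurable)
    qed
    also have "\<dots> \<le> ennreal C2 * (\<integral>\<^sup>+x. enn_powr (?F x) s \<partial>\<mu>s)"
      unfolding C2_def by (intro S.strong_type s) auto
    also have "(\<integral>\<^sup>+x. enn_powr (?F x) s \<partial>\<mu>s) = (\<integral>\<^sup>+x. ennreal (w x) * enn_powr (f x) s \<partial>lborel)"
    proof -
      have "ennreal (\<sigma> x) * enn_powr (?F x) s = ennreal (w x) * enn_powr (f x) s" for x
      proof -
        have eH: "enn_powr (?F x) s = enn_powr (f x) s * ennreal ((1 / \<sigma> x) powr s)"
          unfolding enn_powr_mult using \<sigma>_pos[of x] by (simp add: enn_powr_ennreal)
        have "\<sigma> x * (1 / \<sigma> x) powr s = w x"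
        proof -
          have "\<sigma> x * (1 / \<sigma> x) powr s = \<sigma> x powr 1 * \<sigma> x powr (- s)"
            using \<sigma>_pos[of x] by (simp add: powr_divide powr_minus_divide)
          also have "\<dots> = \<sigma> x powr (1 - s)" unfolding powr_add[symmetric] by simp
          also have "\<dots> = w x powr ((- 1 / (s - 1)) * (1 - s))" unfolding \<sigma>_def powr_powr ..
          also have "(- 1 / (s - 1)) * (1 - s) = 1" using s by (simp add: field_simps)
          finally show ?thesis using w_pos[of x] by simp
        qed
        then have ew: "ennreal (\<sigma> x) * ennreal ((1 / \<sigma> x) powr s) = ennreal (w x)"
          using \<sigma>_pos[of x] by (simp add: ennreal_mult'[symmetric])
        show ?thesis unfolding eH ew[symmetric] by (simp only: mult_ac)
      qed
      then show ?thesis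
        by (subst nn_integral_\<mu>s, measurable)
    qed
    finally have "(\<integral>\<^sup>+x. ennreal (w x) * enn_powr (maximal lborel f x) s \<partial>lborel)
      \<le> ennreal (max A 0 powr s') * (ennreal C1 * (ennreal C2 * (\<integral>\<^sup>+x. ennreal (w x) * enn_powr (f x) s \<partial>lborel)))"
      by (simp add: mult_left_mono)
    also have "\<dots> = ennreal (max A 0 powr s' * C1 * C2) * (\<integral>\<^sup>+x. ennreal (w x) * enn_powr (f x) s \<partial>lborel)"
      using C by (simp add: ennreal_mult mult.assoc)
    finally show "(\<integral>\<^sup>+x. ennreal (w x) * enn_powr (maximal lborel f x) s \<partial>lborel)
      \<le> ennreal (max A 0 powr s' * C1 * C2) * (\<integral>\<^sup>+x. ennreal (w x) * enn_powr (f x) s \<partial>lborel)" .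
  qed
qed

end

section \<open>Transfer to \<open>maxfun\<close> and \<open>muckenhoupt\<close>\<close>

lemma maxfun_eq_maximal:
  assumes "0 < p"
  shows "maxfun p u x = enn_powr (maximal lborel (\<lambda>y. ennreal (norm (u y) powr p)) x) (1 / p)"
proof -
  have "emeasure lebesgue B = emeasure lborel B" if "B \<in> {ball c r | c r. 0 < r \<and> x \<in> ball c r}" for B :: "'a set"
    using that by auto
  then show ?thesis
    unfolding maxfun_def maximal_def using assms
    by (subst enn_powr_SUP) (auto intro!: SUP_cong simp: nn_integral_completion)
qed

lemma maxfun_measurable:
  assumes "0 < p"
  shows "maxfun p u \<in> borel_measurable borel"
proof -
  have "maxfun p u = (\<lambda>x. enn_powr (maximal lborel (\<lambda>y. ennreal (norm (u y) powr p)) x) (1 / p))"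
    by (intro ext maxfun_eq_maximal assms)
  then show ?thesis by simp
qed

lemma maxfun_le:
  assumes p: "0 < p" and A: "0 \<le> A" "AE y in lborel. norm (u y) \<le> A"
  shows "maxfun p u x \<le> ennreal A"
proof -
  have "maximal lborel (\<lambda>y. ennreal (norm (u y) powr p)) x \<le> ennreal (A powr p)"
  proof (rule maximal_least)
    fix c :: 'a and r :: real assume r: "0 < r"
    have "(\<integral>\<^sup>+ y. ennreal (norm (u y) powr p) * indicator (ball c r) y \<partial>lborel) \<le> (\<integral>\<^sup>+ y. ennreal (A powr p) * indicator (ball c r) y \<partial>lborel)"
      using A(2) by (intro nn_integral_mono_AE, eventually_elim) (use p in \<open>auto simp: indicator_def intro!: ennreal_leI powr_mono2\<close>)
    also have "\<dots> = ennreal (A powr p) * emeasure lborel (ball c r)"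
      by (rule nn_integral_cmult_indicator) simp
    finally have "(\<integral>\<^sup>+ y. ennreal (norm (u y) powr p) * indicator (ball c r) y \<partial>lborel) / emeasure lborel (ball c r)
      \<le> ennreal (A powr p) * emeasure lborel (ball c r) / emeasure lborel (ball c r)"
      by (rule divide_right_mono_ennreal)
    also have "\<dots> = ennreal (A powr p)" using emeasure_ball_neq[OF r, of c] by (simp add: ennreal_mult_divide_eq)
    finally show "(\<integral>\<^sup>+ y. ennreal (norm (u y) powr p) * indicator (ball c r) y \<partial>lborel) / emeasure lborel (ball c r) \<le> ennreal (A powr p)" .
  qed
  then have "maxfun p u x \<le> enn_powr (ennreal (A powr p)) (1 / p)"
    unfolding maxfun_eq_maximal[OF p] using p by (intro enn_powr_mono) auto
  also have "\<dots> = ennreal A" using A p by (simp add: enn_powr_ennreal powr_powr)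
  finally show ?thesis .
qed

lemma muckenhoupt_ball:
  fixes w :: "'a::euclidean_space \<Rightarrow> real"
  assumes "muckenhoupt s w"
  obtains A where "\<And>c r. 0 < r \<Longrightarrow> (\<integral>\<^sup>+y. ennreal (w y) * indicator (ball c r) y \<partial>lborel) *
     enn_powr (\<integral>\<^sup>+y. (if w y = 0 then \<infinity> else ennreal (w y powr (- 1 / (s - 1)))) * indicator (ball c r) y \<partial>lborel) (s - 1)
     \<le> ennreal A * enn_powr (emeasure lborel (ball c r)) s"
proof -
  let ?W = "\<lambda>B. \<integral>\<^sup>+y. ennreal (w y) * indicator B y \<partial>lborel"
  let ?S = "\<lambda>B. \<integral>\<^sup>+y. (if w y = 0 then \<infinity> else ennreal (w y powr (- 1 / (s - 1)))) * indicator B y \<partial>lborel"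
  define T where "T = (SUP B \<in> {ball c r | c r. 0 < r}. ((\<integral>\<^sup>+ y \<in> B. ennreal (w y) \<partial>lebesgue) / emeasure lebesgue B) *
        enn_powr ((\<integral>\<^sup>+ y \<in> B. (if w y = 0 then \<infinity> else ennreal (w y powr (- 1 / (s - 1)))) \<partial>lebesgue)
                   / emeasure lebesgue (B :: 'a set)) (s - 1))"
  have T: "T < \<infinity>" using assms unfolding muckenhoupt_def T_def by blast
  then obtain A where A: "T = ennreal A" by (cases T) auto
  show thesis
  proof (rule that[of A])
    fix c :: 'a and r :: real assume r: "0 < r"
    define m where "m = emeasure lborel (ball c r)"
    have m: "m \<noteq> 0" "m \<noteq> \<top>" unfolding m_def using emeasure_ball_neq[OF r] by auto
    have cancel: "X / m * m = X" for X :: ennreal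
      using m by (simp add: ennreal_divide_times mult_divide_eq_ennreal less_top)
    have "ball c r \<in> {ball c r | c r. 0 < r}" using r by blast
    then have "((\<integral>\<^sup>+ y \<in> ball c r. ennreal (w y) \<partial>lebesgue) / emeasure lebesgue (ball c r)) *
        enn_powr ((\<integral>\<^sup>+ y \<in> ball c r. (if w y = 0 then \<infinity> else ennreal (w y powr (- 1 / (s - 1)))) \<partial>lebesgue)
                   / emeasure lebesgue (ball c r)) (s - 1) \<le> T" unfolding T_def by (rule SUP_upper)
    then have le: "(?W (ball c r) / m) * enn_powr (?S (ball c r) / m) (s - 1) \<le> ennreal A"
      unfolding nn_integral_completion A m_def by simp
    have "?W (ball c r) * enn_powr (?S (ball c r)) (s - 1)
      = (?W (ball c r) / m * m) * enn_powr (?S (ball c r) / m * m) (s - 1)" unfolding cancel ..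
    also have "\<dots> = ((?W (ball c r) / m) * enn_powr (?S (ball c r) / m) (s - 1)) * (m * enn_powr m (s - 1))"
      unfolding enn_powr_mult by (simp only: mult_ac)
    also have "m * enn_powr m (s - 1) = enn_powr m s" using enn_powr_add[of m 1 "s - 1"] by simp
    also have "((?W (ball c r) / m) * enn_powr (?S (ball c r) / m) (s - 1)) * enn_powr m s \<le> ennreal A * enn_powr m s"
      by (intro mult_right_mono le) simp
    finally show "?W (ball c r) * enn_powr (?S (ball c r)) (s - 1) \<le> ennreal A * enn_powr (emeasure lborel (ball c r)) s"
      unfolding m_def .
  qed
qed

text \<open>Because 0 times \<infinity> is 0, the zero weight satisfies the condition. If w has
  positive integral over some ball around 0, then so it has over all larger ones; there the integral
  of the dual weight is finite, and since the dual weight is \<infinity> where w = 0, w is nonzero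
  almost everywhere.\<close>

lemma muckenhoupt_cases:
  fixes w :: "'a::euclidean_space \<Rightarrow> real"
  assumes muck: "muckenhoupt s w"
  obtains (zero) "AE x in lborel. w x = 0"
    | (weight) w' A where "Ap_weight w' s A" "AE x in lborel. w x = w' x"
proof (cases "AE x in lborel. w x = 0")
  case False
  have s: "1 < s" and w0: "\<And>x. 0 \<le> w x" and wm[measurable]: "w \<in> borel_measurable lebesgue"
    using muck unfolding muckenhoupt_def by auto
  obtain A where A: "\<And>c r. 0 < r \<Longrightarrow> (\<integral>\<^sup>+y. ennreal (w y) * indicator (ball c r) y \<partial>lborel) *
     enn_powr (\<integral>\<^sup>+y. (if w y = 0 then \<infinity> else ennreal (w y powr (- 1 / (s - 1)))) * indicator (ball c r) y \<partial>lborel) (s - 1)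
     \<le> ennreal A * enn_powr (emeasure lborel (ball c r)) s"
    using muckenhoupt_ball[OF muck] by blast
  let ?g = "\<lambda>y. if w y = 0 then \<infinity> else ennreal (w y powr (- 1 / (s - 1)))"
  have [measurable]: "?g \<in> borel_measurable lebesgue" by measurable
  define N where "N = {n::nat. 0 < n \<and> (\<integral>\<^sup>+y. ennreal (w y) * indicator (ball 0 (real n)) y \<partial>lborel) \<noteq> 0}"
  have AEn: "AE x in lborel. x \<in> ball 0 (real n) \<longrightarrow> w x \<noteq> 0" if n: "n \<in> N" for n
  proof -
    let ?B = "ball 0 (real n) :: 'a set"
    have r: "0 < real n" using n by (simp add: N_def)
    have [measurable]: "?B \<in> sets lebesgue" by simp
    have "ennreal A * enn_powr (emeasure lborel ?B) s < \<top>"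
      using enn_powr_neq_top[OF emeasure_ball_neq(2)[OF r, of "0::'a"], of s]
      by (simp add: ennreal_mult_eq_top_iff less_top[symmetric])
    then have "(\<integral>\<^sup>+y. ennreal (w y) * indicator ?B y \<partial>lborel) * enn_powr (\<integral>\<^sup>+y. ?g y * indicator ?B y \<partial>lborel) (s - 1) < \<top>"
      using A[OF r, of 0] by (rule le_less_trans[rotated])
    then have "enn_powr (\<integral>\<^sup>+y. ?g y * indicator ?B y \<partial>lborel) (s - 1) \<noteq> \<top>"
      using n by (auto simp: N_def ennreal_mult_less_top)
    then have "(\<integral>\<^sup>+y. ?g y * indicator ?B y \<partial>lborel) \<noteq> \<infinity>" by auto
    then have "(\<integral>\<^sup>+y. ?g y * indicator ?B y \<partial>lebesgue) \<noteq> \<infinity>" by (simp add: nn_integral_completion)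
    then have "AE y in lebesgue. ?g y * indicator ?B y \<noteq> \<infinity>" by (intro nn_integral_PInf_AE) auto
    then have "AE y in lborel. ?g y * indicator ?B y \<noteq> \<infinity>" by (simp only: AE_completion_iff)
    then show ?thesis by eventually_elim (auto simp: indicator_def)
  qed
  obtain n0 where n0: "n0 \<in> N"
  proof (rule ccontr)
    assume "\<not> thesis"
    then have N: "N = {}" using that by blast
    have "AE x in lborel. \<forall>n::nat. x \<in> ball 0 (real (Suc n)) \<longrightarrow> w x = 0"
    proof (subst AE_all_countable, intro allI)
      fix n :: nat
      let ?B = "ball 0 (real (Suc n)) :: 'a set"
      have [measurable]: "?B \<in> sets lebesgue" by simp
      have "(\<integral>\<^sup>+y. ennreal (w y) * indicator ?B y \<partial>lborel) = 0"
        using N unfolding N_def by blast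
      then have "(\<integral>\<^sup>+y. ennreal (w y) * indicator ?B y \<partial>lebesgue) = 0" by (simp add: nn_integral_completion)
      moreover have mm: "(\<lambda>y. ennreal (w y) * indicator ?B y) \<in> borel_measurable lebesgue" by measurable
      ultimately have "AE y in lebesgue. ennreal (w y) * indicator ?B y = 0"
        by (simp only: nn_integral_0_iff_AE[OF mm])
      then have "AE y in lborel. ennreal (w y) * indicator ?B y = 0" by (simp only: AE_completion_iff)
      then show "AE x in lborel. x \<in> ?B \<longrightarrow> w x = 0"
        by eventually_elim (use w0 in \<open>auto simp: indicator_def ennreal_eq_0_iff antisym\<close>)
    qed
    then have "AE x in lborel. w x = 0"
    proof eventually_elim
      case (elim x)
      obtain n :: nat where "norm x < real n" using reals_Archimedean2 by blast
      then have "x \<in> ball 0 (real (Suc n))" by simp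
      with elim show ?case by blast
    qed
    with False show False by blast
  qed
  have nN: "n \<in> N" if "n0 \<le> n" for n
  proof -
    have "(\<integral>\<^sup>+y. ennreal (w y) * indicator (ball 0 (real n0)) y \<partial>lborel) \<le> (\<integral>\<^sup>+y. ennreal (w y) * indicator (ball (0::'a) (real n)) y \<partial>lborel)"
      using that by (intro nn_integral_mono mult_left_mono) (auto simp: indicator_def)
    then show ?thesis using n0 that by (auto simp: N_def)
  qed
  have "AE x in lborel. x \<in> ball 0 (real (n0 + n)) \<longrightarrow> w x \<noteq> 0" for n
    by (rule AEn[OF nN]) simp
  then have "AE x in lborel. \<forall>n. x \<in> ball 0 (real (n0 + n)) \<longrightarrow> w x \<noteq> 0" by (simp only: AE_all_countable) blast
  then have nz: "AE x in lborel. w x \<noteq> 0"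
  proof eventually_elim
    case (elim x)
    obtain n :: nat where "norm x < real n" using reals_Archimedean2 by blast
    then have "x \<in> ball 0 (real (n0 + n))" by simp
    with elim show ?case by blast
  qed
  obtain v where v[measurable]: "v \<in> borel_measurable lborel" and wv: "AE x in lborel. w x = v x"
    using completion_ex_borel_measurable_real[OF wm] by blast
  \<comment> \<open>A Borel version of w, reset to 1 on the null set where it fails to be
    positive.\<close>
  define w' where "w' = (\<lambda>x. if 0 < v x then v x else 1)"
  have w'm: "w' \<in> borel_measurable borel" unfolding w'_def using v by simp
  have w'pos: "0 < w' x" for x by (simp add: w'_def)
  have ww': "AE x in lborel. w x = w' x"
    using wv nz
  proof eventually_elim
    case (elim x)
    then show ?case using w0[of x] by (auto simp: w'_def)
  qed
  have "Ap_weight w' s A"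
  proof
    fix c :: 'a and r :: real assume r: "0 < r"
    have 1: "(\<integral>\<^sup>+y. ennreal (w' y) * indicator (ball c r) y \<partial>lborel) = (\<integral>\<^sup>+y. ennreal (w y) * indicator (ball c r) y \<partial>lborel)"
      using ww' by (intro nn_integral_cong_AE, eventually_elim) simp
    have 2: "(\<integral>\<^sup>+y. ennreal (w' y powr (- 1 / (s - 1))) * indicator (ball c r) y \<partial>lborel) = (\<integral>\<^sup>+y. ?g y * indicator (ball c r) y \<partial>lborel)"
      using ww' nz by (intro nn_integral_cong_AE, eventually_elim) simp
    show "(\<integral>\<^sup>+y. ennreal (w' y) * indicator (ball c r) y \<partial>lborel)
       * enn_powr (\<integral>\<^sup>+y. ennreal (w' y powr (- 1 / (s - 1))) * indicator (ball c r) y \<partial>lborel) (s - 1)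
       \<le> ennreal A * enn_powr (emeasure lborel (ball c r)) s" unfolding 1 2 by (rule A[OF r])
  qed (fact s w'm w'pos)+
  from this ww' show thesis by (rule that(2))
qed (rule that(1))

text \<open>The weighted maximal theorem with exponent q/p, applied to |u|^p.\<close>

lemma maxfun_weighted_bound:
  fixes w :: "'a::euclidean_space \<Rightarrow> real"
  assumes w: "Ap_weight w (q / p) A" and p: "0 < p"
  obtains C where "0 \<le> C"
    and "\<And>u. u \<in> borel_measurable borel \<Longrightarrow>
      (\<integral>\<^sup>+x. ennreal (w x) * enn_powr (maxfun p u x) q \<partial>lborel) \<le> ennreal C * (\<integral>\<^sup>+x. ennreal (norm (u x) powr q * w x) \<partial>lborel)"
proof -
  interpret Ap_weight w "q / p" A by (rule w)
  obtain C where C: "0 \<le> C"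
    and bd: "\<And>f. f \<in> borel_measurable borel \<Longrightarrow>
      (\<integral>\<^sup>+x. ennreal (w x) * enn_powr (maximal lborel f x) (q / p) \<partial>lborel) \<le> ennreal C * (\<integral>\<^sup>+x. ennreal (w x) * enn_powr (f x) (q / p) \<partial>lborel)"
    using maximal_weighted_bound by blast
  show thesis
  proof (rule that[OF C])
    fix u :: "'a \<Rightarrow> complex" assume [measurable]: "u \<in> borel_measurable borel"
    have 1: "enn_powr (maxfun p u x) q = enn_powr (maximal lborel (\<lambda>y. ennreal (norm (u y) powr p)) x) (q / p)" for x
      unfolding maxfun_eq_maximal[OF p] enn_powr_powr by simp
    have 2: "ennreal (w x) * enn_powr (ennreal (norm (u x) powr p)) (q / p) = ennreal (norm (u x) powr q * w x)" for x
      using p w_pos[of x] by (simp add: enn_powr_ennreal powr_powr ennreal_mult' mult.commute)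
    show "(\<integral>\<^sup>+x. ennreal (w x) * enn_powr (maxfun p u x) q \<partial>lborel) \<le> ennreal C * (\<integral>\<^sup>+x. ennreal (norm (u x) powr q * w x) \<partial>lborel)"
      unfolding 1 2[symmetric] by (rule bd) measurable
  qed
qed

subsection \<open>Multilinear operators\<close>

lemma schwartz_borel: "schwartz u \<Longrightarrow> u \<in> borel_measurable borel"
  unfolding schwartz_def by (auto intro: smooth_fun_borel)

lemma schwartz_decay:
  assumes "schwartz u"
  obtains C where "0 \<le> C" "\<And>x. (1 + norm x) ^ k * norm (u x) \<le> C"
proof -
  obtain C where C: "\<And>x. (1 + norm x) ^ k * norm (Dlist [] u x) \<le> C"
    using assms unfolding schwartz_def by (metis empty_set empty_subsetI)
  have "0 \<le> (1 + norm x) ^ k * norm (Dlist [] u x)" for x by simp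
  with C have "0 \<le> C" using order_trans by blast
  with C that show thesis by simp
qed

lemma schwartz_bounded:
  assumes "schwartz u"
  obtains C where "0 \<le> C" "\<And>x. norm (u x) \<le> C"
proof -
  obtain C where C: "0 \<le> C" "\<And>x. (1 + norm x) ^ 0 * norm (u x) \<le> C"
    using schwartz_decay[OF assms, of 0] by blast
  show thesis by (rule that[of C]) (use C in simp_all)
qed

text \<open>The comparison function (1 + |y|^2)^(-(n+1)/2) is integrable by
  \<open>weighted_integral_le_maxfun\<close> for the constant function 1, whose maximal function is
  at most 1.\<close>

lemma schwartz_integrable:
  fixes u :: "'a::euclidean_space \<Rightarrow> complex"
  assumes u: "schwartz u"
  shows "integrable lborel u"
proof -
  let ?g = "\<lambda>y::'a. (1 + (norm y)\<^sup>2) powr (- (real DIM('a) + 1) / 2)"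
  have "maxfun 1 (\<lambda>_::'a. 1) 0 \<le> ennreal 1" by (rule maxfun_le) auto
  then have "(\<integral>\<^sup>+ y. ennreal (?g y) \<partial>lborel) \<le> ennreal (2 ^ (DIM('a) + 2) * unit_ball_vol (DIM('a)))"
    using weighted_integral_le_maxfun[of "\<lambda>_::'a. 1" 1 1 0 1] by simp
  then have "(\<integral>\<^sup>+ y. ennreal (?g y) \<partial>lborel) < \<infinity>" by (rule le_less_trans) simp
  then have gi: "integrable lborel ?g" by (intro integrableI_nonneg) auto
  obtain C where C: "0 \<le> C" "\<And>x. (1 + norm x) ^ (DIM('a) + 1) * norm (u x) \<le> C"
    using schwartz_decay[OF u, of "DIM('a) + 1"] by blast
  have [measurable]: "u \<in> borel_measurable borel" by (rule schwartz_borel[OF u])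
  show ?thesis
  proof (rule Bochner_Integration.integrable_bound)
    show "integrable lborel (\<lambda>y. C * ?g y)" by (intro integrable_mult_right gi)
    show "AE y in lborel. norm (u y) \<le> norm (C * ?g y)"
    proof (rule AE_I2)
      fix y :: 'a
      have pos: "0 < 1 + (norm y)\<^sup>2" by (simp add: add_pos_nonneg)
      have "(1 + (norm y)\<^sup>2) powr ((real DIM('a) + 1) / 2) \<le> ((1 + norm y)\<^sup>2) powr ((real DIM('a) + 1) / 2)"
        using pos by (intro powr_mono2) (auto simp: power2_eq_square algebra_simps)
      also have "\<dots> = (1 + norm y) powr (real (DIM('a) + 1))"
      proof -
        have "(1 + norm y)\<^sup>2 = (1 + norm y) powr 2" by (simp add: powr_numeral)
        moreover have "2 * ((real DIM('a) + 1) / 2) = real (DIM('a) + 1)" by simp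
        ultimately show ?thesis by (simp only: powr_powr)
      qed
      also have "\<dots> = (1 + norm y) ^ (DIM('a) + 1)" by (rule powr_realpow) (simp add: add_pos_nonneg)
      finally have "(1 + (norm y)\<^sup>2) powr ((real DIM('a) + 1) / 2) * norm (u y) \<le> C"
        using C(2)[of y] by (meson mult_right_mono norm_ge_zero order_trans)
      then have "((1 + (norm y)\<^sup>2) powr ((real DIM('a) + 1) / 2) * norm (u y)) * ?g y \<le> C * ?g y"
        by (rule mult_right_mono) simp
      moreover have "(1 + (norm y)\<^sup>2) powr ((real DIM('a) + 1) / 2) * ?g y = 1"
        using pos by (simp add: powr_add[symmetric] add_divide_distrib[symmetric])
      then have "((1 + (norm y)\<^sup>2) powr ((real DIM('a) + 1) / 2) * norm (u y)) * ?g y = norm (u y)"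
        by (metis mult.assoc mult.commute mult_1)
      ultimately have "norm (u y) \<le> C * ?g y" by (simp only:)
      also have "\<dots> \<le> norm (C * ?g y)" unfolding real_norm_def by (rule abs_ge_self)
      finally show "norm (u y) \<le> norm (C * ?g y)" .
    qed
  qed measurable
qed

lemma fourier_translate:
  fixes u :: "'a::euclidean_space \<Rightarrow> complex"
  assumes u: "integrable lborel u"
  shows "fourier (\<lambda>y. u (x + y)) \<xi> = fourier u \<xi> * cis (x \<bullet> \<xi>)"
proof -
  have "fourier u \<xi> = (\<integral>y. u (x + y) * cis (- (\<xi> \<bullet> (x + y))) \<partial>lborel)"
    unfolding fourier_def by (rule integrable_lborel_translate(2)[symmetric]) (intro integrable_mult_cis u, simp)
  also have "\<dots> = (\<integral>y. cis (- (x \<bullet> \<xi>)) * (u (x + y) * cis (- (\<xi> \<bullet> y))) \<partial>lborel)"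
  proof (intro Bochner_Integration.integral_cong refl)
    fix y
    have "cis (- (\<xi> \<bullet> (x + y))) = cis (- (x \<bullet> \<xi>)) * cis (- (\<xi> \<bullet> y))"
      by (subst cis_mult) (simp add: inner_add_right inner_commute[of x \<xi>])
    then show "u (x + y) * cis (- (\<xi> \<bullet> (x + y))) = cis (- (x \<bullet> \<xi>)) * (u (x + y) * cis (- (\<xi> \<bullet> y)))"
      by (simp only: mult_ac)
  qed
  also have "\<dots> = cis (- (x \<bullet> \<xi>)) * fourier (\<lambda>y. u (x + y)) \<xi>"
    unfolding fourier_def by (rule integral_mult_right_zero)
  finally show ?thesis by (simp add: cis_mult mult_ac)
qed

lemma weighted_bound_translate:
  fixes u :: "'a::euclidean_space \<Rightarrow> complex"
  assumes [measurable]: "u \<in> borel_measurable borel" and p: "0 < p" and A: "0 \<le> A" "maxfun p u x \<le> ennreal A"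
  shows "weighted_bound p (\<lambda>y. u (x + y)) A"
  unfolding weighted_bound_def
proof (intro allI impI)
  fix h :: real assume h: "0 < h"
  let ?f = "\<lambda>y. ennreal (norm (u y) powr p * (1 + h\<^sup>2 * (norm (y - x))\<^sup>2) powr (- (real DIM('a) + 1) / 2))"
  have "(\<integral>\<^sup>+ y. ?f (x + y) \<partial>lborel) = (\<integral>\<^sup>+ y. ?f y \<partial>lborel)"
    by (rule nn_integral_lborel_translate) measurable
  also have "\<dots> \<le> ennreal (2 ^ (DIM('a) + 2) * unit_ball_vol (DIM('a)) * A powr p / h ^ DIM('a))"
    by (intro weighted_integral_le_maxfun assms h)
  finally show "(\<integral>\<^sup>+ y. ennreal (norm (u (x + y)) powr p * (1 + h\<^sup>2 * (norm y)\<^sup>2) powr (- (real DIM('a) + 1) / 2)) \<partial>lborel)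
    \<le> ennreal (2 ^ (DIM('a) + 2) * unit_ball_vol (DIM('a)) * A powr p / h ^ DIM('a))" by simp
qed

text \<open>The factor \<open>cis (x \<bullet> \<xi>)\<close> turns the transform of u_j into that
  of its translate, so the point x becomes the origin. The assumed bound asks for positive A_j while
  a maximal function may vanish; hence A_j is the maximal function plus e, and e tends to 0. The
  maximal functions are finite because Schwartz functions are bounded.\<close>

lemma T_op_le_maxfun:
  fixes u :: "'N::finite \<Rightarrow> real^'n \<Rightarrow> complex"
  assumes u: "\<And>j. schwartz (u j)" and p: "\<And>j. 0 < p j" and C: "0 \<le> C"
    and bd: "\<And>(U :: 'N \<Rightarrow> real^'n \<Rightarrow> complex) A. \<lbrakk>\<And>j. integrable lborel (U j); \<And>j. 0 < A j; \<And>j. weighted_bound (p j) (U j) (A j)\<rbrakk>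
      \<Longrightarrow> norm (\<integral>\<Xi>. a x \<Xi> * (\<Prod>j\<in>UNIV. fourier (U j) (\<Xi> $ j)) \<partial>lborel) \<le> C * (\<Prod>j\<in>UNIV. A j)"
  shows "ennreal (norm (T_op a u x)) \<le> ennreal C * (\<Prod>j\<in>UNIV. maxfun (p j) (u j) x)"
proof -
  have ui: "integrable lborel (u j)" and [measurable]: "u j \<in> borel_measurable borel" for j
    by (rule schwartz_integrable[OF u], rule schwartz_borel[OF u])
  have T: "T_op a u x = (\<integral>\<Xi>. a x \<Xi> * (\<Prod>j\<in>UNIV. fourier (\<lambda>y. u j (x + y)) (\<Xi> $ j)) \<partial>lborel)"
    unfolding T_op_def by (simp add: fourier_translate ui)
  define M where "M = (\<lambda>j. enn2real (maxfun (p j) (u j) x))"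
  have M: "maxfun (p j) (u j) x = ennreal (M j)" "0 \<le> M j" for j
  proof -
    obtain c where c: "0 \<le> c" "\<And>x. norm (u j x) \<le> c" using schwartz_bounded[OF u] by blast
    have "maxfun (p j) (u j) x \<le> ennreal c" by (rule maxfun_le[OF p c(1)]) (use c in auto)
    then have "maxfun (p j) (u j) x < \<top>" by (rule le_less_trans) simp
    then show "maxfun (p j) (u j) x = ennreal (M j)" by (simp add: M_def)
    show "0 \<le> M j" by (simp add: M_def)
  qed
  have le: "norm (T_op a u x) \<le> C * (\<Prod>j\<in>UNIV. M j + e)" if e: "0 < e" for e
    unfolding T
  proof (rule bd)
    fix j
    show "integrable lborel (\<lambda>y. u j (x + y))" by (rule integrable_lborel_translate[OF ui])
    show "0 < M j + e" using M(2)[of j] e by simp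
    show "weighted_bound (p j) (\<lambda>y. u j (x + y)) (M j + e)"
      using M[of j] e by (intro weighted_bound_translate p) (auto intro: ennreal_leI)
  qed
  have "((\<lambda>e. C * (\<Prod>j\<in>UNIV. M j + e)) \<longlongrightarrow> C * (\<Prod>j\<in>UNIV. M j + 0)) (at_right 0)"
    by (intro tendsto_intros)
  then have "norm (T_op a u x) \<le> C * (\<Prod>j\<in>UNIV. M j + 0)"
    by (rule tendsto_lowerbound) (auto simp: eventually_at_right_field intro!: exI[of _ 1] le)
  then have "ennreal (norm (T_op a u x)) \<le> ennreal (C * (\<Prod>j\<in>UNIV. M j))" by (simp add: ennreal_leI)
  also have "\<dots> = ennreal C * (\<Prod>j\<in>UNIV. maxfun (p j) (u j) x)"
    unfolding M(1) using C M(2) by (subst prod_ennreal) (auto simp: ennreal_mult' )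
  finally show ?thesis .
qed

section \<open>From the symbol class to estimates at a fixed x\<close>

lemma finite_derivative_lists: "finite {vs :: 'a::euclidean_space list. set vs \<subseteq> Basis \<and> length vs \<le> K}"
  by (rule finite_lists_length_le[OF finite_Basis])

text \<open>Only finitely many lists of directions have length at most K, so their exceptional sets
  unite to a null set. Passing to \<open>max B 0\<close> makes the constant nonnegative.\<close>

lemma symbol_class_smooth_bounds:
  fixes a :: "real^'n \<Rightarrow> (real^'n)^'N::finite \<Rightarrow> complex"
  assumes "symbol_class m \<rho> a"
    and "\<forall>vs. set vs \<subseteq> Basis \<and> length vs \<le> K \<longrightarrow>
      (AE x in lebesgue. \<forall>\<Xi>. norm (Dlist vs (a x) \<Xi>) \<le> B * jbr \<Xi> powr (m - \<rho> * real (length vs)))"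
  shows "AE x in lebesgue. smooth_fun (a x) \<and> symbol_bounds K m \<rho> (max B 0) (a x)"
proof -
  let ?V = "{vs. set vs \<subseteq> Basis \<and> length vs \<le> K}"
  have "AE x in lebesgue. smooth_fun (a x)" using assms(1) by (simp add: symbol_class_def)
  moreover have "AE x in lebesgue. \<forall>vs\<in>?V. \<forall>\<Xi>. norm (Dlist vs (a x) \<Xi>) \<le> B * jbr \<Xi> powr (m - \<rho> * real (length vs))"
    using assms(2) by (intro AE_finite_allI finite_derivative_lists) auto
  ultimately show ?thesis
  proof eventually_elim
    case (elim x)
    have "symbol_bounds K m \<rho> (max B 0) (a x)"
      unfolding symbol_bounds_def
    proof (intro allI impI)
      fix vs :: "((real^'n)^'N) list" and \<Xi> :: "(real^'n)^'N"
      assume "set vs \<subseteq> Basis \<and> length vs \<le> K"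
      then have "norm (Dlist vs (a x) \<Xi>) \<le> B * jbr \<Xi> powr (m - \<rho> * real (length vs))" using elim(2) by simp
      also have "\<dots> \<le> max B 0 * jbr \<Xi> powr (m - \<rho> * real (length vs))" by (intro mult_right_mono) auto
      finally show "norm (Dlist vs (a x) \<Xi>) \<le> max B 0 * jbr \<Xi> powr (m - \<rho> * real (length vs))" .
    qed
    with elim(1) show ?case ..
  qed
qed

lemma T_op_pointwise_bound:
  fixes p :: "'N::finite \<Rightarrow> real" and m \<rho> :: real
  assumes p: "\<And>j. 1 \<le> p j \<and> p j \<le> 2" and \<rho>: "0 \<le> \<rho>" "\<rho> \<le> 1"
    and m: "m < (\<rho> - 1) * (\<Sum>j\<in>UNIV. real CARD('n) / p j)"
  obtains K C where "0 < C"
    and "\<forall>B (a :: real^'n \<Rightarrow> (real^'n)^'N \<Rightarrow> complex) (u :: 'N \<Rightarrow> real^'n \<Rightarrow> complex).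
      symbol_class m \<rho> a \<longrightarrow>
      (\<forall>vs. set vs \<subseteq> Basis \<and> length vs \<le> K \<longrightarrow>
        (AE x in lebesgue. \<forall>\<Xi>. norm (Dlist vs (a x) \<Xi>) \<le> B * jbr \<Xi> powr (m - \<rho> * real (length vs)))) \<longrightarrow>
      (\<forall>j. schwartz (u j)) \<longrightarrow>
      (AE x in lebesgue. ennreal (norm (T_op a u x)) \<le> ennreal (C * max B 0) * (\<Prod>j\<in>UNIV. maxfun (p j) (u j) x))"
proof -
  have m': "m < (\<rho> - 1) * (\<Sum>j\<in>UNIV. real DIM(real^'n) / p j)" using m by simp
  obtain K C where C: "0 < C"
    and bd: "\<forall>(b :: (real^'n) ^ 'N \<Rightarrow> complex) B (U :: 'N \<Rightarrow> real^'n \<Rightarrow> complex) A. smooth_fun b \<longrightarrow> 0 \<le> B \<longrightarrow>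
       symbol_bounds K m \<rho> B b \<longrightarrow>
       (\<forall>j. integrable lborel (U j) \<and> 0 < A j \<and> weighted_bound (p j) (U j) (A j)) \<longrightarrow>
       norm (\<integral>\<Xi>. b \<Xi> * (\<Prod>j\<in>UNIV. fourier (U j) (\<Xi> $ j)) \<partial>lborel) \<le> C * B * (\<Prod>j\<in>UNIV. A j)"
    by (rule multilinear_pointwise_bound[OF p \<rho> m'])
  show thesis
  proof (rule that[of C K], goal_cases)
    case 1
    show ?case by (rule C)
  next
    case 2
    show ?case
    proof (intro allI impI)
      fix B :: real and a :: "real^'n \<Rightarrow> (real^'n)^'N \<Rightarrow> complex" and u :: "'N \<Rightarrow> real^'n \<Rightarrow> complex"
      assume a: "symbol_class m \<rho> a"
        and H: "\<forall>vs. set vs \<subseteq> Basis \<and> length vs \<le> K \<longrightarrow>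
          (AE x in lebesgue. \<forall>\<Xi>. norm (Dlist vs (a x) \<Xi>) \<le> B * jbr \<Xi> powr (m - \<rho> * real (length vs)))"
        and u: "\<forall>j. schwartz (u j)"
      from symbol_class_smooth_bounds[OF a H]
      show "AE x in lebesgue. ennreal (norm (T_op a u x)) \<le> ennreal (C * max B 0) * (\<Prod>j\<in>UNIV. maxfun (p j) (u j) x)"
      proof eventually_elim
        case (elim x)
        show ?case
        proof (rule T_op_le_maxfun)
          show "schwartz (u j)" for j using u by blast
          show "0 < p j" for j using p[of j] by linarith
          show "0 \<le> C * max B 0" using C by simp
        qed (use bd elim in auto)
      qed
    qed
  qed
qed

text \<open>The sum of the absolute values of the finitely many constants serves for all orders up
  to K.\<close>

lemma symbol_class_uniform_bound:
  fixes a :: "real^'n \<Rightarrow> (real^'n)^'N::finite \<Rightarrow> complex"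
  assumes a: "symbol_class m \<rho> a"
  obtains B where "\<forall>vs. set vs \<subseteq> Basis \<and> length vs \<le> K \<longrightarrow>
           (AE x in lebesgue. \<forall>\<Xi>. norm (Dlist vs (a x) \<Xi>) \<le> B * jbr \<Xi> powr (m - \<rho> * real (length vs)))"
proof -
  let ?V = "{vs :: ((real^'n)^'N) list. set vs \<subseteq> Basis \<and> length vs \<le> K}"
  have "\<forall>vs. \<exists>C. set vs \<subseteq> Basis \<longrightarrow> (AE x in lebesgue. \<forall>\<Xi>. norm (Dlist vs (a x) \<Xi>) \<le> C * jbr \<Xi> powr (m - \<rho> * real (length vs)))"
    using a unfolding symbol_class_def by blast
  from choice[OF this] obtain c where c: "\<forall>vs. set vs \<subseteq> Basis \<longrightarrow> (AE x in lebesgue. \<forall>\<Xi>. norm (Dlist vs (a x) \<Xi>) \<le> c vs * jbr \<Xi> powr (m - \<rho> * real (length vs)))"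
    by blast
  define B where "B = (\<Sum>vs\<in>?V. \<bar>c vs\<bar>)"
  show thesis
  proof (rule that[of B], intro allI impI)
    fix vs :: "((real^'n)^'N) list" assume vs: "set vs \<subseteq> Basis \<and> length vs \<le> K"
    have "\<bar>c vs\<bar> \<le> B" unfolding B_def using vs by (intro member_le_sum finite_derivative_lists) auto
    then have cB: "c vs \<le> B" by simp
    have "AE x in lebesgue. \<forall>\<Xi>. norm (Dlist vs (a x) \<Xi>) \<le> c vs * jbr \<Xi> powr (m - \<rho> * real (length vs))"
      using c vs by blast
    then show "AE x in lebesgue. \<forall>\<Xi>. norm (Dlist vs (a x) \<Xi>) \<le> B * jbr \<Xi> powr (m - \<rho> * real (length vs))"
      by eventually_elim (meson cB mult_right_mono order_trans powr_ge_zero)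
  qed
qed

section \<open>Weighted estimates\<close>

lemma enn_powr_prod: "enn_powr (\<Prod>i\<in>I. f i) e = (\<Prod>i\<in>I. enn_powr (f i) e)"
proof (induction I rule: infinite_finite_induct)
  case (insert x F)
  then show ?case by (simp add: enn_powr_mult)
qed (use enn_powr_ennreal[of 1 e] in simp_all)

lemma maxfun_le_wnorm_infinity:
  assumes "0 < p"
  shows "maxfun p u x \<le> wnorm \<infinity> w u"
proof -
  have "maxfun p u x \<le> c" if "AE x in lebesgue. ennreal (norm (u x)) \<le> c" for c
  proof (cases c)
    case (real b)
    from that have "AE x in lborel. ennreal (norm (u x)) \<le> c" by (simp only: AE_completion_iff)
    then have "AE x in lborel. norm (u x) \<le> b" by eventually_elim (simp add: real)
    then show ?thesis using maxfun_le[OF assms real(1)] by (simp add: real(2))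
  qed simp
  then show ?thesis unfolding wnorm_def by (auto intro: Inf_greatest)
qed

text \<open>Packs what Hoelder's inequality needs for one finite exponent: a positive Borel version
  v of the weight w, and a constant G in the weighted maximal inequality. Both can then be chosen
  for all indices at once.\<close>

definition maxfun_bounded :: "real \<Rightarrow> real \<Rightarrow> ('a::euclidean_space \<Rightarrow> real) \<Rightarrow> ('a \<Rightarrow> real) \<Rightarrow> real \<Rightarrow> bool" where
  "maxfun_bounded p q w v G \<longleftrightarrow> v \<in> borel_measurable borel \<and> (\<forall>x. 0 < v x) \<and> (AE x in lborel. w x = v x) \<and> 0 \<le> G \<and>
    (\<forall>u. u \<in> borel_measurable borel \<longrightarrow>
      (\<integral>\<^sup>+x. ennreal (v x) * enn_powr (maxfun p u x) q \<partial>lborel) \<le> ennreal G * (\<integral>\<^sup>+x. ennreal (norm (u x) powr q * w x) \<partial>lborel))"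

lemma muckenhoupt_maxfun_bound:
  fixes w :: "'a::euclidean_space \<Rightarrow> real"
  assumes "muckenhoupt (q / p) w" "0 < p" "\<not> (AE x in lborel. w x = 0)"
  shows "\<exists>v G. maxfun_bounded p q w v G"
  using assms(1)
proof (cases rule: muckenhoupt_cases)
  case zero
  then show ?thesis using assms(3) by blast
next
  case (weight v A)
  obtain G where G: "0 \<le> G" and bd: "\<And>u. u \<in> borel_measurable borel \<Longrightarrow>
      (\<integral>\<^sup>+x. ennreal (v x) * enn_powr (maxfun p u x) q \<partial>lborel) \<le> ennreal G * (\<integral>\<^sup>+x. ennreal (norm (u x) powr q * v x) \<partial>lborel)"
    using maxfun_weighted_bound[OF weight(1) assms(2)] by blast
  have "(\<integral>\<^sup>+x. ennreal (norm (u x) powr q * v x) \<partial>lborel) = (\<integral>\<^sup>+x. ennreal (norm (u x) powr q * w x) \<partial>lborel)" for u :: "'a \<Rightarrow> complex"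
    using weight(2) by (intro nn_integral_cong_AE, eventually_elim) simp
  then show ?thesis unfolding maxfun_bounded_def
    using G bd weight Ap_weight.w_meas[OF weight(1)] Ap_weight.w_pos[OF weight(1)] by auto
qed

text \<open>Everything is raised to the power r, which may be less than 1. Indices with infinite
  exponent are pulled out of the integral through their sup norms; the others enter Hoelder's
  inequality with exponents r/Q_j, which sum to 1, and the maximal inequality is applied to each
  resulting integral.\<close>

lemma weighted_multilinear_holder:
  fixes u :: "'N::finite \<Rightarrow> 'a::euclidean_space \<Rightarrow> complex" and w :: "'N \<Rightarrow> 'a \<Rightarrow> real" and T :: "'a \<Rightarrow> complex"
  assumes r: "0 < r" and p: "\<And>j. 0 < p j" and C0: "0 \<le> C0"
    and J: "\<And>j. j \<in> J \<Longrightarrow> q j = ennreal (Q j) \<and> 0 < Q j" "\<And>j. j \<notin> J \<Longrightarrow> q j = \<infinity> \<and> w j = (\<lambda>_. 1)"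
    and sum: "(\<Sum>j\<in>J. r / Q j) = 1"
    and mb: "\<And>j. j \<in> J \<Longrightarrow> maxfun_bounded (p j) (Q j) (w j) (v j) (G j)"
    and u: "\<And>j. u j \<in> borel_measurable borel"
    and T: "AE x in lebesgue. ennreal (norm (T x)) \<le> ennreal C0 * (\<Prod>j\<in>UNIV. maxfun (p j) (u j) x)"
  shows "wnorm (ennreal r) (\<lambda>x. \<Prod>j\<in>UNIV. w j x powr (r / enn2real (q j))) T
    \<le> ennreal (C0 * (\<Prod>j\<in>J. G j powr (1 / Q j))) * (\<Prod>j\<in>UNIV. wnorm (q j) (w j) (u j))"
proof -
  have v: "v j \<in> borel_measurable borel \<and> (\<forall>x. 0 < v j x) \<and> (AE x in lborel. w j x = v j x)"
    and G: "0 \<le> G j" "(\<integral>\<^sup>+x. ennreal (v j x) * enn_powr (maxfun (p j) (u j) x) (Q j) \<partial>lborel)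
      \<le> ennreal (G j) * (\<integral>\<^sup>+x. ennreal (norm (u j x) powr Q j * w j x) \<partial>lborel)" if "j \<in> J" for j
    using mb[OF that] u unfolding maxfun_bounded_def by auto
  define N where "N = (\<lambda>j. wnorm (q j) (w j) (u j))"
  define f where "f = (\<lambda>j x. ennreal (v j x) * enn_powr (maxfun (p j) (u j) x) (Q j))"
  define S where "S = (\<lambda>j. \<integral>\<^sup>+x. ennreal (norm (u j x) powr Q j * w j x) \<partial>lborel)"
  have split: "(\<Prod>j\<in>UNIV. g j) = (\<Prod>j\<in>- J. g j) * (\<Prod>j\<in>J. g j)" for g :: "'N \<Rightarrow> ennreal"
    using prod.subset_diff[of J UNIV g] by (simp add: Compl_eq_Diff_UNIV)
  have NJ: "N j = enn_powr (S j) (1 / Q j)" if "j \<in> J" for j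
    using J(1)[OF that] unfolding N_def wnorm_def S_def by (simp add: nn_integral_completion less_imp_le)
  have mono_pow: "\<And>X Y. X \<le> Y \<Longrightarrow> enn_powr X r \<le> enn_powr Y r" using r by (intro enn_powr_mono) auto
  have AEv: "AE x in lborel. \<forall>j\<in>J. w j x = v j x"
    using v by (intro AE_finite_allI) auto
  have "(\<integral>\<^sup>+x. ennreal (norm (T x) powr r * (\<Prod>j\<in>UNIV. w j x powr (r / enn2real (q j)))) \<partial>lborel)
    \<le> (\<integral>\<^sup>+x. (ennreal (C0 powr r) * (\<Prod>j\<in>- J. enn_powr (N j) r)) * (\<Prod>j\<in>J. enn_powr (f j x) (r / Q j)) \<partial>lborel)"
  proof (rule nn_integral_mono_AE)
    from T have "AE x in lborel. ennreal (norm (T x)) \<le> ennreal C0 * (\<Prod>j\<in>UNIV. maxfun (p j) (u j) x)"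
      by (simp only: AE_completion_iff)
    with AEv show "AE x in lborel. ennreal (norm (T x) powr r * (\<Prod>j\<in>UNIV. w j x powr (r / enn2real (q j))))
      \<le> (ennreal (C0 powr r) * (\<Prod>j\<in>- J. enn_powr (N j) r)) * (\<Prod>j\<in>J. enn_powr (f j x) (r / Q j))"
    proof eventually_elim
      case (elim x)
      let ?M = "\<lambda>j. maxfun (p j) (u j) x"
      let ?w = "\<lambda>j. ennreal (w j x powr (r / enn2real (q j)))"
      have "ennreal (norm (T x) powr r * (\<Prod>j\<in>UNIV. w j x powr (r / enn2real (q j))))
        = enn_powr (ennreal (norm (T x))) r * (\<Prod>j\<in>UNIV. ?w j)"
        by (subst prod_ennreal) (auto simp: enn_powr_ennreal ennreal_mult')
      also have "\<dots> \<le> enn_powr (ennreal C0 * (\<Prod>j\<in>UNIV. ?M j)) r * (\<Prod>j\<in>UNIV. ?w j)"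
        by (intro mult_right_mono mono_pow elim) simp
      also have "\<dots> = ennreal (C0 powr r) * (\<Prod>j\<in>UNIV. enn_powr (?M j) r * ?w j)"
        using C0 by (simp add: enn_powr_mult enn_powr_prod enn_powr_ennreal prod.distrib mult.assoc)
      also have "\<dots> = ennreal (C0 powr r) * ((\<Prod>j\<in>- J. enn_powr (?M j) r * ?w j) * (\<Prod>j\<in>J. enn_powr (?M j) r * ?w j))"
        unfolding split ..
      also have "(\<Prod>j\<in>J. enn_powr (?M j) r * ?w j) = (\<Prod>j\<in>J. enn_powr (f j x) (r / Q j))"
      proof (rule prod.cong[OF refl])
        fix j assume j: "j \<in> J"
        have "?w j = enn_powr (ennreal (v j x)) (r / Q j)"
          using elim(1) j J(1)[OF j] v[OF j] by (simp add: enn_powr_ennreal less_imp_le)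
        then show "enn_powr (?M j) r * ?w j = enn_powr (f j x) (r / Q j)"
          using J(1)[OF j] by (simp add: f_def enn_powr_mult enn_powr_powr mult.commute)
      qed
      also have "(\<Prod>j\<in>- J. enn_powr (?M j) r * ?w j) \<le> (\<Prod>j\<in>- J. enn_powr (N j) r)"
      proof (rule prod_mono_ennreal)
        fix j assume "j \<in> - J"
        \<comment> \<open>Here \<open>enn2real \<infinity>\<close> is 0 and so is the quotient by
          it; the weight being 1, its factor is 1.\<close>
        then have "q j = \<infinity>" "w j = (\<lambda>_. 1)" using J(2) by auto
        then show "enn_powr (?M j) r * ?w j \<le> enn_powr (N j) r"
          using mono_pow[OF maxfun_le_wnorm_infinity[OF p, of j "u j" x "w j"]] by (simp add: N_def)
      qed
      finally show ?case by (simp add: mult_left_mono mult_right_mono mult.assoc)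
    qed
  qed
  also have "\<dots> = (ennreal (C0 powr r) * (\<Prod>j\<in>- J. enn_powr (N j) r)) * (\<integral>\<^sup>+x. (\<Prod>j\<in>J. enn_powr (f j x) (r / Q j)) \<partial>lborel)"
  proof (rule nn_integral_cmult)
    have "f j \<in> borel_measurable borel" if "j \<in> J" for j
      unfolding f_def using v[OF that] maxfun_measurable[OF p] by (intro borel_measurable_times_ennreal enn_powr_measurable) auto
    then show "(\<lambda>x. \<Prod>j\<in>J. enn_powr (f j x) (r / Q j)) \<in> borel_measurable lborel"
      by (intro borel_measurable_prod_ennreal enn_powr_measurable) auto
  qed
  also have "(\<integral>\<^sup>+x. (\<Prod>j\<in>J. enn_powr (f j x) (r / Q j)) \<partial>lborel) \<le> (\<Prod>j\<in>J. enn_powr (\<integral>\<^sup>+x. f j x \<partial>lborel) (r / Q j))"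
  proof (rule nn_integral_prod_powr_le[OF _ sum])
    fix j assume j: "j \<in> J"
    show "0 < r / Q j" using r J(1)[OF j] by simp
    show "f j \<in> borel_measurable lborel"
      unfolding f_def using v[OF j] maxfun_measurable[OF p] by (intro borel_measurable_times_ennreal enn_powr_measurable) auto
  qed simp
  also have "\<dots> \<le> (\<Prod>j\<in>J. enn_powr (ennreal (G j) * S j) (r / Q j))"
    using r J(1) G(2) unfolding f_def S_def by (intro prod_mono_ennreal enn_powr_mono) (auto simp: less_imp_le)
  finally have main: "(\<integral>\<^sup>+x. ennreal (norm (T x) powr r * (\<Prod>j\<in>UNIV. w j x powr (r / enn2real (q j)))) \<partial>lborel)
    \<le> (ennreal (C0 powr r) * (\<Prod>j\<in>- J. enn_powr (N j) r)) * (\<Prod>j\<in>J. enn_powr (ennreal (G j) * S j) (r / Q j))"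
    by (simp add: mult_left_mono)
  have "wnorm (ennreal r) (\<lambda>x. \<Prod>j\<in>UNIV. w j x powr (r / enn2real (q j))) T
    = enn_powr (\<integral>\<^sup>+x. ennreal (norm (T x) powr r * (\<Prod>j\<in>UNIV. w j x powr (r / enn2real (q j)))) \<partial>lborel) (1 / r)"
    unfolding wnorm_def using r by (simp add: nn_integral_completion)
  also have "\<dots> \<le> enn_powr ((ennreal (C0 powr r) * (\<Prod>j\<in>- J. enn_powr (N j) r)) * (\<Prod>j\<in>J. enn_powr (ennreal (G j) * S j) (r / Q j))) (1 / r)"
    using r by (intro enn_powr_mono main) simp
  also have "\<dots> = ennreal C0 * (\<Prod>j\<in>- J. N j) * (\<Prod>j\<in>J. enn_powr (ennreal (G j) * S j) (1 / Q j))"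
    using r C0 by (simp add: enn_powr_mult enn_powr_prod enn_powr_powr enn_powr_ennreal powr_powr)
  also have "(\<Prod>j\<in>J. enn_powr (ennreal (G j) * S j) (1 / Q j)) = (\<Prod>j\<in>J. ennreal (G j powr (1 / Q j)) * N j)"
    using G(1) by (intro prod.cong) (auto simp: enn_powr_mult enn_powr_ennreal NJ)
  also have "\<dots> = ennreal (\<Prod>j\<in>J. G j powr (1 / Q j)) * (\<Prod>j\<in>J. N j)"
    by (simp add: prod.distrib prod_ennreal)
  also have "ennreal C0 * (\<Prod>j\<in>- J. N j) * (ennreal (\<Prod>j\<in>J. G j powr (1 / Q j)) * (\<Prod>j\<in>J. N j))
    = ennreal (C0 * (\<Prod>j\<in>J. G j powr (1 / Q j))) * (\<Prod>j\<in>UNIV. N j)"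
    unfolding split ennreal_mult'[OF C0] by (simp only: mult_ac)
  finally show ?thesis unfolding N_def .
qed

text \<open>The order of the quantifiers in the first part encodes the dependence of the constant: K
  comes before the bound B on the derivatives up to order K, and C is chosen before the symbol and
  the u_j.\<close>

theorem theorem3p3:
  fixes p :: "'N::finite \<Rightarrow> real" and m \<rho> :: real
  assumes p_range: "\<And>j. 1 \<le> p j \<and> p j \<le> 2"
    and rho_range: "0 \<le> \<rho>" "\<rho> \<le> 1"
    and m_bound: "m < (\<rho> - 1) * (\<Sum>j\<in>UNIV. real CARD('n) / p j)"
  shows
    "(\<exists>K::nat. \<forall>B::real. \<exists>C::real. \<forall>(a :: real^'n \<Rightarrow> (real^'n)^'N \<Rightarrow> complex).
        symbol_class m \<rho> a \<longrightarrow>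
        (\<forall>vs. set vs \<subseteq> Basis \<and> length vs \<le> K \<longrightarrow>
           (AE x in lebesgue. \<forall>\<Xi>. norm (Dlist vs (a x) \<Xi>) \<le> B * jbr \<Xi> powr (m - \<rho> * real (length vs)))) \<longrightarrow>
        (\<forall>u :: 'N \<Rightarrow> real^'n \<Rightarrow> complex. (\<forall>j. schwartz (u j)) \<longrightarrow>
           (AE x in lebesgue. ennreal (norm (T_op a u x)) \<le> ennreal C * (\<Prod>j\<in>UNIV. maxfun (p j) (u j) x))))
   \<and>
    (\<forall>(a :: real^'n \<Rightarrow> (real^'n)^'N \<Rightarrow> complex) (q :: 'N \<Rightarrow> ennreal) (r :: real)
        (w :: 'N \<Rightarrow> real^'n \<Rightarrow> real).
        symbol_class m \<rho> a \<longrightarrow>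
        (\<forall>j. ennreal (p j) < q j) \<longrightarrow> 0 < r \<longrightarrow>
        ennreal (1 / r) = (\<Sum>j\<in>UNIV. 1 / q j) \<longrightarrow>
        (\<forall>j. (q j < \<infinity> \<longrightarrow> muckenhoupt (enn2real (q j) / p j) (w j)) \<and>
             (q j = \<infinity> \<longrightarrow> w j = (\<lambda>_. 1))) \<longrightarrow>
        (\<exists>C::real. \<forall>u :: 'N \<Rightarrow> real^'n \<Rightarrow> complex. (\<forall>j. schwartz (u j)) \<longrightarrow>
           wnorm (ennreal r) (\<lambda>x. \<Prod>j\<in>UNIV. w j x powr (r / enn2real (q j))) (T_op a u)
             \<le> ennreal C * (\<Prod>j\<in>UNIV. wnorm (q j) (w j) (u j))))"
proof -
  have p_pos: "0 < p j" for j using p_range[of j] by linarith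
  obtain K C where C: "0 < C"
    and K: "\<forall>B (a :: real^'n \<Rightarrow> (real^'n)^'N \<Rightarrow> complex) (u :: 'N \<Rightarrow> real^'n \<Rightarrow> complex).
      symbol_class m \<rho> a \<longrightarrow>
      (\<forall>vs. set vs \<subseteq> Basis \<and> length vs \<le> K \<longrightarrow>
        (AE x in lebesgue. \<forall>\<Xi>. norm (Dlist vs (a x) \<Xi>) \<le> B * jbr \<Xi> powr (m - \<rho> * real (length vs)))) \<longrightarrow>
      (\<forall>j. schwartz (u j)) \<longrightarrow>
      (AE x in lebesgue. ennreal (norm (T_op a u x)) \<le> ennreal (C * max B 0) * (\<Prod>j\<in>UNIV. maxfun (p j) (u j) x))"
    by (rule T_op_pointwise_bound[OF p_range rho_range m_bound])
  show ?thesis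
  proof (intro conjI exI[of _ K] allI impI, goal_cases)
    case (1 B)
    show ?case using K by (intro exI[of _ "C * max B 0"]) blast
  next
    case (2 a q r w)
    note a = 2(1) and qp = 2(2) and r = 2(3) and qsum = 2(4) and w = 2(5)
    obtain B where B: "\<forall>vs. set vs \<subseteq> Basis \<and> length vs \<le> K \<longrightarrow>
           (AE x in lebesgue. \<forall>\<Xi>. norm (Dlist vs (a x) \<Xi>) \<le> B * jbr \<Xi> powr (m - \<rho> * real (length vs)))"
      using symbol_class_uniform_bound[OF a, of K] by blast
    define C0 where "C0 = C * max B 0"
    have C0: "0 \<le> C0" using C by (simp add: C0_def)
    have T: "AE x in lebesgue. ennreal (norm (T_op a u x)) \<le> ennreal C0 * (\<Prod>j\<in>UNIV. maxfun (p j) (u j) x)"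
      if "\<forall>j. schwartz (u j)" for u :: "'N \<Rightarrow> real^'n \<Rightarrow> complex"
      unfolding C0_def using K a B that by blast
    define J where "J = {j. q j < \<infinity>}"
    define Q where "Q = (\<lambda>j. enn2real (q j))"
    have QJ: "q j = ennreal (Q j)" "0 < Q j" if "j \<in> J" for j
    proof -
      show e: "q j = ennreal (Q j)" using that by (simp add: J_def Q_def)
      have "ennreal (p j) < ennreal (Q j)" using qp e by metis
      then show "0 < Q j" using p_pos[of j] by (simp add: ennreal_less_iff)
    qed
    have nJ: "q j = \<infinity>" "w j = (\<lambda>_. 1)" if "j \<notin> J" for j
    proof -
      show "q j = \<infinity>" using that by (simp add: J_def less_top[symmetric])
      then show "w j = (\<lambda>_. 1)" using w by blast
    qed
    \<comment> \<open>Infinite exponents contribute 1/\<infinity> = 0, so the scaling condition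
      lives on J alone.\<close>
    have sum1: "(\<Sum>j\<in>J. r / Q j) = 1"
    proof -
      have "(\<Sum>j\<in>UNIV. 1 / q j) = (\<Sum>j\<in>J. 1 / q j)"
        by (intro sum.mono_neutral_right) (auto simp: nJ)
      also have "\<dots> = (\<Sum>j\<in>J. ennreal (1 / Q j))"
        using QJ by (intro sum.cong) (auto simp: divide_ennreal simp flip: ennreal_1)
      also have "\<dots> = ennreal (\<Sum>j\<in>J. 1 / Q j)" using QJ by (intro sum_ennreal) (auto simp: less_imp_le)
      finally have "ennreal (1 / r) = ennreal (\<Sum>j\<in>J. 1 / Q j)" using qsum by simp
      then have "1 / r = (\<Sum>j\<in>J. 1 / Q j)"
        using r QJ by (subst (asm) ennreal_inj) (auto intro!: sum_nonneg simp: less_imp_le)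
      then have "r * (1 / r) = (\<Sum>j\<in>J. r / Q j)" by (simp add: sum_distrib_left)
      then show ?thesis using r by simp
    qed
    show ?case
    proof (cases "\<exists>j\<in>J. AE x in lborel. w j x = 0")
      case True
      then obtain j where j: "j \<in> J" "AE x in lborel. w j x = 0" by blast
      \<comment> \<open>One weight vanishing almost everywhere makes the product weight vanish too,
        so the left side is 0 and the constant 0 serves.\<close>
      have "wnorm (ennreal r) (\<lambda>x. \<Prod>j\<in>UNIV. w j x powr (r / enn2real (q j))) (T_op a u) = 0" for u
      proof -
        have "AE x in lborel. (\<Prod>j\<in>UNIV. w j x powr (r / enn2real (q j))) = 0"
          using j(2) by eventually_elim (auto simp: prod_zero_iff intro: exI[of _ j])
        then have "(\<integral>\<^sup>+x. ennreal (norm (T_op a u x) powr r * (\<Prod>j\<in>UNIV. w j x powr (r / enn2real (q j)))) \<partial>lborel)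
          = (\<integral>\<^sup>+x. 0 \<partial>(lborel :: (real^'n) measure))"
          by (intro nn_integral_cong_AE, eventually_elim) (simp only: mult_zero_right ennreal_0)
        then show ?thesis unfolding wnorm_def using r by (simp add: nn_integral_completion)
      qed
      then show ?thesis by (intro exI[of _ 0]) simp
    next
      case False
      \<comment> \<open>Version and constant are chosen as a pair, so that a single application of
        choice suffices.\<close>
      have "\<forall>j. \<exists>vG. j \<in> J \<longrightarrow> maxfun_bounded (p j) (Q j) (w j) (fst vG) (snd vG)"
      proof
        fix j
        show "\<exists>vG. j \<in> J \<longrightarrow> maxfun_bounded (p j) (Q j) (w j) (fst vG) (snd vG)"
        proof (cases "j \<in> J")
          case True
          then have "muckenhoupt (Q j / p j) (w j)" using w unfolding J_def Q_def by blast
          from muckenhoupt_maxfun_bound[OF this p_pos] False True show ?thesis by fastforce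
        qed simp
      qed
      from choice[OF this] obtain vG
        where vG: "\<And>j. j \<in> J \<Longrightarrow> maxfun_bounded (p j) (Q j) (w j) (fst (vG j)) (snd (vG j))"
        by blast
      show ?thesis
      proof (intro exI[of _ "C0 * (\<Prod>j\<in>J. snd (vG j) powr (1 / Q j))"] allI impI)
        fix u :: "'N \<Rightarrow> real^'n \<Rightarrow> complex" assume u: "\<forall>j. schwartz (u j)"
        show "wnorm (ennreal r) (\<lambda>x. \<Prod>j\<in>UNIV. w j x powr (r / enn2real (q j))) (T_op a u)
          \<le> ennreal (C0 * (\<Prod>j\<in>J. snd (vG j) powr (1 / Q j))) * (\<Prod>j\<in>UNIV. wnorm (q j) (w j) (u j))"
          using QJ nJ vG u
          by (intro weighted_multilinear_holder[OF r p_pos C0 _ _ sum1 _ _ T[OF u], where v = "\<lambda>j. fst (vG j)"])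
            (auto intro: schwartz_borel)
      qed
    qed
  qed
qed

end
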